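(* Let $L=L(v)$ be either the Hill operator with a $\pi$-periodic potential $v\in H^{-1}_{per}(\mathbb{R})$, or the one-dimensional Dirac operator with a potential $v=\begin{pmatrix}0&P\\Q&0\end{pmatrix}$, $P,Q\in L^2([0,\pi],\mathbb{C})$. Suppose that the set $\mathcal{M}=\{n:\lambda_n^+\neq\lambda_n^-\}$ is infinite. Then there exist $N^*\in\mathbb{N}$ and a sequence of positive numbers $\eta_n\to 0$ such that for all $n\in\mathcal{M}$ with $|n|>N^*$ $$\frac{2\sqrt{t_n}}{1+t_n}-\eta_n\;\le\;\frac{|\gamma_n|}{|\beta_n^-(z_n^* )|+|\beta_n^+(z_n^* )|}\;\le\;\frac{2\sqrt{t_n}}{1+t_n}+\eta_n,$$ where $$t_n=\begin{cases}\max\left(\dfrac{|\beta_n^-(z_n^* )|}{|\beta_n^+(z_n^* )|},\dfrac{|\beta_n^+(z_n^* )|}{|\beta_n^-(z_n^* )|}\right)&\text{if }\beta_n^-(z_n^* )\beta_n^+(z_n^* )\neq 0,\\[2mm] \infty&\text{if }\beta_n^-(z_n^* )\beta_n^+(z_n^* )=0,\end{cases}$$ and $\frac{2\sqrt t}{1+t}=0$ for $t=\infty$.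
   Context: Hill operator: $v\in H^{-1}_{per}(\mathbb{R})$ is a complex-valued $\pi$-periodic distribution $v=C+q'$ with $C\in\mathbb{C}$ and $q\in L^2_{loc}(\mathbb{R})$ $\pi$-periodic. $Ly=-y''+v(x)y$ on $[0,\pi]$ is understood as $Ly=-(y'-qy)'-qy'+Cy$ for $y\in W^1_2([0,\pi])$ with $y'-qy\in W^1_1([0,\pi])$, $Ly\in L^2([0,\pi])$. Boundary conditions: $Dir$: $y(0)=y(\pi)=0$; $Per^\pm$: $y(\pi)=\pm y(0)$, $(y'-qy)(\pi)=\pm(y'-qy)(0)$ (for $v\in L^2$ this is $y'(\pi)=\pm y'(0)$). Dirac operator: $Ly=i\begin{pmatrix}1&0\\0&-1\end{pmatrix}\frac{dy}{dx}+v(x)y$, $y=\begin{pmatrix}y_1\\ y_2\end{pmatrix}$ on $[0,\pi]$. $Dir$: $y_1(0)=y_2(0)$, $y_1(\pi)=y_2(\pi)$; $Per^\pm$: $y_1(\pi)=\pm y_1(0)$, $y_2(\pi)=\pm y_2(0)$. Eigenvalues: indices are $n\in\mathbb{N}$, $\lambda_n^0=n^2$ (Hill), $n\in\mathbb{Z}$, $\lambda^0_n=n$ (Dirac). For large enough $|n|$ the disc $|\lambda-\lambda_n^0|<n/4$ (Hill), resp. $|\lambda-\lambda_n^0|<1/2$ (Dirac), contains exactly two eigenvalues $\lambda_n^-,\lambda_n^+$ (counted with multiplicity) of $L$ with condition $Per^+$ if $n$ is even, $Per^-$ if $n$ is odd. $\lambda_n^+$ is the one with larger real part (larger imaginary part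 if the real parts are equal). Put $\gamma_n=\lambda_n^+-\lambda_n^-$, $z_n^\pm=\lambda_n^\pm-\lambda_n^0$, $z_n^*=\frac12(z_n^++z_n^-)$. Functionals $\alpha_n(z),\beta_n^\pm(z)$ (depending on $v$; analytic in $z$, defined for large $|n|$ and $|z|\le n/4$ (Hill), $|z|\le 1/2$ (Dirac)). Hill: with $v=\sum_{m\in2\mathbb{Z}}V(m)e^{imx}$, and all sums over $j_1,\dots,j_k\in(n+2\mathbb{Z})\setminus\{\pm n\}$, $$\alpha_n(z)=V(0)+\sum_{k\ge1}\sum_{j_1,\dots,j_k}\frac{V(-n-j_1)V(j_1-j_2)\cdots V(j_{k-1}-j_k)V(j_k+n)}{\prod_{i=1}^k(n^2-j_i^2+z)},$$ $$\beta_n^\pm(z)=V(\pm2n)+\sum_{k\ge1}\sum_{j_1,\dots,j_k}\frac{V(\pm n-j_1)V(j_1-j_2)\cdots V(j_{k-1}-j_k)V(j_k\pm n)}{\prod_{i=1}^k(n^2-j_i^2+z)}.$$ Dirac: with $P=\sum_{m\in2\mathbb{Z}}p(m)e^{imx}$, $Q=\sum_{m\in2\mathbb{Z}}q(m)e^{imx}$, and all sums over $j_1,\dots,j_k\in(n+2\mathbb{Z})\setminus\{n\}$, $$\alpha_n(z)=\sum_{k\ge1\text{ odd}}\sum_{j_1,\dots,j_k}\frac{p(-n-j_1)q(j_1+j_2)p(-j_2-j_3)\cdots q(j_k+n)}{\prod_{i=1}^k(n-j_i+z)},$$ $$\beta_n^-(z)=p(-2n)+\sum_{k\ge2\text{ even}}\sum_{j_1,\dots,j_k}\frac{p(-n-j_1)q(j_1+j_2)p(-j_2-j_3)\cdots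 p(-j_k-n)}{\prod_{i=1}^k(n-j_i+z)},$$ $$\beta_n^+(z)=q(2n)+\sum_{k\ge2\text{ even}}\sum_{j_1,\dots,j_k}\frac{q(n+j_1)p(-j_1-j_2)q(j_2+j_3)\cdots q(j_k+n)}{\prod_{i=1}^k(n-j_i+z)}.$$ Known property: $\lambda_n^0+z$, with $|z|\le n/4$ (resp. $|z|\le1/2$), is a periodic ($n$ even) or antiperiodic ($n$ odd) eigenvalue of $L$ if and only if $(z-\alpha_n(z))^2=\beta_n^-(z)\beta_n^+(z)$, and $z_n^\pm$ are the only solutions. *)

theory Defs
  imports "HOL-Analysis.Analysis" "HOL-Library.Function_Algebras"
begin

section \<open>Function spaces\<close>

definition L2_on :: "real set \<Rightarrow> (real \<Rightarrow> complex) \<Rightarrow> bool" where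
  "L2_on S f \<longleftrightarrow> f \<in> borel_measurable (lebesgue_on S)
     \<and> integrable (lebesgue_on S) (\<lambda>x. (cmod (f x))\<^sup>2)"

text \<open>\<open>W11 y g\<close>: \<open>y\<close> is the absolutely continuous representative of an element of
  \<open>W\<^sup>1\<^sub>1([0,\<pi>])\<close>, and its derivative is \<open>g\<close> (determined up to a null set).
  It belongs to \<open>W\<^sup>1\<^sub>2([0,\<pi>])\<close> iff moreover \<open>L2_on {0..pi} g\<close>.\<close>

definition W11 :: "(real \<Rightarrow> complex) \<Rightarrow> (real \<Rightarrow> complex) \<Rightarrow> bool" where
  "W11 y g \<longleftrightarrow> g absolutely_integrable_on {0..pi}
     \<and> (\<forall>x\<in>{0..pi}. y x = y 0 + integral {0..x} g)"

definition W12 :: "(real \<Rightarrow> complex) \<Rightarrow> (real \<Rightarrow> complex) \<Rightarrow> bool" where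
  "W12 y g \<longleftrightarrow> W11 y g \<and> L2_on {0..pi} g"

definition fourier_coeff :: "(real \<Rightarrow> complex) \<Rightarrow> int \<Rightarrow> complex" where
  "fourier_coeff f m =
     integral {0..pi} (\<lambda>x. f x * exp (- (\<i> * of_int m * of_real x))) / of_real pi"


section \<open>The operators\<close>

text \<open>An operator in \<open>L\<^sup>2([0,\<pi>])\<close> is represented by its graph, a set of pairs \<open>(y, f)\<close> with
  \<open>y\<close> in the domain and \<open>Ly = f\<close> almost everywhere. So that distinct functions \<open>y\<close> represent
  distinct elements of \<open>L\<^sup>2([0,\<pi>])\<close>, each \<open>y\<close> is the continuous representative on \<open>[0,\<pi>]\<close>
  and is set to \<open>0\<close> elsewhere. The sign \<open>s = \<plusminus>1\<close> selects the boundary condition \<open>Per\<^sup>\<plusminus>\<close>.\<close>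

text \<open>The Hill operator with potential \<open>v = C + q'\<close>. Here \<open>w\<close> is the absolutely continuous
  representative of the quasi-derivative \<open>y' - q y\<close>.\<close>

definition hill_graph ::
  "complex \<Rightarrow> (real \<Rightarrow> complex) \<Rightarrow> complex \<Rightarrow> ((real \<Rightarrow> complex) \<times> (real \<Rightarrow> complex)) set" where
  "hill_graph C q s = {(y, f).
     (\<forall>x. x \<notin> {0..pi} \<longrightarrow> y x = 0) \<and> L2_on {0..pi} f \<and>
     (\<exists>y' w w'. W12 y y' \<and> W11 w w'
        \<and> (AE x in lebesgue_on {0..pi}. w x = y' x - q x * y x)
        \<and> (AE x in lebesgue_on {0..pi}. f x = - w' x - q x * y' x + C * y x)
        \<and> y pi = s * y 0 \<and> w pi = s * w 0)}"

definition dirac_graph ::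
  "(real \<Rightarrow> complex) \<Rightarrow> (real \<Rightarrow> complex) \<Rightarrow> complex
     \<Rightarrow> ((real \<Rightarrow> complex ^ 2) \<times> (real \<Rightarrow> complex ^ 2)) set" where
  "dirac_graph P Q s = {(y, f).
     (\<forall>x. x \<notin> {0..pi} \<longrightarrow> y x = 0) \<and>
     (\<forall>i. L2_on {0..pi} (\<lambda>x. f x $ i)) \<and>
     (\<exists>y'. (\<forall>i. W12 (\<lambda>x. y x $ i) (\<lambda>x. y' x $ i))
        \<and> (AE x in lebesgue_on {0..pi}.
              f x $ 1 = \<i> * y' x $ 1 + P x * y x $ 2 \<and>
              f x $ 2 = - \<i> * y' x $ 2 + Q x * y x $ 1)
        \<and> y pi = s *s y 0)}"


section \<open>Eigenvalues and algebraic multiplicity\<close>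

definition scale1 :: "complex \<Rightarrow> (real \<Rightarrow> complex) \<Rightarrow> (real \<Rightarrow> complex)" where
  "scale1 c y = (\<lambda>x. c * y x)"

definition scale2 :: "complex \<Rightarrow> (real \<Rightarrow> complex ^ 2) \<Rightarrow> (real \<Rightarrow> complex ^ 2)" where
  "scale2 c y = (\<lambda>x. c *s y x)"

lemma vector_space_scale1: "vector_space scale1"
  by unfold_locales (auto simp: scale1_def fun_eq_iff algebra_simps)

lemma vector_space_scale2: "vector_space scale2"
  by unfold_locales (auto simp: scale2_def fun_eq_iff vec_eq_iff algebra_simps)

definition is_eigenvalue ::
  "(complex \<Rightarrow> 'f \<Rightarrow> 'f) \<Rightarrow> ('f::zero \<times> 'f) set \<Rightarrow> complex \<Rightarrow> bool" where
  "is_eigenvalue sc G \<mu> \<longleftrightarrow> (\<exists>y. y \<noteq> 0 \<and> (y, sc \<mu> y) \<in> G)"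

text \<open>\<open>ker_pow sc G \<mu> k\<close> is the kernel of \<open>(L - \<mu>)\<^sup>k\<close>.\<close>

primrec ker_pow ::
  "(complex \<Rightarrow> 'f \<Rightarrow> 'f) \<Rightarrow> ('f \<times> 'f) set \<Rightarrow> complex \<Rightarrow> nat \<Rightarrow> 'f::ab_group_add set" where
  "ker_pow sc G \<mu> 0 = {0}"
| "ker_pow sc G \<mu> (Suc k) = {y. \<exists>f\<in>ker_pow sc G \<mu> k. (y, f + sc \<mu> y) \<in> G}"

definition alg_mult ::
  "(complex \<Rightarrow> 'f \<Rightarrow> 'f) \<Rightarrow> ('f::ab_group_add \<times> 'f) set \<Rightarrow> complex \<Rightarrow> nat" where
  "alg_mult sc G \<mu> = vector_space.dim sc (\<Union>k. ker_pow sc G \<mu> k)"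


section \<open>The two families of operators\<close>

text \<open>\<open>Hill C q\<close> stands for the potential \<open>v = C + q'\<close>, and \<open>Dirac P Q\<close> for the
  potential matrix with off-diagonal entries \<open>P\<close> (upper right) and \<open>Q\<close> (lower left).\<close>

datatype potential =
    Hill complex "real \<Rightarrow> complex"
  | Dirac "real \<Rightarrow> complex" "real \<Rightarrow> complex"

fun admissible :: "potential \<Rightarrow> bool" where
  "admissible (Hill C q) \<longleftrightarrow> (\<forall>x. q (x + pi) = q x) \<and> (\<forall>a b. L2_on {a..b} q)"
| "admissible (Dirac P Q) \<longleftrightarrow> L2_on {0..pi} P \<and> L2_on {0..pi} Q"

fun indices :: "potential \<Rightarrow> int set" where
  "indices (Hill C q) = {1..}"
| "indices (Dirac P Q) = UNIV"

fun lam0 :: "potential \<Rightarrow> int \<Rightarrow> complex" where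
  "lam0 (Hill C q) n = (of_int n)\<^sup>2"
| "lam0 (Dirac P Q) n = of_int n"

fun radius :: "potential \<Rightarrow> int \<Rightarrow> real" where
  "radius (Hill C q) n = of_int n / 4"
| "radius (Dirac P Q) n = 1 / 2"

fun per_eigenvalue :: "potential \<Rightarrow> complex \<Rightarrow> complex \<Rightarrow> bool" where
  "per_eigenvalue (Hill C q) s \<mu> = is_eigenvalue scale1 (hill_graph C q s) \<mu>"
| "per_eigenvalue (Dirac P Q) s \<mu> = is_eigenvalue scale2 (dirac_graph P Q s) \<mu>"

fun per_mult :: "potential \<Rightarrow> complex \<Rightarrow> complex \<Rightarrow> nat" where
  "per_mult (Hill C q) s \<mu> = alg_mult scale1 (hill_graph C q s) \<mu>"
| "per_mult (Dirac P Q) s \<mu> = alg_mult scale2 (dirac_graph P Q s) \<mu>"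

definition per_sign :: "int \<Rightarrow> complex" where
  "per_sign n = (if even n then 1 else - 1)"

text \<open>\<open>a\<close>, \<open>b\<close> are the two eigenvalues in the \<open>n\<close>-th disc, counted with multiplicity,
  and \<open>b\<close> is the larger one in the lexicographic order of real and imaginary parts.\<close>

definition eigenvalue_pair :: "potential \<Rightarrow> int \<Rightarrow> complex \<Rightarrow> complex \<Rightarrow> bool" where
  "eigenvalue_pair v n a b \<longleftrightarrow>
     {\<mu>. per_eigenvalue v (per_sign n) \<mu> \<and> cmod (\<mu> - lam0 v n) < radius v n} = {a, b}
     \<and> (\<forall>\<mu>\<in>{a, b}. per_mult v (per_sign n) \<mu> = count {#a, b#} \<mu>)
     \<and> (Re a < Re b \<or> Re a = Re b \<and> Im a \<le> Im b)"

text \<open>For all but finitely many indices the pair exists. For the remaining ones, where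
  \<open>\<lambda>\<^sub>n\<^sup>\<plusminus>\<close> is not defined, both are set to \<open>\<lambda>\<^sub>n\<^sup>0\<close>.\<close>

definition lam_minus :: "potential \<Rightarrow> int \<Rightarrow> complex" where
  "lam_minus v n = (if \<exists>a b. eigenvalue_pair v n a b
     then THE a. \<exists>b. eigenvalue_pair v n a b else lam0 v n)"

definition lam_plus :: "potential \<Rightarrow> int \<Rightarrow> complex" where
  "lam_plus v n = (if \<exists>a b. eigenvalue_pair v n a b
     then THE b. \<exists>a. eigenvalue_pair v n a b else lam0 v n)"

lemma eigenvalue_pair_unique:
  assumes "eigenvalue_pair v n a b" "eigenvalue_pair v n a' b'"
  shows "a = a'" "b = b'"
proof -
  have "{a, b} = {a', b'}"
    using assms unfolding eigenvalue_pair_def by (elim conjE) (erule subst)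
  then have *: "a = a' \<and> b = b' \<or> a = b' \<and> b = a'"
    by (simp add: doubleton_eq_iff)
  have "Re a < Re b \<or> Re a = Re b \<and> Im a \<le> Im b"
       "Re a' < Re b' \<or> Re a' = Re b' \<and> Im a' \<le> Im b'"
    using assms[unfolded eigenvalue_pair_def, THEN conjunct2, THEN conjunct2] by -
  with * show "a = a'" "b = b'"
    by (elim disjE conjE; simp add: complex_eq_iff)+
qed

lemma lam_eqI:
  assumes "eigenvalue_pair v n a b"
  shows "lam_minus v n = a" "lam_plus v n = b"
proof -
  have "(THE a. \<exists>b. eigenvalue_pair v n a b) = a"
    by (rule the_equality) (use assms eigenvalue_pair_unique(1) in blast)+
  moreover have "(THE b. \<exists>a. eigenvalue_pair v n a b) = b"
    by (rule the_equality) (use assms eigenvalue_pair_unique(2) in blast)+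
  ultimately show "lam_minus v n = a" "lam_plus v n = b"
    unfolding lam_minus_def lam_plus_def using assms by metis+
qed

definition gam :: "potential \<Rightarrow> int \<Rightarrow> complex" where
  "gam v n = lam_plus v n - lam_minus v n"

definition z_plus :: "potential \<Rightarrow> int \<Rightarrow> complex" where
  "z_plus v n = lam_plus v n - lam0 v n"

definition z_minus :: "potential \<Rightarrow> int \<Rightarrow> complex" where
  "z_minus v n = lam_minus v n - lam0 v n"

definition z_star :: "potential \<Rightarrow> int \<Rightarrow> complex" where
  "z_star v n = (z_plus v n + z_minus v n) / 2"


section \<open>The functionals \<open>\<beta>\<^sub>n\<^sup>\<plusminus>\<close>\<close>

text \<open>\<open>chain F G a [j\<^sub>1, \<dots>, j\<^sub>k] b = F a j\<^sub>1 * G j\<^sub>1 j\<^sub>2 * F j\<^sub>2 j\<^sub>3 * \<dots>\<close>, a product of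
  \<open>k + 1\<close> alternating factors, the last one with second argument \<open>b\<close>.\<close>

fun chain :: "(int \<Rightarrow> int \<Rightarrow> complex) \<Rightarrow> (int \<Rightarrow> int \<Rightarrow> complex)
    \<Rightarrow> int \<Rightarrow> int list \<Rightarrow> int \<Rightarrow> complex" where
  "chain F G a [] b = F a b"
| "chain F G a (j # js) b = F a j * chain G F j js b"

definition tuples :: "int set \<Rightarrow> nat \<Rightarrow> int list set" where
  "tuples J k = {js. length js = k \<and> set js \<subseteq> J}"

text \<open>Fourier coefficients of the distribution \<open>C + q'\<close>.\<close>

definition hill_coeff :: "complex \<Rightarrow> (real \<Rightarrow> complex) \<Rightarrow> int \<Rightarrow> complex" where
  "hill_coeff C q m = (if m = 0 then C else \<i> * of_int m * fourier_coeff q m)"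

definition hill_sum ::
  "complex \<Rightarrow> (real \<Rightarrow> complex) \<Rightarrow> int \<Rightarrow> complex \<Rightarrow> int \<Rightarrow> int \<Rightarrow> nat \<Rightarrow> complex" where
  "hill_sum C q n z a b k =
     (let F = (\<lambda>i j. hill_coeff C q (i - j)) in
      \<Sum>\<^sub>\<infinity>js\<in>tuples {j. even (j - n) \<and> j \<noteq> n \<and> j \<noteq> - n} k.
        chain F F a js b / (\<Prod>j\<leftarrow>js. (of_int n)\<^sup>2 - (of_int j)\<^sup>2 + z))"

definition dirac_sum ::
  "(int \<Rightarrow> int \<Rightarrow> complex) \<Rightarrow> (int \<Rightarrow> int \<Rightarrow> complex) \<Rightarrow> int \<Rightarrow> complex \<Rightarrow> nat \<Rightarrow> complex" where
  "dirac_sum F G n z k =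
     (\<Sum>\<^sub>\<infinity>js\<in>tuples {j. even (j - n) \<and> j \<noteq> n} k.
        chain F G n js n / (\<Prod>j\<leftarrow>js. of_int n - of_int j + z))"

fun beta_minus :: "potential \<Rightarrow> int \<Rightarrow> complex \<Rightarrow> complex" where
  "beta_minus (Hill C q) n z =
     hill_coeff C q (- 2 * n) + (\<Sum>k. hill_sum C q n z (- n) n (k + 1))"
| "beta_minus (Dirac P Q) n z =
     fourier_coeff P (- 2 * n)
     + (\<Sum>k. dirac_sum (\<lambda>i j. fourier_coeff P (- i - j)) (\<lambda>i j. fourier_coeff Q (i + j))
              n z (2 * k + 2))"

fun beta_plus :: "potential \<Rightarrow> int \<Rightarrow> complex \<Rightarrow> complex" where
  "beta_plus (Hill C q) n z =
     hill_coeff C q (2 * n) + (\<Sum>k. hill_sum C q n z n (- n) (k + 1))"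
| "beta_plus (Dirac P Q) n z =
     fourier_coeff Q (2 * n)
     + (\<Sum>k. dirac_sum (\<lambda>i j. fourier_coeff Q (i + j)) (\<lambda>i j. fourier_coeff P (- i - j))
              n z (2 * k + 2))"


section \<open>The quantities \<open>t\<^sub>n\<close>\<close>

definition t_ratio :: "potential \<Rightarrow> int \<Rightarrow> ereal" where
  "t_ratio v n =
     (let bm = beta_minus v n (z_star v n); bp = beta_plus v n (z_star v n) in
      if bm * bp \<noteq> 0 then ereal (max (cmod bm / cmod bp) (cmod bp / cmod bm)) else \<infinity>)"

definition t_bound :: "ereal \<Rightarrow> real" where
  "t_bound t = (if t = \<infinity> then 0
     else 2 * sqrt (real_of_ereal t) / (1 + real_of_ereal t))"

end

theory Submission
  imports Defs
begin

text \<open>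
  In terms of Fourier coefficients \<open>Ly = (\<lambda>\<^sub>n\<^sup>0 + z)y\<close> is an infinite linear system. After conjugation
  with \<open>|\<lambda>\<^sub>n\<^sup>0 - \<lambda>\<^sub>j\<^sup>0|\<close> to the power \<open>1/2\<close> its off-resonant block has a Hilbert-Schmidt norm that tends to 0,
  so the off-resonant coefficients can be eliminated by a Neumann series. What remains is a \<open>2\<times>2\<close> system with
  determinant \<open>(z - \<alpha>\<^sub>n(z))\<^sup>2 - \<beta>\<^sub>n\<^sup>-(z) \<beta>\<^sub>n\<^sup>+(z)\<close>. The same norm bounds show that \<open>\<alpha>\<^sub>n\<close> and \<open>\<beta>\<^sub>n\<^sup>\<plusminus>\<close>
  are Lipschitz with constants \<open>\<epsilon>\<^sub>n \<rightarrow> 0\<close>.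

  Let \<open>x \<noteq> y\<close> be the two roots, \<open>X = x - \<alpha>\<^sub>n(x)\<close>, \<open>Y = y - \<alpha>\<^sub>n(y)\<close> and \<open>d = |\<beta>\<^sub>n\<^sup>-(z\<^sub>n\<^sup>*)| + |\<beta>\<^sub>n\<^sup>+(z\<^sub>n\<^sup>*)|\<close>.
  Then \<open>X - Y\<close> is \<open>\<gamma>\<^sub>n\<close> up to a factor \<open>1 + O(\<epsilon>\<^sub>n)\<close>, whereas \<open>X\<^sup>2 - Y\<^sup>2 = O(\<epsilon>\<^sub>n |\<gamma>\<^sub>n| d)\<close>; dividing gives
  \<open>X + Y = O(\<epsilon>\<^sub>n d)\<close>. So \<open>|\<gamma>\<^sub>n|\<close> is close to \<open>2|X|\<close>, which is close to
  \<open>2 |\<beta>\<^sub>n\<^sup>-(z\<^sub>n\<^sup>*) \<beta>\<^sub>n\<^sup>+(z\<^sub>n\<^sup>*)|\<close> to the power \<open>1/2\<close>, and this is \<open>d\<close> times \<open>2 t\<^sub>n\<close> to the power \<open>1/2\<close> over \<open>1 + t\<^sub>n\<close>.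
\<close>

section \<open>Square-integrable functions and Fourier coefficients\<close>

text \<open>For a Hill potential V(m) = i m q_m with q_m merely square summable, so multiplication
  by v is unbounded on l2. Only the symmetrically weighted matrix is small, and weights on one side
  alone would not do. Hilbert-Schmidt norms reduce every product of matrices to Cauchy-Schwarz on
  finite sums. One scheme with alternating matrices F, G serves both operators: Hill takes F = G,
  Dirac takes the two off-diagonal blocks. The threshold 1/8 for the norm has this origin: within
  the disc a denominator keeps at least half of its size at z = 0, which costs a factor 2 per index;
  the Lipschitz bound compares products of k denominators and costs another factor 2 per index; a
  geometric series of ratio 1/2 remains. In the last part the delicate direction is the lower bound
  for the gap. X and Y are square roots of nearly the same number, so they could be close to each
  other and the gap tiny; the smallness of X + Y forces opposite branches. Since |X| is compared
  with the geometric mean only through squares, the final error is of order sqrt(eps).\<close>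

definition per_exp :: "int \<Rightarrow> real \<Rightarrow> complex" where
  "per_exp m x = exp (\<i> * of_int m * of_real x)"

lemma per_exp_add: "per_exp (m + k) x = per_exp m x * per_exp k x"
  by (simp add: per_exp_def algebra_simps exp_add)

lemma per_exp_0 [simp]: "per_exp 0 x = 1" "per_exp m 0 = 1"
  by (simp_all add: per_exp_def)

lemma cmod_per_exp [simp]: "cmod (per_exp m x) = 1"
  by (simp add: per_exp_def norm_exp_eq_Re)

lemma cnj_per_exp: "cnj (per_exp m x) = per_exp (- m) x"
  unfolding per_exp_def by (subst exp_cnj) simp

lemma continuous_on_per_exp [continuous_intros]: "continuous_on S (per_exp m)"
  unfolding per_exp_def by (intro continuous_intros)

lemma per_exp_pi: "per_exp m pi = (if even m then 1 else - 1)"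
proof -
  have "per_exp m pi = cis (of_int m * pi)"
    by (simp add: per_exp_def cis_conv_exp mult_ac)
  also have "\<dots> = (if even m then 1 else - 1)"
    by (auto simp: complex_eq_iff mult.commute elim!: evenE oddE)
  finally show ?thesis .
qed

lemma has_vector_derivative_per_exp:
  "(per_exp m has_vector_derivative \<i> * of_int m * per_exp m x) (at x within S)"
proof -
  have "((\<lambda>z. exp (\<i> * of_int m * z)) has_field_derivative exp (\<i> * of_int m * of_real x) * (\<i> * of_int m))
      (at (of_real x))"
    by (auto intro!: derivative_eq_intros)
  from has_vector_derivative_real_field[OF this, of S] show ?thesis
    by (simp add: per_exp_def [abs_def] mult_ac)
qed

abbreviation "leb_pi \<equiv> lebesgue_on {0..pi}"
abbreviation "L2_pi \<equiv> L2_on {0..pi}"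

lemma finite_measure_leb_pi: "finite_measure leb_pi"
  by (rule finite_measureI) (simp add: emeasure_restrict_space)

lemma space_leb_pi [simp]: "space leb_pi = {0..pi}" by simp

lemma continuous_imp_measurable_leb_pi:
  "continuous_on {0..pi} f \<Longrightarrow> f \<in> borel_measurable leb_pi" for f :: "real \<Rightarrow> complex"
  by (rule continuous_imp_measurable_on_sets_lebesgue) auto

lemma L2_onD:
  assumes "L2_on S f"
  shows "f \<in> borel_measurable (lebesgue_on S)" "integrable (lebesgue_on S) (\<lambda>x. (cmod (f x))\<^sup>2)"
  using assms by (auto simp: L2_on_def)

lemma cmod_add_square_le: "(cmod (a + b))\<^sup>2 \<le> 2 * (cmod a)\<^sup>2 + 2 * (cmod b)\<^sup>2"
proof -
  have "(cmod (a + b))\<^sup>2 \<le> (cmod a + cmod b)\<^sup>2"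
    by (intro power_mono norm_triangle_ineq) simp
  also have "\<dots> \<le> 2 * (cmod a)\<^sup>2 + 2 * (cmod b)\<^sup>2"
    using sum_squares_bound[of "cmod a" "cmod b"] by (simp add: power2_sum)
  finally show ?thesis .
qed

lemma L2_on_add:
  assumes f: "L2_on S f" and g: "L2_on S g"
  shows "L2_on S (\<lambda>x. f x + g x)"
proof -
  note [measurable] = L2_onD(1)[OF f] L2_onD(1)[OF g]
  have "integrable (lebesgue_on S) (\<lambda>x. (cmod (f x + g x))\<^sup>2)"
  proof (rule Bochner_Integration.integrable_bound)
    show "integrable (lebesgue_on S) (\<lambda>x. 2 * (cmod (f x))\<^sup>2 + 2 * (cmod (g x))\<^sup>2)"
      using L2_onD(2)[OF f] L2_onD(2)[OF g] by simp
    show "AE x in lebesgue_on S. norm ((cmod (f x + g x))\<^sup>2) \<le> norm (2 * (cmod (f x))\<^sup>2 + 2 * (cmod (g x))\<^sup>2)"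
      using cmod_add_square_le by (intro AE_I2) simp
  qed measurable
  then show ?thesis unfolding L2_on_def by simp
qed

lemma L2_on_bounded_mult:
  assumes f: "L2_on S f" and g [measurable]: "g \<in> borel_measurable (lebesgue_on S)"
    and B: "\<And>x. x \<in> S \<Longrightarrow> cmod (g x) \<le> B" and S: "S \<in> sets lebesgue"
  shows "L2_on S (\<lambda>x. f x * g x)"
proof -
  note [measurable] = L2_onD(1)[OF f]
  have "integrable (lebesgue_on S) (\<lambda>x. (cmod (f x * g x))\<^sup>2)"
  proof (rule Bochner_Integration.integrable_bound)
    show "integrable (lebesgue_on S) (\<lambda>x. B\<^sup>2 * (cmod (f x))\<^sup>2)"
      using L2_onD(2)[OF f] by simp
    show "AE x in lebesgue_on S. norm ((cmod (f x * g x))\<^sup>2) \<le> norm (B\<^sup>2 * (cmod (f x))\<^sup>2)"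
      using S B by (intro AE_I2)
        (auto simp: norm_mult power_mult_distrib mult.commute[of "B\<^sup>2"] intro!: mult_left_mono power_mono)
  qed measurable
  then show ?thesis unfolding L2_on_def by simp
qed

lemma L2_on_bounded:
  assumes f [measurable]: "f \<in> borel_measurable leb_pi" and B: "\<And>x. x \<in> {0..pi} \<Longrightarrow> cmod (f x) \<le> B"
  shows "L2_pi f"
proof -
  interpret finite_measure leb_pi by (rule finite_measure_leb_pi)
  have "integrable leb_pi (\<lambda>x. (cmod (f x))\<^sup>2)"
    by (rule integrable_const_bound[of _ "B\<^sup>2"]) (use B in \<open>auto intro!: AE_I2 power_mono\<close>)
  then show ?thesis by (simp add: L2_on_def)
qed

lemma L2_on_continuous:
  assumes "continuous_on {0..pi} f"
  shows "L2_pi f"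
proof -
  have "bounded (f ` {0..pi})"
    by (intro compact_imp_bounded compact_continuous_image assms) simp
  then obtain B where "\<And>x. x \<in> {0..pi} \<Longrightarrow> cmod (f x) \<le> B"
    unfolding bounded_iff by blast
  then show ?thesis by (intro L2_on_bounded continuous_imp_measurable_leb_pi assms)
qed

lemma L2_on_scale: "L2_on S f \<Longrightarrow> L2_on S (\<lambda>x. c * f x)"
  by (auto simp: L2_on_def norm_mult power_mult_distrib)

lemma L2_on_diff: "L2_on S f \<Longrightarrow> L2_on S g \<Longrightarrow> L2_on S (\<lambda>x. f x - g x)"
  using L2_on_add[of S f "\<lambda>x. (-1) * g x"] L2_on_scale[of S g "-1"] by simp

lemma L2_on_mult_per_exp: "L2_pi f \<Longrightarrow> L2_pi (\<lambda>x. f x * per_exp m x)"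
  by (rule L2_on_bounded_mult[where B = 1])
     (auto intro!: continuous_imp_measurable_leb_pi continuous_intros)

lemma L2_on_cnj:
  assumes "L2_on S f"
  shows "L2_on S (\<lambda>x. cnj (f x))"
proof -
  have "(\<lambda>x. cnj (f x)) \<in> borel_measurable (lebesgue_on S)"
    by (rule borel_measurable_continuous_on[OF _ L2_onD(1)[OF assms], of cnj]) (intro continuous_intros)
  then show ?thesis using assms by (simp add: L2_on_def)
qed

lemma L2_on_mult_integrable:
  assumes f: "L2_on S f" and g: "L2_on S g"
  shows "integrable (lebesgue_on S) (\<lambda>x. f x * g x)"
proof (rule Bochner_Integration.integrable_bound)
  note [measurable] = L2_onD(1)[OF f] L2_onD(1)[OF g]
  show "integrable (lebesgue_on S) (\<lambda>x. (cmod (f x))\<^sup>2 + (cmod (g x))\<^sup>2)"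
    using L2_onD(2)[OF f] L2_onD(2)[OF g] by simp
  show "(\<lambda>x. f x * g x) \<in> borel_measurable (lebesgue_on S)" by measurable
  show "AE x in lebesgue_on S. norm (f x * g x) \<le> norm ((cmod (f x))\<^sup>2 + (cmod (g x))\<^sup>2)"
  proof (rule AE_I2)
    fix x
    have "cmod (f x) * cmod (g x) \<le> 2 * (cmod (f x) * cmod (g x))" by simp
    also have "\<dots> \<le> (cmod (f x))\<^sup>2 + (cmod (g x))\<^sup>2"
      using sum_squares_bound[of "cmod (f x)" "cmod (g x)"] by (simp add: mult.assoc)
    finally show "norm (f x * g x) \<le> norm ((cmod (f x))\<^sup>2 + (cmod (g x))\<^sup>2)"
      by (simp add: norm_mult)
  qed
qed

lemma integrable_mult_per_exp:
  assumes "integrable leb_pi f"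
  shows "integrable leb_pi (\<lambda>x. f x * per_exp m x)"
proof (rule Bochner_Integration.integrable_bound[OF assms])
  have [measurable]: "per_exp m \<in> borel_measurable leb_pi"
    by (intro continuous_imp_measurable_leb_pi continuous_intros)
  have [measurable]: "f \<in> borel_measurable leb_pi" using assms by simp
  show "(\<lambda>x. f x * per_exp m x) \<in> borel_measurable leb_pi" by measurable
qed (simp add: norm_mult)

lemma L2_on_integrable: "L2_pi f \<Longrightarrow> integrable leb_pi f"
  using L2_on_mult_integrable[of "{0..pi}" f "\<lambda>x. 1"] L2_on_continuous[of "\<lambda>x. 1"] by simp

text \<open>\<open>fourier_coeff\<close> is a gauge integral; in Lebesgue form the theorems on
  linearity and almost everywhere equality apply.\<close>

lemma fourier_coeff_eq:
  assumes "integrable leb_pi f"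
  shows "fourier_coeff f m = (LINT x|leb_pi. f x * per_exp (- m) x) / of_real pi"
  unfolding fourier_coeff_def
  by (subst lebesgue_integral_eq_integral)
     (use integrable_mult_per_exp[OF assms, of "-m"] in \<open>auto simp: per_exp_def\<close>)

lemma fourier_coeff_add:
  assumes "integrable leb_pi f" "integrable leb_pi g"
  shows "fourier_coeff (\<lambda>x. f x + g x) m = fourier_coeff f m + fourier_coeff g m"
  using assms by (simp add: fourier_coeff_eq integrable_mult_per_exp distrib_right add_divide_distrib)

lemma fourier_coeff_scale:
  assumes "integrable leb_pi f"
  shows "fourier_coeff (\<lambda>x. c * f x) m = c * fourier_coeff f m"
  using assms by (simp add: fourier_coeff_eq integrable_mult_per_exp mult.assoc)

lemma fourier_coeff_diff:
  assumes "integrable leb_pi f" "integrable leb_pi g"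
  shows "fourier_coeff (\<lambda>x. f x - g x) m = fourier_coeff f m - fourier_coeff g m"
  using fourier_coeff_add[of f "\<lambda>x. (-1) * g x" m] fourier_coeff_scale[of g "-1" m] assms by simp

lemma fourier_coeff_cong_AE:
  assumes "integrable leb_pi f" "integrable leb_pi g" "AE x in leb_pi. f x = g x"
  shows "fourier_coeff f m = fourier_coeff g m"
proof -
  have "(LINT x|leb_pi. f x * per_exp (- m) x) = (LINT x|leb_pi. g x * per_exp (- m) x)"
    using integrable_mult_per_exp[OF assms(1)] integrable_mult_per_exp[OF assms(2)] assms(3)
    by (intro integral_cong_AE) auto
  then show ?thesis using assms by (simp add: fourier_coeff_eq)
qed

lemma fourier_coeff_mult_per_exp:
  "fourier_coeff (\<lambda>x. f x * per_exp k x) m = fourier_coeff f (m - k)"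
  by (simp add: fourier_coeff_def per_exp_def mult.assoc exp_add [symmetric] algebra_simps)

text \<open>On an interval of length pi exponentials are orthogonal when their frequencies have the
  same parity: then the antiderivative of \<open>per_exp l\<close> takes equal values at both ends.
  Hence expansions run over one residue class modulo 2, even for the periodic and odd for the
  antiperiodic condition.\<close>

lemma fourier_coeff_per_exp:
  assumes "even (m - k)"
  shows "fourier_coeff (per_exp k) m = (if m = k then 1 else 0)"
proof (cases "m = k")
  case True
  have "fourier_coeff (\<lambda>x. 1 * per_exp k x) m = 1"
    unfolding fourier_coeff_mult_per_exp using True by (simp add: fourier_coeff_def scaleR_conv_of_real)
  then show ?thesis using True by simp
next
  case False
  define l where "l = k - m"
  have l: "l \<noteq> 0" "even l" using False assms by (auto simp: l_def)
  have "((\<lambda>x. \<i> * of_int l * per_exp l x) has_integral per_exp l pi - per_exp l 0) {0..pi}"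
    by (intro fundamental_theorem_of_calculus has_vector_derivative_per_exp) simp
  then have "((\<lambda>x. \<i> * of_int l * per_exp l x) has_integral 0) {0..pi}"
    using l by (simp add: per_exp_pi)
  from has_integral_mult_right[OF this, of "1 / (\<i> * of_int l)"]
  have "(per_exp l has_integral 0) {0..pi}" using l by simp
  then have "integral {0..pi} (per_exp l) = 0" by (rule integral_unique)
  moreover have "fourier_coeff (per_exp k) m = integral {0..pi} (per_exp l) / of_real pi"
    unfolding fourier_coeff_def per_exp_def l_def
    by (simp add: exp_add [symmetric] algebra_simps)
  ultimately show ?thesis using False by simp
qed

section \<open>Bessel's inequality for even frequencies\<close>

definition L2_sq :: "(real \<Rightarrow> complex) \<Rightarrow> real" where
  "L2_sq f = (LINT x|leb_pi. (cmod (f x))\<^sup>2)"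

lemma L2_sq_nonneg: "L2_sq f \<ge> 0"
  by (simp add: L2_sq_def)

lemma L2_on_sum:
  "finite S \<Longrightarrow> (\<And>i. i \<in> S \<Longrightarrow> L2_pi (f i)) \<Longrightarrow> L2_pi (\<lambda>x. \<Sum>i\<in>S. f i x)"
  by (induction S rule: finite_induct) (auto intro: L2_on_add L2_on_continuous)

lemma L2_on_per_exp: "L2_pi (per_exp m)"
  by (intro L2_on_continuous continuous_intros)

lemma LINT_mult_per_exp:
  assumes "integrable leb_pi f"
  shows "(LINT x|leb_pi. f x * per_exp m x) = of_real pi * fourier_coeff f (- m)"
  using fourier_coeff_eq[OF assms, of "- m"] by simp

lemma L2_sq_complex: 
  assumes "L2_pi f"
  shows "complex_of_real (L2_sq f) = (LINT x|leb_pi. f x * cnj (f x))"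
  by (simp only: L2_sq_def complex_norm_square [symmetric] integral_complex_of_real)

text \<open>Expand the squared norm of f - p for the partial Fourier sum \<open>p\<close>: the mixed
  and the pure terms all equal pi times the sum of squares, so \<open>L2_sq f\<close> minus that
  quantity is nonnegative.\<close>

lemma bessel_even:
  assumes f: "L2_pi f" and S: "finite S" "\<And>m. m \<in> S \<Longrightarrow> even m"
  shows "(\<Sum>m\<in>S. (cmod (fourier_coeff f m))\<^sup>2) \<le> L2_sq f / pi"
proof -
  define c where "c = fourier_coeff f"
  define p where "p = (\<lambda>x. \<Sum>m\<in>S. c m * per_exp m x)"
  have p: "L2_pi p"
    unfolding p_def by (intro L2_on_sum S(1) L2_on_scale L2_on_per_exp)
  have int: "integrable leb_pi (\<lambda>x. g x * per_exp m x)" if "L2_pi g" for g m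
    using integrable_mult_per_exp[OF L2_on_integrable[OF that]] .
  have pc: "(LINT x|leb_pi. g x * cnj (p x)) = of_real pi * (\<Sum>m\<in>S. fourier_coeff g m * cnj (c m))"
    if g: "L2_pi g" for g
  proof -
    have "(LINT x|leb_pi. g x * cnj (p x)) = (LINT x|leb_pi. (\<Sum>m\<in>S. cnj (c m) * (g x * per_exp (- m) x)))"
      by (simp add: p_def cnj_per_exp sum_distrib_left mult_ac)
    also have "\<dots> = (\<Sum>m\<in>S. cnj (c m) * (LINT x|leb_pi. g x * per_exp (- m) x))"
      by (subst Bochner_Integration.integral_sum) (auto intro!: int g)
    also have "\<dots> = (\<Sum>m\<in>S. cnj (c m) * (of_real pi * fourier_coeff g m))"
      by (simp add: LINT_mult_per_exp L2_on_integrable g)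
    finally show ?thesis by (simp add: sum_distrib_left mult_ac)
  qed
  have cp: "fourier_coeff p m = c m" if m: "m \<in> S" for m
  proof -
    have "fourier_coeff p m = (\<Sum>k\<in>S. c k * fourier_coeff (per_exp k) m)"
      unfolding p_def using S(1)
    proof (induction S rule: finite_induct)
      case empty show ?case by (simp add: fourier_coeff_def)
    next
      case (insert k F)
      have "integrable leb_pi (\<lambda>x. \<Sum>m\<in>F. c m * per_exp m x)"
        by (intro L2_on_integrable L2_on_sum insert L2_on_scale L2_on_per_exp)
      moreover have "integrable leb_pi (per_exp k)" by (intro L2_on_integrable L2_on_per_exp)
      ultimately show ?case
        using insert by (simp add: fourier_coeff_add fourier_coeff_scale)
    qed
    also have "\<dots> = (\<Sum>k\<in>S. if k = m then c k else 0)"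
      by (intro sum.cong refl) (use S(2) m in \<open>auto simp: fourier_coeff_per_exp\<close>)
    also have "\<dots> = c m" using S(1) m by simp
    finally show ?thesis .
  qed
  have fp: "(LINT x|leb_pi. f x * cnj (p x)) = of_real (pi * (\<Sum>m\<in>S. (cmod (c m))\<^sup>2))"
    unfolding pc[OF f] by (simp add: c_def complex_norm_square [symmetric] del: of_real_power)
  have pp: "(LINT x|leb_pi. p x * cnj (p x)) = of_real (pi * (\<Sum>m\<in>S. (cmod (c m))\<^sup>2))"
    unfolding pc[OF p] by (simp add: cp complex_norm_square [symmetric] del: of_real_power)
  have [simp]: "integrable leb_pi (\<lambda>x. g x * cnj (h x))" if "L2_pi g" "L2_pi h" for g h
    using L2_on_mult_integrable[OF that(1) L2_on_cnj[OF that(2)]] .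
  have "(LINT x|leb_pi. (f x - p x) * cnj (f x - p x)) =
    (LINT x|leb_pi. f x * cnj (f x)) - (LINT x|leb_pi. f x * cnj (p x)) - ((LINT x|leb_pi. p x * cnj (f x)) - (LINT x|leb_pi. p x * cnj (p x)))"
    using f p by (simp add: algebra_simps)
  moreover have "(LINT x|leb_pi. p x * cnj (f x)) = cnj (LINT x|leb_pi. f x * cnj (p x))"
    by (subst Bochner_Integration.integral_cnj [symmetric]) (simp add: mult.commute)
  ultimately have "complex_of_real (L2_sq (\<lambda>x. f x - p x)) = of_real (L2_sq f - pi * (\<Sum>m\<in>S. (cmod (c m))\<^sup>2))"
    unfolding L2_sq_complex[OF f] L2_sq_complex[OF L2_on_diff[OF f p]] of_real_diff fp pp by simp
  then have "L2_sq (\<lambda>x. f x - p x) = L2_sq f - pi * (\<Sum>m\<in>S. (cmod (c m))\<^sup>2)"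
    by (simp only: of_real_eq_iff)
  with L2_sq_nonneg[of "\<lambda>x. f x - p x"] show ?thesis
    by (simp add: c_def field_simps)
qed

section \<open>Uniform approximation by pi-periodic trigonometric polynomials\<close>

inductive trig_poly :: "(real \<Rightarrow> complex) \<Rightarrow> bool" where
  "even m \<Longrightarrow> trig_poly (per_exp m)"
| "trig_poly f \<Longrightarrow> trig_poly (\<lambda>x. c * f x)"
| "trig_poly f \<Longrightarrow> trig_poly g \<Longrightarrow> trig_poly (\<lambda>x. f x + g x)"

lemma trig_poly_mult:
  assumes "trig_poly f" "trig_poly g"
  shows "trig_poly (\<lambda>x. f x * g x)"
  using assms(1)
proof induction
  case (1 m)
  show ?case using assms(2)
  proof induction
    case (1 k)
    then show ?case using trig_poly.intros(1)[of "m + k"] \<open>even m\<close> by (simp add: per_exp_add [abs_def])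
  next
    case (2 f c)
    then show ?case using trig_poly.intros(2)[OF 2(2), of c] by (simp add: mult_ac)
  next
    case (3 f g)
    then show ?case using trig_poly.intros(3)[OF 3(3,4)] by (simp add: algebra_simps)
  qed
next
  case (2 f c)
  then show ?case using trig_poly.intros(2)[OF 2(2), of c] by (simp add: mult_ac)
next
  case (3 f h)
  then show ?case using trig_poly.intros(3)[OF 3(3,4)] by (simp add: algebra_simps)
qed

lemma trig_poly_const: "trig_poly (\<lambda>x. c)"
  using trig_poly.intros(2)[OF trig_poly.intros(1)[of 0], of c] by simp

lemma trig_poly_continuous: "trig_poly f \<Longrightarrow> continuous_on S f"
  by (induction rule: trig_poly.induct) (intro continuous_intros; assumption)+

lemma L2_on_trig_poly: "trig_poly f \<Longrightarrow> L2_pi f"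
  by (intro L2_on_continuous trig_poly_continuous)

text \<open>\<open>per_exp 2\<close> takes values on the unit circle, where Re and Im are linear
  combinations of z and its inverse, that is of \<open>per_exp 2\<close> and
  \<open>per_exp (- 2)\<close>. Polynomials in them keep even frequencies.\<close>

lemma trig_poly_real_polynomial:
  assumes "real_polynomial_function (g :: complex \<Rightarrow> real)"
  shows "trig_poly (\<lambda>x. complex_of_real (g (per_exp 2 x)))"
  using assms
proof induction
  case (linear f)
  have fz: "f z = f 1 * Re z + f \<i> * Im z" for z
  proof -
    have "f z = f (Re z *\<^sub>R 1 + Im z *\<^sub>R \<i>)"
      by (rule arg_cong[of _ _ f]) (simp add: complex_eq_iff)
    also have "\<dots> = f 1 * Re z + f \<i> * Im z"
      unfolding linear_simps[OF linear] by simp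
    finally show ?thesis .
  qed
  have 1: "trig_poly (\<lambda>x. c * (per_exp 2 x + d * per_exp (- 2) x))" for c d
    using trig_poly.intros(2)[OF trig_poly.intros(3)[OF trig_poly.intros(1)[of 2]
        trig_poly.intros(2)[OF trig_poly.intros(1)[of "- 2"], of d]], of c] by simp
  have "complex_of_real (Re z) = 1 / 2 * (z + 1 * cnj z)" "complex_of_real (Im z) = - \<i> / 2 * (z + (- 1) * cnj z)" for z
    by (simp_all add: complex_eq_iff)
  then have "trig_poly (\<lambda>x. complex_of_real (Re (per_exp 2 x)))" "trig_poly (\<lambda>x. complex_of_real (Im (per_exp 2 x)))"
    using 1[of "1 / 2" 1] 1[of "- \<i> / 2" "- 1"] by (simp_all only: cnj_per_exp)
  from trig_poly.intros(3)[OF this[THEN trig_poly.intros(2)], of "f 1" "f \<i>"] show ?case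
    by (simp only: fz[of "per_exp 2 _"] of_real_add of_real_mult)
next
  case (const c)
  show ?case by (rule trig_poly_const)
next
  case (add f g)
  then show ?case using trig_poly.intros(3)[OF add(3,4)] by simp
next
  case (mult f g)
  then show ?case using trig_poly_mult[OF mult(3,4)] by simp
qed

text \<open>Equal values at the ends let \<open>h\<close> descend to the unit circle, where the
  Stone-Weierstrass theorem yields a polynomial in Re and Im.\<close>

lemma trig_poly_uniform_dense:
  fixes h :: "real \<Rightarrow> complex"
  assumes h: "continuous_on {0..pi} h" "h 0 = h pi" and e: "e > 0"
  shows "\<exists>p. trig_poly p \<and> (\<forall>x\<in>{0..pi}. cmod (h x - p x) < e)"
proof -
  define l where "l = (\<lambda>t::real. h (pi * t))"
  have pl: "path l" unfolding path_def l_def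
    by (intro continuous_on_compose2[OF h(1)] continuous_intros) (auto simp: mult_le_cancel_left1)
  \<comment> \<open>The loop is compared with itself in order to read off that the map it induces on
    the circle is continuous.\<close>
  have "homotopic_loops UNIV l l"
    using pl h by (subst homotopic_loops_refl) (simp add: pathstart_def pathfinish_def l_def)
  from homotopic_loops_imp_homotopic_circlemaps[OF this]
  have F: "continuous_on (sphere 0 1) (l \<circ> (\<lambda>z. (Arg2pi z / (2 * pi))))" (is "continuous_on _ ?F")
    using homotopic_with_imp_continuous by blast
  obtain g where g: "polynomial_function g" "\<And>z. z \<in> sphere 0 1 \<Longrightarrow> cmod (?F z - g z) < e"
    using Stone_Weierstrass_polynomial_function[OF compact_sphere F e] by metis
  have "trig_poly (\<lambda>x. complex_of_real (Re (g (per_exp 2 x))) + \<i> * complex_of_real (Im (g (per_exp 2 x))))"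
  proof -
    have "real_polynomial_function (\<lambda>z. Re (g z))" "real_polynomial_function (\<lambda>z. Im (g z))"
      using g(1) unfolding polynomial_function_def by (auto simp: o_def bounded_linear_Re bounded_linear_Im)
    from this[THEN trig_poly_real_polynomial] show ?thesis
      by (intro trig_poly.intros(3) trig_poly.intros(2)[where c = \<i>])
  qed
  then have "trig_poly (\<lambda>x. g (per_exp 2 x))"
    by (simp add: complex_eq [symmetric])
  moreover have "cmod (h x - g (per_exp 2 x)) < e" if x: "x \<in> {0..pi}" for x
  proof -
    \<comment> \<open>At \<open>x = pi\<close> the argument jumps back to 0; there
      \<open>h 0 = h pi\<close> restores the right value.\<close>
    have "Arg2pi (per_exp 2 x) = (if x = pi then 0 else 2 * x)"
    proof (cases "x = pi")
      case True
      then show ?thesis using Arg2pi_of_real[of 1] by (simp add: per_exp_pi)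
    next
      case False
      then show ?thesis
        using x by (simp, intro Arg2pi_unique[of 1]) (auto simp: per_exp_def mult_ac)
    qed
    then have "?F (per_exp 2 x) = h x" using h(2) by (simp add: l_def)
    then show ?thesis using g(2)[of "per_exp 2 x"] by simp
  qed
  ultimately show ?thesis by blast
qed

section \<open>Parseval's identity\<close>

lemma L2_sq_add_le:
  assumes f: "L2_pi f" and g: "L2_pi g"
  shows "L2_sq (\<lambda>x. f x + g x) \<le> 2 * L2_sq f + 2 * L2_sq g"
proof -
  have "L2_sq (\<lambda>x. f x + g x) \<le> (LINT x|leb_pi. 2 * (cmod (f x))\<^sup>2 + 2 * (cmod (g x))\<^sup>2)"
    unfolding L2_sq_def
    using L2_onD(2)[OF f] L2_onD(2)[OF g] L2_onD(2)[OF L2_on_add[OF f g]] cmod_add_square_le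
    by (intro integral_mono) simp_all
  also have "\<dots> = 2 * L2_sq f + 2 * L2_sq g"
    using L2_onD(2)[OF f] L2_onD(2)[OF g] by (simp add: L2_sq_def)
  finally show ?thesis .
qed

section \<open>Density in L2 and L1\<close>

definition clip :: "real \<Rightarrow> complex \<Rightarrow> complex" where
  "clip K z = of_real (K / max K (cmod z)) * z"

text \<open>\<open>clip K\<close> is the radial retraction onto the disc of radius \<open>K\<close>;
  the maximum in the denominator gives continuity without a case distinction. The last bound
  supplies the dominating function when \<open>K\<close> tends to infinity.\<close>

lemma clip:
  assumes "K > 0"
  shows "continuous_on UNIV (clip K)" "cmod (clip K z) \<le> K" "cmod z \<le> K \<Longrightarrow> clip K z = z"
    "cmod (z - clip K z) \<le> cmod z"
proof -
  have nz: "max K a \<noteq> 0" for a using assms by auto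
  show "continuous_on UNIV (clip K)"
    unfolding clip_def using nz by (intro continuous_intros) auto
  show "cmod (clip K z) \<le> K"
    using assms by (auto simp: clip_def norm_mult norm_divide field_simps max_def)
  show "cmod z \<le> K \<Longrightarrow> clip K z = z"
    using assms by (simp add: clip_def max_def)
  have "z - clip K z = of_real (1 - K / max K (cmod z)) * z" by (simp add: clip_def algebra_simps)
  moreover have "0 \<le> K / max K (cmod z)" "K / max K (cmod z) \<le> 1" using assms by (auto simp: divide_le_eq_1)
  then have "\<bar>1 - K / max K (cmod z)\<bar> \<le> 1" by linarith
  ultimately show "cmod (z - clip K z) \<le> cmod z"
    by (simp only: norm_mult norm_of_real) (metis mult_left_le_one_le norm_ge_zero abs_ge_zero)
qed

lemma clip_measurable:
  "K > 0 \<Longrightarrow> f \<in> borel_measurable M \<Longrightarrow> (\<lambda>x. clip K (f x)) \<in> borel_measurable M"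
  by (rule borel_measurable_continuous_on[OF clip(1)])

lemma clip_tendsto: "(\<lambda>k. clip (real (Suc k)) z) \<longlonglongrightarrow> z"
proof (rule tendsto_eventually)
  obtain N :: nat where "cmod z \<le> real N" using real_arch_simple by blast
  then have "clip (real (Suc k)) z = z" if "k \<ge> N" for k
    using that by (intro clip(3)) auto
  then show "\<forall>\<^sub>F k in sequentially. clip (real (Suc k)) z = z"
    by (auto simp: eventually_sequentially)
qed

text \<open>Stated for a general exponent because it is used with 2 for density in L2 and with 1 for
  density in L1.\<close>

lemma LINT_clip_tendsto:
  assumes f: "f \<in> borel_measurable leb_pi" "integrable leb_pi (\<lambda>x. cmod (f x) ^ p)" and p: "p > 0"
  shows "(\<lambda>k. LINT x|leb_pi. cmod (f x - clip (real (Suc k)) (f x)) ^ p) \<longlonglongrightarrow> 0"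
proof -
  note [measurable] = f(1) clip_measurable[OF _ f(1)]
  have "(\<lambda>k. LINT x|leb_pi. cmod (f x - clip (real (Suc k)) (f x)) ^ p) \<longlonglongrightarrow> (LINT x|leb_pi. 0)"
  proof (rule integral_dominated_convergence[OF _ _ f(2)])
    have "(\<lambda>k. cmod (f x - clip (real (Suc k)) (f x)) ^ p) \<longlonglongrightarrow> cmod (f x - f x) ^ p" for x
      by (intro tendsto_intros clip_tendsto)
    then show "AE x in leb_pi. (\<lambda>k. cmod (f x - clip (real (Suc k)) (f x)) ^ p) \<longlonglongrightarrow> 0"
      unfolding diff_self norm_zero zero_power[OF p] by (rule AE_I2)
    show "AE x in leb_pi. norm (cmod (f x - clip (real (Suc k)) (f x)) ^ p) \<le> cmod (f x) ^ p" for k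
      by (auto intro!: power_mono clip(4))
    show "(\<lambda>x. cmod (f x - clip (real (Suc k)) (f x)) ^ p) \<in> borel_measurable leb_pi" for k
      by (intro borel_measurable_power borel_measurable_norm borel_measurable_diff f(1) clip_measurable) simp
  qed simp
  then show ?thesis by simp
qed

text \<open>A measurable function is an almost everywhere limit of continuous ones. Clipping these
  at \<open>K\<close> permits dominated convergence, and a cut-off near the ends enforces equal
  boundary values.\<close>

lemma L2_dense_bounded:
  assumes f: "f \<in> borel_measurable leb_pi" and K: "K > 0" "\<And>x. x \<in> {0..pi} \<Longrightarrow> cmod (f x) \<le> K"
    and e: "e > 0"
  shows "\<exists>h. continuous_on {0..pi} h \<and> h 0 = h pi \<and> L2_sq (\<lambda>x. f x - h x) < e"
proof -
  obtain N g where N: "negligible N" and g: "\<And>n. continuous_on UNIV (g n)"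
    and lim: "\<And>x. x \<notin> N \<Longrightarrow> (\<lambda>n. g n x) \<longlonglongrightarrow> (if x \<in> {0..pi} then f x else 0)"
    using f unfolding measurable_on_iff_borel_measurable[of "{0..pi}" f, simplified, symmetric] measurable_on_def by auto
  \<comment> \<open>Vanishes at 0 and pi, and is eventually 1 at every interior point; the two ends
    are added to the null set.\<close>
  define cut where "cut = (\<lambda>(n::nat) (x::real). min 1 (real n * (x * (pi - x))))"
  define h where "h = (\<lambda>n x. of_real (cut n x) * clip K (g n x))"
  have h: "continuous_on {0..pi} (h n)" "h n 0 = h n pi" for n
    unfolding h_def cut_def
    by (intro continuous_intros continuous_on_compose2[OF clip(1)[OF K(1)]] continuous_on_subset[OF g]) auto
  have hK: "cmod (h n x) \<le> K" if "x \<in> {0..pi}" for n x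
  proof -
    have "\<bar>cut n x\<bar> \<le> 1" using that by (auto simp: cut_def)
    then have "cmod (h n x) \<le> 1 * K"
      unfolding h_def norm_mult norm_of_real by (intro mult_mono clip(2)[OF K(1)]) auto
    then show ?thesis by simp
  qed
  have "N \<union> {0, pi} \<in> null_sets lebesgue"
    using N by (simp add: negligible_iff_null_sets [symmetric])
  from AE_not_in[OF this] have ae: "AE x in leb_pi. x \<notin> N \<union> {0, pi}"
    by (subst AE_restrict_space_iff) (simp, rule eventually_mono, auto)
  interpret finite_measure leb_pi by (rule finite_measure_leb_pi)
  have "(\<lambda>n. L2_sq (\<lambda>x. f x - h n x)) \<longlonglongrightarrow> (LINT x|leb_pi. 0)"
    unfolding L2_sq_def
  proof (rule integral_dominated_convergence[where w = "\<lambda>x. (2 * K)\<^sup>2"])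
    have [measurable]: "h n \<in> borel_measurable leb_pi" for n
      by (rule continuous_imp_measurable_leb_pi[OF h(1)])
    note [measurable] = f
    show "(\<lambda>x. (cmod (f x - h n x))\<^sup>2) \<in> borel_measurable leb_pi" for n by measurable
    show "AE x in leb_pi. (\<lambda>n. (cmod (f x - h n x))\<^sup>2) \<longlonglongrightarrow> 0"
    proof -
      have *: "(\<lambda>n. (cmod (f x - h n x))\<^sup>2) \<longlonglongrightarrow> 0" if x: "x \<notin> N \<union> {0, pi}" "x \<in> {0..pi}" for x
      proof -
        have "0 < x * (pi - x)" using x by auto
        then obtain M :: nat where M: "1 < real M * (x * (pi - x))" 
          using ex_less_of_nat_mult by blast
        have "cut n x = 1" if "n \<ge> M" for n
        proof -
          have "real M * (x * (pi - x)) \<le> real n * (x * (pi - x))"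
            using that \<open>0 < x * (pi - x)\<close> by (intro mult_right_mono) auto
          then show ?thesis using M by (simp add: cut_def)
        qed
        then have "(\<lambda>n. cut n x) \<longlonglongrightarrow> 1"
          by (intro tendsto_eventually) (auto simp: eventually_sequentially)
        moreover have "(\<lambda>n. clip K (g n x)) \<longlonglongrightarrow> clip K (f x)"
          using clip(1)[OF K(1)] lim[of x] x
          by (intro continuous_on_tendsto_compose[of UNIV "clip K"]) auto
        ultimately have "(\<lambda>n. h n x) \<longlonglongrightarrow> of_real 1 * clip K (f x)"
          unfolding h_def by (intro tendsto_intros)
        then have "(\<lambda>n. h n x) \<longlonglongrightarrow> f x" using clip(3)[OF K(1) K(2)[OF x(2)]] by simp
        then have "(\<lambda>n. (cmod (f x - h n x))\<^sup>2) \<longlonglongrightarrow> (cmod (f x - f x))\<^sup>2"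
          by (intro tendsto_intros)
        then show ?thesis by simp
      qed
      from ae show ?thesis by (rule AE_mp) (intro AE_I2 impI *, simp_all)
    qed
    show "AE x in leb_pi. norm ((cmod (f x - h n x))\<^sup>2) \<le> (2 * K)\<^sup>2" for n
    proof (rule AE_I2)
      fix x assume "x \<in> space leb_pi"
      then have "cmod (f x - h n x) \<le> K + K"
        by (intro order_trans[OF norm_triangle_ineq4] add_mono K(2) hK) auto
      then have "(cmod (f x - h n x))\<^sup>2 \<le> (2 * K)\<^sup>2"
        by (intro power_mono) simp_all
      then show "norm ((cmod (f x - h n x))\<^sup>2) \<le> (2 * K)\<^sup>2" by simp
    qed
  qed simp_all
  then have "(\<lambda>n. L2_sq (\<lambda>x. f x - h n x)) \<longlonglongrightarrow> 0" by simp
  from order_tendstoD(2)[OF this e] obtain n where "L2_sq (\<lambda>x. f x - h n x) < e"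
    by (auto simp: eventually_sequentially)
  then show ?thesis using h by blast
qed

lemma L2_trig_poly_dense:
  assumes f: "L2_pi f" and e: "e > 0"
  shows "\<exists>p. trig_poly p \<and> L2_sq (\<lambda>x. f x - p x) < e"
proof -
  note [measurable] = L2_onD(1)[OF f]
  define c where "c = (\<lambda>k x. clip (real (Suc k)) (f x))"
  have c [measurable]: "c k \<in> borel_measurable leb_pi" for k
    unfolding c_def by (rule clip_measurable) auto
  have "(\<lambda>k. L2_sq (\<lambda>x. f x - c k x)) \<longlonglongrightarrow> 0"
    unfolding L2_sq_def c_def by (rule LINT_clip_tendsto[OF L2_onD[OF f]]) simp
  \<comment> \<open>Three errors of at most e/16 enter two uses of \<open>L2_sq_add_le\<close>, with
    total 2e/16 + 4e/16 + 4e/16 < e.\<close>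
  from order_tendstoD(2)[OF this, of "e / 16"] e obtain k where k: "L2_sq (\<lambda>x. f x - c k x) < e / 16"
    by (auto simp: eventually_sequentially)
  have ck: "cmod (c k x) \<le> real (Suc k)" for x
    unfolding c_def by (rule clip(2)) auto
  obtain h where h: "continuous_on {0..pi} h" "h 0 = h pi" "L2_sq (\<lambda>x. c k x - h x) < e / 16"
    using L2_dense_bounded[OF c, of "real (Suc k)" k "e / 16"] e ck by auto
  define d where "d = sqrt (e / (16 * pi))"
  have d: "d > 0" "pi * d\<^sup>2 = e / 16" using e by (auto simp: d_def)
  obtain p where p: "trig_poly p" "\<And>x. x \<in> {0..pi} \<Longrightarrow> cmod (h x - p x) < d"
    using trig_poly_uniform_dense[OF h(1,2) d(1)] by auto
  have L: "L2_pi (c k)" using ck by (intro L2_on_bounded c)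
  have Lh: "L2_pi h" by (rule L2_on_continuous[OF h(1)])
  have Lp: "L2_pi p" by (rule L2_on_trig_poly[OF p(1)])
  interpret finite_measure leb_pi by (rule finite_measure_leb_pi)
  have hp: "L2_sq (\<lambda>x. h x - p x) \<le> e / 16"
  proof -
    have "L2_sq (\<lambda>x. h x - p x) \<le> (LINT x|leb_pi. d\<^sup>2)"
      unfolding L2_sq_def using L2_onD(2)[OF L2_on_diff[OF Lh Lp]] less_imp_le[OF p(2)]
      by (intro integral_mono) (simp_all add: power_mono)
    also have "\<dots> = pi * d\<^sup>2" by (simp add: measure_restrict_space)
    finally show ?thesis using d by simp
  qed
  define r where "r = (\<lambda>x. c k x - p x)"
  have "L2_sq r \<le> 2 * L2_sq (\<lambda>x. c k x - h x) + 2 * L2_sq (\<lambda>x. h x - p x)"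
    using L2_sq_add_le[OF L2_on_diff[OF L Lh] L2_on_diff[OF Lh Lp]] by (simp add: r_def)
  moreover have "L2_sq (\<lambda>x. f x - p x) \<le> 2 * L2_sq (\<lambda>x. f x - c k x) + 2 * L2_sq r"
    using L2_sq_add_le[OF L2_on_diff[OF f L], of r] L2_on_diff[OF L Lp] by (simp add: r_def)
  ultimately have "L2_sq (\<lambda>x. f x - p x) < e" using k h(3) hp e by linarith
  then show ?thesis using p(1) by blast
qed

text \<open>Needed because the derivative of the quasi-derivative \<open>w\<close> in the Hill
  domain is merely integrable. Clip to a bounded function, then approximate that one in L2, which
  suffices on a finite measure space.\<close>

lemma L1_continuous_dense:
  assumes f: "integrable leb_pi f" and e: "e > 0"
  shows "\<exists>h. continuous_on {0..pi} h \<and> (LINT x|leb_pi. cmod (f x - h x)) < e"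
proof -
  have [measurable]: "f \<in> borel_measurable leb_pi" using f by simp
  define c where "c = (\<lambda>k x. clip (real (Suc k)) (f x))"
  have c [measurable]: "c k \<in> borel_measurable leb_pi" for k
    unfolding c_def by (rule clip_measurable) auto
  have "(\<lambda>k. LINT x|leb_pi. cmod (f x - c k x)) \<longlonglongrightarrow> 0"
    using LINT_clip_tendsto[of f 1] f by (simp add: c_def)
  from order_tendstoD(2)[OF this, of "e / 2"] e obtain k where k: "(LINT x|leb_pi. cmod (f x - c k x)) < e / 2"
    by (auto simp: eventually_sequentially)
  have ck: "cmod (c k x) \<le> real (Suc k)" for x
    unfolding c_def by (rule clip(2)) auto
  \<comment> \<open>The passage from L2 to L1 rests on \<open>u \<le> t + u\<^sup>2 / t\<close>;
    with this \<open>t\<close> the constant part integrates to e/4.\<close>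
  define t where "t = e / (4 * pi)"
  have t: "t > 0" "pi * t = e / 4" using e by (auto simp: t_def)
  obtain h where h: "continuous_on {0..pi} h" "L2_sq (\<lambda>x. c k x - h x) < t * (e / 4)"
    using L2_dense_bounded[OF c, of "real (Suc k)" k "t * (e / 4)"] e ck t by auto
  have Lc: "L2_pi (c k)" using ck by (intro L2_on_bounded c)
  have Lh: "L2_pi h" by (rule L2_on_continuous[OF h(1)])
  interpret finite_measure leb_pi by (rule finite_measure_leb_pi)
  have Ld: "L2_pi (\<lambda>x. c k x - h x)" by (rule L2_on_diff[OF Lc Lh])
  have "(LINT x|leb_pi. cmod (c k x - h x)) \<le> (LINT x|leb_pi. t + (cmod (c k x - h x))\<^sup>2 / t)"
  proof (rule integral_mono)
    show "integrable leb_pi (\<lambda>x. cmod (c k x - h x))"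
      using L2_on_integrable[OF Ld] by simp
    show "integrable leb_pi (\<lambda>x. t + (cmod (c k x - h x))\<^sup>2 / t)"
      using L2_onD(2)[OF Ld] by simp
    fix x
    have "u \<le> t + u\<^sup>2 / t" if "u \<ge> 0" for u
    proof -
      have "0 \<le> (u - t)\<^sup>2 + u * t" using t that by simp
      then have "u * t \<le> (t + u\<^sup>2 / t) * t" using t by (simp add: power2_eq_square algebra_simps)
      then show ?thesis using t by simp
    qed
    then show "cmod (c k x - h x) \<le> t + (cmod (c k x - h x))\<^sup>2 / t" by simp
  qed
  also have "\<dots> = pi * t + L2_sq (\<lambda>x. c k x - h x) / t"
    using L2_onD(2)[OF Ld] by (simp add: L2_sq_def measure_restrict_space)
  also have "\<dots> < e / 4 + e / 4"
    using h(2) t by (intro add_le_less_mono) (auto simp: field_simps)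
  finally have ch: "(LINT x|leb_pi. cmod (c k x - h x)) < e / 2" by simp
  have int: "integrable leb_pi (\<lambda>x. cmod (f x - c k x))" "integrable leb_pi (\<lambda>x. cmod (c k x - h x))"
    "integrable leb_pi (\<lambda>x. cmod (f x - h x))"
    using f L2_on_integrable[OF Lc] L2_on_integrable[OF Lh] by (auto intro!: integrable_norm)
  have "(LINT x|leb_pi. cmod (f x - h x)) \<le> (LINT x|leb_pi. cmod (f x - c k x) + cmod (c k x - h x))"
    using int by (intro integral_mono) (auto intro: norm_diff_triangle_le)
  also have "\<dots> < e" using int k ch by simp
  finally show ?thesis using h(1) by blast
qed

text \<open>Multiplication by \<open>per_exp (- 1)\<close> moves odd frequencies to even ones and
  preserves the norm. The factor 2 comes from adding the two parities.\<close>

lemma bessel: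
  assumes f: "L2_pi f" and S: "finite S"
  shows "(\<Sum>m\<in>S. (cmod (fourier_coeff f m))\<^sup>2) \<le> 2 * L2_sq f / pi"
proof -
  define E where "E = {m\<in>S. even m}"
  define g where "g = (\<lambda>x. f x * per_exp (- 1) x)"
  have fin: "finite E" "finite (S - E)" using S by (auto simp: E_def)
  have "(\<Sum>m\<in>S. (cmod (fourier_coeff f m))\<^sup>2) = (\<Sum>m\<in>E. (cmod (fourier_coeff f m))\<^sup>2) + (\<Sum>m\<in>S - E. (cmod (fourier_coeff f m))\<^sup>2)"
    using S by (subst sum.subset_diff[of E S]) (auto simp: E_def)
  also have "(\<Sum>m\<in>S - E. (cmod (fourier_coeff f m))\<^sup>2) = (\<Sum>m\<in>(\<lambda>m. m - 1) ` (S - E). (cmod (fourier_coeff g m))\<^sup>2)"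
    by (subst sum.reindex) (auto simp: g_def fourier_coeff_mult_per_exp inj_on_def)
  also have "\<dots> \<le> L2_sq g / pi"
    by (rule bessel_even) (use fin in \<open>auto simp: E_def g_def intro!: L2_on_mult_per_exp f\<close>)
  also have "L2_sq g = L2_sq f" by (simp add: L2_sq_def g_def norm_mult)
  also have "(\<Sum>m\<in>E. (cmod (fourier_coeff f m))\<^sup>2) \<le> L2_sq f / pi"
    by (rule bessel_even[OF f fin(1)]) (simp add: E_def)
  finally show ?thesis by simp
qed

text \<open>Young's inequality with a free parameter, in place of Cauchy-Schwarz: if the second
  factor has squared norm below \<open>t\<^sup>2\<close>, both terms are of order
  \<open>t\<close>.\<close>

lemma mult_le_weighted_squares:
  fixes a b t :: real
  assumes "t > 0" 
  shows "a * b \<le> t * a\<^sup>2 + b\<^sup>2 / t"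
proof -
  have "0 \<le> (t * a - b / 2)\<^sup>2 + 3 / 4 * b\<^sup>2" by simp
  then have "(a * b) * t \<le> (t * a\<^sup>2 + b\<^sup>2 / t) * t"
    using assms by (simp add: power2_eq_square algebra_simps)
  then show ?thesis using assms by simp
qed

lemma has_sum_norm_le:
  fixes f :: "'a \<Rightarrow> 'b :: real_normed_vector"
  assumes "(f has_sum s) A" "\<And>F. finite F \<Longrightarrow> F \<subseteq> A \<Longrightarrow> norm (sum f F) \<le> C"
  shows "norm s \<le> C"
proof -
  have "((\<lambda>F. norm (sum f F)) \<longlongrightarrow> norm s) (finite_subsets_at_top A)"
    using assms(1) unfolding has_sum_def by (rule tendsto_norm)
  moreover have "eventually (\<lambda>F. norm (sum f F) \<le> C) (finite_subsets_at_top A)"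
    using assms(2) by (auto simp: eventually_finite_subsets_at_top intro!: exI[of _ "{}"])
  ultimately show ?thesis by (rule tendsto_upperbound) simp
qed

lemma fourier_prod_summable:
  assumes "L2_pi f" "L2_pi g" "inj_on u A"
  shows "(\<lambda>m. fourier_coeff f (u m) * fourier_coeff g m) summable_on A"
proof (rule abs_summable_summable, rule nonneg_bdd_above_summable_on)
  show "bdd_above (sum (\<lambda>m. cmod (fourier_coeff f (u m) * fourier_coeff g m)) ` {F. F \<subseteq> A \<and> finite F})"
  proof (rule bdd_aboveI2)
    fix F assume F: "F \<in> {F. F \<subseteq> A \<and> finite F}"
    have "(\<Sum>m\<in>F. cmod (fourier_coeff f (u m) * fourier_coeff g m))
      \<le> (\<Sum>m\<in>F. (cmod (fourier_coeff f (u m)))\<^sup>2 + (cmod (fourier_coeff g m))\<^sup>2)"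
      unfolding norm_mult using mult_le_weighted_squares[of 1] by (intro sum_mono) simp
    also have "\<dots> = (\<Sum>m\<in>u ` F. (cmod (fourier_coeff f m))\<^sup>2) + (\<Sum>m\<in>F. (cmod (fourier_coeff g m))\<^sup>2)"
      using F inj_on_subset[OF assms(3)] by (subst sum.reindex) (auto simp: sum.distrib)
    also have "\<dots> \<le> 2 * L2_sq f / pi + 2 * L2_sq g / pi"
      using F by (intro add_mono bessel assms) auto
    finally show "(\<Sum>m\<in>F. cmod (fourier_coeff f (u m) * fourier_coeff g m)) \<le> 2 * L2_sq f / pi + 2 * L2_sq g / pi" .
  qed
qed simp

lemma cmod_LINT_mult_le:
  assumes f: "L2_pi f" and g: "L2_pi g" and t: "t > 0"
  shows "cmod (LINT x|leb_pi. f x * g x) \<le> t * L2_sq f + L2_sq g / t"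
proof -
  have "cmod (LINT x|leb_pi. f x * g x) \<le> (LINT x|leb_pi. cmod (f x * g x))"
    by (rule integral_norm_bound)
  also have "\<dots> \<le> (LINT x|leb_pi. t * (cmod (f x))\<^sup>2 + (cmod (g x))\<^sup>2 / t)"
    using L2_onD(2)[OF f] L2_onD(2)[OF g] integrable_norm[OF L2_on_mult_integrable[OF f g]]
    by (intro integral_mono) (auto simp: norm_mult intro!: mult_le_weighted_squares t)
  also have "\<dots> = t * L2_sq f + L2_sq g / t"
    using L2_onD(2)[OF f] L2_onD(2)[OF g] by (simp add: L2_sq_def)
  finally show ?thesis .
qed

lemma parseval_trig_poly:
  assumes f: "L2_pi f" and p: "trig_poly p"
  shows "((\<lambda>m. fourier_coeff f (- m) * fourier_coeff p m) has_sum fourier_coeff (\<lambda>x. f x * p x) 0) {m. even m}"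
  using p
proof induction
  case (1 k)
  have "((\<lambda>m. fourier_coeff f (- m) * fourier_coeff (per_exp k) m) has_sum fourier_coeff f (- k)) {k}"
    using has_sum_finite[of "{k}" "\<lambda>m. fourier_coeff f (- m) * fourier_coeff (per_exp k) m"]
    by (simp add: fourier_coeff_per_exp)
  also have "?this \<longleftrightarrow> ?case"
    unfolding fourier_coeff_mult_per_exp diff_0 using 1
    by (intro has_sum_cong_neutral) (auto simp: fourier_coeff_per_exp)
  finally show ?case .
next
  case (2 g c)
  have "fourier_coeff (\<lambda>x. f x * (c * g x)) 0 = c * fourier_coeff (\<lambda>x. f x * g x) 0"
    using fourier_coeff_scale[OF L2_on_mult_integrable[OF f L2_on_trig_poly[OF 2(1)]], of c 0]
    by (simp add: mult_ac)
  then show ?case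
    using has_sum_cmult_right[OF 2(2), of c] L2_on_integrable[OF L2_on_trig_poly[OF 2(1)]]
    by (simp add: fourier_coeff_scale mult_ac)
next
  case (3 g h)
  note i = L2_on_integrable[OF L2_on_trig_poly[OF 3(1)]] L2_on_integrable[OF L2_on_trig_poly[OF 3(2)]]
  have "fourier_coeff (\<lambda>x. f x * (g x + h x)) 0 = fourier_coeff (\<lambda>x. f x * g x) 0 + fourier_coeff (\<lambda>x. f x * h x) 0"
    using fourier_coeff_add[OF L2_on_mult_integrable[OF f L2_on_trig_poly[OF 3(1)]]
      L2_on_mult_integrable[OF f L2_on_trig_poly[OF 3(2)]], of 0]
    by (simp add: ring_distribs)
  then show ?case
    using has_sum_add[OF 3(3,4)] i by (simp add: fourier_coeff_add ring_distribs)
qed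

text \<open>Both sides depend continuously on \<open>g\<close> in L2, the series by Bessel and the
  integral by Young, and they agree on the dense set of trigonometric polynomials.\<close>

lemma parseval_even:
  assumes f: "L2_pi f" and g: "L2_pi g"
  shows "((\<lambda>m. fourier_coeff f (- m) * fourier_coeff g m) has_sum fourier_coeff (\<lambda>x. f x * g x) 0) {m. even m}"
proof -
  define s where "s = infsum (\<lambda>m. fourier_coeff f (- m) * fourier_coeff g m) {m. even m}"
  have s: "((\<lambda>m. fourier_coeff f (- m) * fourier_coeff g m) has_sum s) {m. even m}"
    unfolding s_def using fourier_prod_summable[OF f g, of uminus "{m. even m}"]
    by (simp add: has_sum_infsum inj_on_def)
  \<comment> \<open>The 3 is 2 from the series, where \<open>bessel\<close> carries a factor 2, plus
    1 from the integral.\<close>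
  define C where "C = (3 * L2_sq f + 3) / pi"
  have le: "cmod (fourier_coeff (\<lambda>x. f x * g x) 0 - s) \<le> C * t" if t: "t > 0" for t
  proof -
    obtain p where p: "trig_poly p" "L2_sq (\<lambda>x. g x - p x) < t\<^sup>2"
      using L2_trig_poly_dense[OF g, of "t\<^sup>2"] t by auto
    define r where "r = (\<lambda>x. g x - p x)"
    note Lp = L2_on_trig_poly[OF p(1)]
    have Lr: "L2_pi r" unfolding r_def by (rule L2_on_diff[OF g Lp])
    have rt: "L2_sq r / t \<le> t"
      using p(2) t by (simp add: r_def field_simps power2_eq_square)
    have "((\<lambda>m. fourier_coeff f (- m) * fourier_coeff r m) has_sum (s - fourier_coeff (\<lambda>x. f x * p x) 0)) {m. even m}"
      using has_sum_add[OF s has_sum_cmult_right[OF parseval_trig_poly[OF f p(1)], of "- 1"]] L2_on_integrable[OF g] L2_on_integrable[OF Lp]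
      by (simp add: r_def fourier_coeff_diff ring_distribs)
    then have 1: "cmod (s - fourier_coeff (\<lambda>x. f x * p x) 0) \<le> 2 * (t * L2_sq f + t) / pi"
    proof (rule has_sum_norm_le)
      fix F :: "int set" assume F: "finite F"
      have "cmod (\<Sum>m\<in>F. fourier_coeff f (- m) * fourier_coeff r m)
        \<le> (\<Sum>m\<in>F. t * (cmod (fourier_coeff f (- m)))\<^sup>2 + (cmod (fourier_coeff r m))\<^sup>2 / t)"
        by (rule sum_norm_le) (simp add: norm_mult mult_le_weighted_squares t)
      also have "\<dots> = t * (\<Sum>m\<in>uminus ` F. (cmod (fourier_coeff f m))\<^sup>2) + (\<Sum>m\<in>F. (cmod (fourier_coeff r m))\<^sup>2) / t"
        by (subst sum.reindex) (auto simp: sum.distrib sum_distrib_left sum_divide_distrib)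
      also have "\<dots> \<le> t * (2 * L2_sq f / pi) + (2 * L2_sq r / pi) / t"
        using t F by (intro add_mono mult_left_mono divide_right_mono bessel f Lr) auto
      also have "\<dots> = 2 * (t * L2_sq f + L2_sq r / t) / pi" by (simp add: field_simps)
      also have "\<dots> \<le> 2 * (t * L2_sq f + t) / pi"
        by (intro divide_right_mono mult_left_mono add_left_mono rt) auto
      finally show "cmod (\<Sum>m\<in>F. fourier_coeff f (- m) * fourier_coeff r m) \<le> 2 * (t * L2_sq f + t) / pi" .
    qed
    have fr: "integrable leb_pi (\<lambda>x. f x * r x)" by (rule L2_on_mult_integrable[OF f Lr])
    have "fourier_coeff (\<lambda>x. f x * r x) 0 = fourier_coeff (\<lambda>x. f x * g x) 0 - fourier_coeff (\<lambda>x. f x * p x) 0"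
      using fourier_coeff_diff[OF L2_on_mult_integrable[OF f g] L2_on_mult_integrable[OF f Lp], of 0]
      by (simp add: r_def ring_distribs)
    moreover have "cmod (fourier_coeff (\<lambda>x. f x * r x) 0) \<le> (t * L2_sq f + t) / pi"
    proof -
      have "cmod (fourier_coeff (\<lambda>x. f x * r x) 0) = cmod (LINT x|leb_pi. f x * r x) / pi"
        by (simp add: fourier_coeff_eq[OF fr] norm_divide)
      also have "\<dots> \<le> (t * L2_sq f + L2_sq r / t) / pi"
        by (intro divide_right_mono cmod_LINT_mult_le f Lr t) simp
      also have "\<dots> \<le> (t * L2_sq f + t) / pi"
        by (intro divide_right_mono add_left_mono rt) simp
      finally show ?thesis .
    qed
    ultimately have "cmod (fourier_coeff (\<lambda>x. f x * g x) 0 - s) \<le> 2 * (t * L2_sq f + t) / pi + (t * L2_sq f + t) / pi"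
      using 1 norm_triangle_ineq4[of "fourier_coeff (\<lambda>x. f x * r x) 0" "s - fourier_coeff (\<lambda>x. f x * p x) 0"]
      by (simp del: times_divide_eq_left times_divide_eq_right)
    also have "\<dots> = C * t" by (simp add: C_def field_simps)
    finally show ?thesis .
  qed
  have "cmod (fourier_coeff (\<lambda>x. f x * g x) 0 - s) \<le> 0"
  proof (rule field_le_epsilon)
    fix e :: real assume e: "e > 0"
    have C: "C > 0" using L2_sq_nonneg[of f] by (simp add: C_def field_simps add_nonneg_pos)
    show "cmod (fourier_coeff (\<lambda>x. f x * g x) 0 - s) \<le> 0 + e"
      using le[of "e / C"] e C by simp
  qed
  then have "s = fourier_coeff (\<lambda>x. f x * g x) 0" by simp
  with s show ?thesis by simp
qed

text \<open>This form turns multiplication by a potential into a matrix on the coefficients of one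
  residue class. Shifting the frequencies by n - j and by -n reduces it to the even case.\<close>

lemma parseval:
  assumes f: "L2_pi f" and g: "L2_pi g"
  shows "((\<lambda>m. fourier_coeff f (j - m) * fourier_coeff g m) has_sum fourier_coeff (\<lambda>x. f x * g x) j) {m. even (m - n)}"
proof -
  have "((\<lambda>m. fourier_coeff f (j - (m + n)) * fourier_coeff g (m + n)) has_sum fourier_coeff (\<lambda>x. f x * g x) j) {m. even m}"
  proof -
    have "(\<lambda>x. f x * per_exp (n - j) x * (g x * per_exp (- n) x)) = (\<lambda>x. f x * g x * per_exp (- j) x)"
      using per_exp_add[of "n - j" "- n"] by (simp add: mult_ac fun_eq_iff)
    moreover have "fourier_coeff (\<lambda>x. f x * g x * per_exp (- j) x) 0 = fourier_coeff (\<lambda>x. f x * g x) j"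
      using fourier_coeff_mult_per_exp[of "\<lambda>x. f x * g x" "- j" 0] by simp
    moreover have "- m - (n - j) = j - (m + n)" "m - - n = m + n" for m by simp_all
    ultimately show ?thesis
      using parseval_even[OF L2_on_mult_per_exp[OF f, of "n - j"] L2_on_mult_per_exp[OF g, of "- n"]]
      by (simp only: fourier_coeff_mult_per_exp)
  qed
  moreover have "bij_betw (\<lambda>m. m + n) {m. even m} {m. even (m - n)}"
    by (rule bij_betwI[where g = "\<lambda>m. m - n"]) auto
  note has_sum_reindex_bij_betw[OF this, of "\<lambda>m. fourier_coeff f (j - m) * fourier_coeff g m"]
  ultimately show ?thesis by blast
qed

text \<open>Parseval for the conjugate of \<open>f\<close> and \<open>f\<close> gives norm 0. Later
  it guarantees that an eigenfunction has a nonzero coefficient in the residue class at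
  hand.\<close>

lemma fourier_unique:
  assumes f: "continuous_on {0..pi} f" and 0: "\<And>m. even (m - n) \<Longrightarrow> fourier_coeff f m = 0"
    and x: "x \<in> {0..pi}"
  shows "f x = 0"
proof -
  have L: "L2_pi f" by (rule L2_on_continuous[OF f])
  have "fourier_coeff (\<lambda>x. cnj (f x)) (0 - m) * fourier_coeff f m = 0" if "m \<in> {m. even (m - n)}" for m
    using 0[of m] that by simp
  from has_sum_cong[THEN iffD1, OF this parseval[OF L2_on_cnj[OF L] L, of 0 n]]
  have "((\<lambda>m::int. 0) has_sum fourier_coeff (\<lambda>x. cnj (f x) * f x) 0) {m. even (m - n)}"
    by this
  then have "fourier_coeff (\<lambda>x. cnj (f x) * f x) 0 = 0" using has_sum_unique[OF _ has_sum_0[OF refl]] by blast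
  then have "(LINT x|leb_pi. f x * cnj (f x)) = 0"
    using fourier_coeff_eq[OF L2_on_mult_integrable[OF L2_on_cnj[OF L] L], of 0] by (simp add: mult.commute)
  then have "L2_sq f = 0" using L2_sq_complex[OF L] by simp
  then have "integral {0..pi} (\<lambda>x. (cmod (f x))\<^sup>2) = 0"
    using lebesgue_integral_eq_integral[OF L2_onD(2)[OF L]] by (simp add: L2_sq_def)
  then have "(cmod (f x))\<^sup>2 = 0"
    using integral_eq_0_iff[of 0 pi "\<lambda>x. (cmod (f x))\<^sup>2"] x f by (simp add: continuous_on_norm continuous_on_power)
  then show ?thesis by simp
qed

section \<open>Fourier coefficients of derivatives\<close>

lemma integrable_leb_pi_iff:
  fixes g :: "real \<Rightarrow> complex"
  shows "integrable leb_pi g \<longleftrightarrow> g absolutely_integrable_on {0..pi}"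
  by (simp add: integrable_restrict_space set_integrable_def)

lemma indefinite_integral_continuous:
  "integrable leb_pi g \<Longrightarrow> continuous_on {0..pi} (\<lambda>x. integral {0..x} (g :: real \<Rightarrow> complex))"
  by (rule indefinite_integral_continuous_1) (rule integrable_on_lebesgue_on, auto)

lemma indefinite_integral_diff_le:
  fixes g h :: "real \<Rightarrow> complex"
  assumes g: "integrable leb_pi g" and h: "integrable leb_pi h" and x: "x \<in> {0..pi}"
  shows "cmod (integral {0..x} g - integral {0..x} h) \<le> (LINT t|leb_pi. cmod (g t - h t))"
proof -
  have gh: "(\<lambda>t. g t - h t) absolutely_integrable_on {0..pi}"
    using g h unfolding integrable_leb_pi_iff by (rule set_integral_diff)
  have sub: "{0..x} \<subseteq> {0..pi}" using x by auto
  have "g integrable_on {0..x}" "h integrable_on {0..x}"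
    using g h x by (auto intro!: integrable_on_subinterval[OF integrable_on_lebesgue_on])
  then have "integral {0..x} g - integral {0..x} h = integral {0..x} (\<lambda>t. g t - h t)"
    by (simp add: Henstock_Kurzweil_Integration.integral_diff)
  also have "cmod \<dots> \<le> integral {0..x} (\<lambda>t. cmod (g t - h t))"
    using set_integrable_subset[OF gh _ sub]
    by (intro integral_norm_bound_integral set_lebesgue_integral_eq_integral(1) absolutely_integrable_norm) (auto simp: absolutely_integrable_on_def)
  also have "\<dots> \<le> integral {0..pi} (\<lambda>t. cmod (g t - h t))"
    using set_integrable_subset[OF gh _ sub] gh
    by (intro integral_subset_le sub) (auto simp: absolutely_integrable_on_def)
  also have "\<dots> = (LINT t|leb_pi. cmod (g t - h t))"
    using g h by (intro lebesgue_integral_eq_integral[symmetric]) auto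
  finally show ?thesis .
qed

lemma continuous_by_parts:
  assumes h: "continuous_on {0..pi} h"
  shows "(LINT x|leb_pi. h x * per_exp m x) = integral {0..pi} h * per_exp m pi
    - (LINT x|leb_pi. integral {0..x} h * (\<i> * of_int m * per_exp m x))"
proof -
  have cH: "continuous_on {0..pi} (\<lambda>x. integral {0..x} h)"
    by (intro indefinite_integral_continuous L2_on_integrable L2_on_continuous h)
  have int: "integrable leb_pi f" if "continuous_on {0..pi} f" for f :: "real \<Rightarrow> complex"
    by (intro L2_on_integrable L2_on_continuous that)
  define J where "J = integral {0..pi} (\<lambda>x. integral {0..x} h * (\<i> * of_int m * per_exp m x))"
  have J: "((\<lambda>x. integral {0..x} h * (\<i> * of_int m * per_exp m x)) has_integral J) {0..pi}"
    unfolding J_def by (intro integrable_integral integrable_continuous_interval continuous_intros cH)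
  have "((\<lambda>x. h x * per_exp m x) has_integral (integral {0..pi} h * per_exp m pi - J)) {0..pi}"
  proof (rule integration_by_parts_interior[where f = "\<lambda>x. integral {0..x} h" and g = "per_exp m" and f' = h
      and g' = "\<lambda>x. \<i> * of_int m * per_exp m x" and prod = "\<lambda>a b. a * b"])
    show "((\<lambda>x. integral {0..x} h) has_vector_derivative h x) (at x)" if "x \<in> {0<..<pi}" for x
      using integral_has_vector_derivative[OF h, of x] that at_within_Icc_at[of 0 x pi] by auto
    show "((\<lambda>x. integral {0..x} h * (\<i> * of_int m * per_exp m x)) has_integral
      integral {0..pi} h * per_exp m pi - integral {0..0} h * per_exp m 0 - (integral {0..pi} h * per_exp m pi - J)) {0..pi}"
      using J by simp
  qed (use cH in \<open>auto intro: continuous_on_per_exp bounded_bilinear_mult has_vector_derivative_per_exp\<close>)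
  then have "integral {0..pi} (\<lambda>x. h x * per_exp m x) = integral {0..pi} h * per_exp m pi - J" by (rule integral_unique)
  moreover have "(LINT x|leb_pi. h x * per_exp m x) = integral {0..pi} (\<lambda>x. h x * per_exp m x)"
    by (intro lebesgue_integral_eq_integral int continuous_intros h) simp
  moreover have "(LINT x|leb_pi. integral {0..x} h * (\<i> * of_int m * per_exp m x)) 
    = J"
    unfolding J_def by (intro lebesgue_integral_eq_integral int continuous_intros cH) simp
  ultimately show ?thesis by simp
qed

text \<open>The defect of the formula is a functional that is bounded in the L1 norm and vanishes on
  continuous functions, which are dense in L1.\<close>

lemma by_parts:
  assumes g: "integrable leb_pi g"
  shows "(LINT x|leb_pi. g x * per_exp m x) = integral {0..pi} g * per_exp m pi
    - (LINT x|leb_pi. integral {0..x} g * (\<i> * of_int m * per_exp m x))"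
proof -
  let ?e' = "\<lambda>x. \<i> * of_int m * per_exp m x"
  define \<Lambda> where "\<Lambda> = (\<lambda>f. (LINT x|leb_pi. f x * per_exp m x) - integral {0..pi} f * per_exp m pi
    + (LINT x|leb_pi. integral {0..x} f * ?e' x))"
  \<comment> \<open>One for the integral on the left, one for the boundary term, and pi |m| for the
    integral of the derivative term over an interval of length pi.\<close>
  define C where "C = 2 + pi * \<bar>real_of_int m\<bar>"
  have C: "C > 0" by (simp add: C_def add_pos_nonneg)
  interpret finite_measure leb_pi by (rule finite_measure_leb_pi)
  have "cmod (\<Lambda> g) \<le> 0"
  proof (rule field_le_epsilon)
    fix e :: real assume "e > 0"
    then have "e / C > 0" using C by simp
    then obtain h where h: "continuous_on {0..pi} h" and gh: "(LINT x|leb_pi. cmod (g x - h x)) < e / C"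
      using L1_continuous_dense[OF g] by blast
    define d where "d = (LINT x|leb_pi. cmod (g x - h x))"
    have ih: "integrable leb_pi h" by (intro L2_on_integrable L2_on_continuous h)
    have int: "integrable leb_pi (\<lambda>x. integral {0..x} f * ?e' x)" if "integrable leb_pi f" for f :: "real \<Rightarrow> complex"
      by (intro L2_on_integrable L2_on_continuous continuous_intros indefinite_integral_continuous that)
    have h0: "\<Lambda> h = 0" using continuous_by_parts[OF h, of m] by (simp add: \<Lambda>_def)
    have D: "cmod (integral {0..x} g - integral {0..x} h) \<le> d" if "x \<in> {0..pi}" for x
      unfolding d_def by (rule indefinite_integral_diff_le[OF g ih that])
    have "\<Lambda> g = \<Lambda> g - \<Lambda> h" by (simp add: h0)
    also have "\<dots> = (LINT x|leb_pi. g x * per_exp m x - h x * per_exp m x) - (integral {0..pi} g - integral {0..pi} h) * per_exp m pi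
      + (LINT x|leb_pi. integral {0..x} g * ?e' x - integral {0..x} h * ?e' x)"
      unfolding \<Lambda>_def using int[OF g] int[OF ih] integrable_mult_per_exp[OF g] integrable_mult_per_exp[OF ih]
      by (simp add: algebra_simps)
    also have "cmod \<dots> \<le> d + d + pi * \<bar>real_of_int m\<bar> * d"
    proof (intro order_trans[OF norm_triangle_ineq] order_trans[OF norm_triangle_ineq4] add_mono)
      have "cmod (LINT x|leb_pi. g x * per_exp m x - h x * per_exp m x) \<le> (LINT x|leb_pi. cmod (g x * per_exp m x - h x * per_exp m x))"
        by (rule integral_norm_bound)
      also have "\<dots> = d" unfolding d_def by (simp add: left_diff_distrib [symmetric] norm_mult)
      finally show "cmod (LINT x|leb_pi. g x * per_exp m x - h x * per_exp m x) \<le> d" .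
      show "cmod ((integral {0..pi} g - integral {0..pi} h) * per_exp m pi) \<le> d"
        using D[of pi] by (simp add: norm_mult)
      have "cmod (LINT x|leb_pi. integral {0..x} g * ?e' x - integral {0..x} h * ?e' x)
        \<le> (LINT x|leb_pi. cmod (integral {0..x} g * ?e' x - integral {0..x} h * ?e' x))"
        by (rule integral_norm_bound)
      also have "\<dots> \<le> (LINT x|leb_pi. \<bar>real_of_int m\<bar> * d)"
      proof (rule integral_mono)
        fix x assume "x \<in> space leb_pi"
        then show "cmod (integral {0..x} g * ?e' x - integral {0..x} h * ?e' x)
          \<le> \<bar>real_of_int m\<bar> * d"
          using D[of x] by (simp add: left_diff_distrib [symmetric] norm_mult mult.commute[of _ "\<bar>real_of_int m\<bar>"] mult_left_mono)
      qed (use int[OF g] int[OF ih] in auto)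
      also have "\<dots> = pi * \<bar>real_of_int m\<bar> * d" by (simp add: measure_restrict_space)
      finally show "cmod (LINT x|leb_pi. integral {0..x} g * ?e' x - integral {0..x} h * ?e' x)
        \<le> pi * \<bar>real_of_int m\<bar> * d" .
    qed
    also have "\<dots> = C * d" by (simp add: C_def algebra_simps)
    also have "\<dots> \<le> e" using gh C by (simp add: d_def field_simps)
    finally show "cmod (\<Lambda> g) \<le> 0 + e" by simp
  qed
  then have "\<Lambda> g = 0" by simp
  then show ?thesis unfolding \<Lambda>_def by (simp add: algebra_simps)
qed

lemma W11_integrable: "W11 y g \<Longrightarrow> integrable leb_pi g"
  by (simp add: W11_def integrable_leb_pi_iff)

lemma W11_integral:
  assumes "W11 y g" "x \<in> {0..pi}"
  shows "integral {0..x} g = y x - y 0"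
proof -
  have "\<forall>x\<in>{0..pi}. y x = y 0 + integral {0..x} g" using assms(1) unfolding W11_def by (rule conjunct2)
  from bspec[OF this assms(2)] show ?thesis by (simp only: add_diff_cancel_left')
qed

lemma W11_continuous:
  assumes "W11 y g"
  shows "continuous_on {0..pi} y"
proof -
  have "continuous_on {0..pi} (\<lambda>x. y 0 + integral {0..x} g)"
    by (intro continuous_intros indefinite_integral_continuous W11_integrable[OF assms])
  then show ?thesis
  proof (rule continuous_on_eq)
    show "y 0 + integral {0..x} g = y x" if "x \<in> {0..pi}" for x
      using W11_integral[OF assms that] by (simp only: add_diff_cancel_left' diff_add_cancel add.commute[of "y 0"])
  qed
qed

text \<open>For \<open>j\<close> of the parity of \<open>n\<close> the exponential changes by the
  same sign over the interval as \<open>y\<close>, so the boundary terms cancel. In the Hill case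
  this applies to \<open>y\<close> and to its quasi-derivative alike.\<close>

lemma fourier_coeff_deriv:
  assumes W: "W11 y g" and per: "y pi = per_sign n * y 0" and j: "even (j - n)"
  shows "fourier_coeff g j = \<i> * of_int j * fourier_coeff y j"
proof -
  let ?e' = "\<lambda>x. \<i> * of_int (- j) * per_exp (- j) x"
  note g = W11_integrable[OF W]
  note y = W11_integral[OF W]
  note cy = W11_continuous[OF W]
  have iy: "integrable leb_pi y" by (intro L2_on_integrable L2_on_continuous cy)
  have E: "per_exp (- j) pi = per_sign n" using j by (auto simp: per_exp_pi per_sign_def)
  have int: "integrable leb_pi (\<lambda>x. y x * ?e' x)" 
     "integrable leb_pi (\<lambda>x. y 0 * ?e' x)" 
    by (intro L2_on_integrable L2_on_continuous continuous_intros cy)+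
  have "integral {0..pi} ?e' = per_exp (- j) pi - per_exp (- j) 0"
    by (intro integral_unique fundamental_theorem_of_calculus has_vector_derivative_per_exp) simp
  moreover have "(LINT x|leb_pi. \<i> * of_int (- j) * per_exp (- j) x) = integral {0..pi} ?e'"
    by (intro lebesgue_integral_eq_integral L2_on_integrable L2_on_continuous continuous_intros) simp
  ultimately have 1: "(LINT x|leb_pi. \<i> * of_int (- j) * per_exp (- j) x) = per_sign n - 1" using E by simp
  have "(LINT x|leb_pi. integral {0..x} g * ?e' x)
    = (LINT x|leb_pi. y x * ?e' x - y 0 * ?e' x)"
  proof (intro Bochner_Integration.integral_cong refl)
    fix x assume "x \<in> space leb_pi"
    then have "integral {0..x} g = y x - y 0" by (intro y) simp
    then show "integral {0..x} g * ?e' x =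
      y x * ?e' x - y 0 * ?e' x"
      by (simp only: left_diff_distrib)
  qed
  also have "\<dots> = (LINT x|leb_pi. \<i> * of_int (- j) * (y x * per_exp (- j) x)) - y 0 * (per_sign n - 1)"
    unfolding Bochner_Integration.integral_diff[OF int] 1[symmetric] integral_mult_right_zero[where c = "y 0", symmetric]
    by (simp only: mult_ac)
  finally have 2: "(LINT x|leb_pi. integral {0..x} g * ?e' x) = 
    \<i> * of_int (- j) * (LINT x|leb_pi. y x * per_exp (- j) x) - y 0 * (per_sign n - 1)" by simp
  have pp: "per_sign n * per_sign n = 1" by (simp add: per_sign_def)
  have "(LINT x|leb_pi. g x * per_exp (- j) x) = (y pi - y 0) * per_sign n
     - (\<i> * of_int (- j) * (LINT x|leb_pi. y x * per_exp (- j) x) - y 0 * (per_sign n - 1))"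
  proof -
    have "integral {0..pi} g = y pi - y 0" by (intro y) simp
    then show ?thesis unfolding by_parts[OF g] 2 E by (simp only:)
  qed
  also have "\<dots> = \<i> * of_int j * (LINT x|leb_pi. y x * per_exp (- j) x)"
    using pp by (simp add: per algebra_simps)
  finally show ?thesis by (simp add: fourier_coeff_eq g iy)
qed

section \<open>Neumann series over index tuples\<close>

text \<open>Compared with \<open>chain\<close>, the last factor is an arbitrary vector instead of a matrix column. This covers the
  remainder of the Neumann series as well.\<close>

fun gchain :: "(int \<Rightarrow> int \<Rightarrow> complex) \<Rightarrow> (int \<Rightarrow> int \<Rightarrow> complex) \<Rightarrow> (int \<Rightarrow> complex) \<Rightarrow> (int \<Rightarrow> complex)
    \<Rightarrow> int \<Rightarrow> int list \<Rightarrow> complex" where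
  "gchain F G f g i [] = f i"
| "gchain F G f g i (j # js) = F i j * gchain G F g f j js"

lemma chain_eq_gchain: "chain F G a js b = gchain F G (\<lambda>i. F i b) (\<lambda>i. G i b) a js"
  by (induction F G a js b rule: chain.induct) auto

lemma gchain_add:
  "gchain F G (\<lambda>i. f i + f' i) (\<lambda>i. g i + g' i) i js = gchain F G f g i js + gchain F G f' g' i js"
  by (induction F G f g i js arbitrary: f' g' rule: gchain.induct) (auto simp: algebra_simps)

text \<open>The roles are exchanged at every step, so a list of even length ends in \<open>f\<close>
  and one of odd length in \<open>g\<close>. This parity later separates the two resonant unknowns
  of the Dirac system.\<close>

lemma gchain_scale:
  "gchain F G (\<lambda>i. b * f i) (\<lambda>i. a * g i) i js = (if even (length js) then b else a) * gchain F G f g i js"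
  by (induction F G f g i js arbitrary: a b rule: gchain.induct) auto

lemma tuples_0 [simp]: "tuples J 0 = {[]}"
  by (auto simp: tuples_def)

lemma tuples_Suc: "tuples J (Suc k) = (\<lambda>(j, js). j # js) ` (J \<times> tuples J k)"
proof (intro equalityI subsetI)
  fix x assume "x \<in> tuples J (Suc k)"
  then show "x \<in> (\<lambda>(j, js). j # js) ` (J \<times> tuples J k)"
    by (cases x) (auto simp: tuples_def image_iff)
qed (auto simp: tuples_def)

lemma inj_on_Cons: "inj_on (\<lambda>(j, js). j # js) A"
  by (auto simp: inj_on_def)

lemma finite_tuples: "finite X \<Longrightarrow> finite (tuples X k)"
  by (induction k) (simp_all add: tuples_Suc)

text \<open>The norms are bounded through finite partial sums, so that no summability side conditions arise.
  \<open>whs_le\<close> bounds the Hilbert-Schmidt norm of \<open>D F D\<close> with both \<open>D\<close> to the power \<open>-1/2\<close>.\<close>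

definition wl2_le :: "int set \<Rightarrow> (int \<Rightarrow> real) \<Rightarrow> (int \<Rightarrow> complex) \<Rightarrow> real \<Rightarrow> bool" where
  "wl2_le J D f \<tau> \<longleftrightarrow> \<tau> \<ge> 0 \<and> (\<forall>X. finite X \<longrightarrow> X \<subseteq> J \<longrightarrow> (\<Sum>j\<in>X. (cmod (f j))\<^sup>2 / D j) \<le> \<tau>\<^sup>2)"

definition whs_le :: "int set \<Rightarrow> (int \<Rightarrow> real) \<Rightarrow> (int \<Rightarrow> int \<Rightarrow> complex) \<Rightarrow> real \<Rightarrow> bool" where
  "whs_le J D F \<rho> \<longleftrightarrow> \<rho> \<ge> 0 \<and> (\<forall>X. finite X \<longrightarrow> X \<subseteq> J \<longrightarrow> (\<Sum>i\<in>X. \<Sum>j\<in>X. (cmod (F i j))\<^sup>2 / (D i * D j)) \<le> \<rho>\<^sup>2)"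

lemma wl2_leD: "wl2_le J D f \<tau> \<Longrightarrow> finite X \<Longrightarrow> X \<subseteq> J \<Longrightarrow> (\<Sum>j\<in>X. (cmod (f j))\<^sup>2 / D j) \<le> \<tau>\<^sup>2"
  "wl2_le J D f \<tau> \<Longrightarrow> \<tau> \<ge> 0"
  by (auto simp: wl2_le_def)

lemma whs_leD: "whs_le J D F \<rho> \<Longrightarrow> finite X \<Longrightarrow> X \<subseteq> J \<Longrightarrow> (\<Sum>i\<in>X. \<Sum>j\<in>X. (cmod (F i j))\<^sup>2 / (D i * D j)) \<le> \<rho>\<^sup>2"
  "whs_le J D F \<rho> \<Longrightarrow> \<rho> \<ge> 0"
  by (auto simp: whs_le_def)

section \<open>Absolute convergence in the weighted norms\<close>

locale weighted =
  fixes J :: "int set" and D :: "int \<Rightarrow> real"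
  assumes D_pos: "j \<in> J \<Longrightarrow> D j > 0"
begin

text \<open>Majorant of the Neumann term of order \<open>k\<close>: moduli throughout, the
  unperturbed weights, and indices confined to a finite set.\<close>

definition abs_sum where
  "abs_sum X F G f g k i = (\<Sum>js\<in>tuples X k. cmod (gchain F G f g i js) * (\<Prod>j\<leftarrow>js. 1 / D j))"

text \<open>Each \<open>1 / D j\<close> is split evenly between the two factors sharing the index
  \<open>j\<close>. This is where the square roots of the weight arise.\<close>

lemma abs_sum_Suc:
  assumes "finite X" and that: "X \<subseteq> J"
  shows "abs_sum X F G f g (Suc k) i = (\<Sum>j\<in>X. (cmod (F i j) / sqrt (D j)) * (abs_sum X G F g f k j / sqrt (D j)))"
proof -
  have "abs_sum X F G f g (Suc k) i = (\<Sum>j\<in>X. \<Sum>js\<in>tuples X k. cmod (F i j) / D j * (cmod (gchain G F g f j js) * (\<Prod>j\<leftarrow>js. 1 / D j)))"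
    unfolding abs_sum_def tuples_Suc
    by (subst sum.reindex[OF inj_on_Cons]) (simp add: sum.cartesian_product o_def case_prod_unfold norm_mult mult_ac)
  also have "\<dots> = (\<Sum>j\<in>X. cmod (F i j) / D j * abs_sum X G F g f k j)"
    by (simp add: abs_sum_def sum_distrib_left)
  also have "\<dots> = (\<Sum>j\<in>X. (cmod (F i j) / sqrt (D j)) * (abs_sum X G F g f k j / sqrt (D j)))"
  proof (intro sum.cong refl)
    fix j assume "j \<in> X"
    then have "D j = sqrt (D j) * sqrt (D j)" using D_pos[of j] that by auto
    then show "cmod (F i j) / D j * abs_sum X G F g f k j = (cmod (F i j) / sqrt (D j)) * (abs_sum X G F g f k j / sqrt (D j))"
      by (metis times_divide_times_eq times_divide_eq_left)
  qed
  finally show ?thesis .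
qed

lemma sqrt_D: "j \<in> J \<Longrightarrow> (x / sqrt (D j))\<^sup>2 = x\<^sup>2 / D j"
  using D_pos[of j] by (simp add: power_divide)

lemma abs_sum_Suc_sq_le:
  assumes X: "finite X" "X \<subseteq> J"
  shows "(abs_sum X F G f g (Suc k) i)\<^sup>2 \<le> (\<Sum>j\<in>X. (cmod (F i j))\<^sup>2 / D j) * (\<Sum>j\<in>X. (abs_sum X G F g f k j)\<^sup>2 / D j)"
proof -
  have "(abs_sum X F G f g (Suc k) i)\<^sup>2 \<le> (\<Sum>j\<in>X. (cmod (F i j) / sqrt (D j))\<^sup>2) * (\<Sum>j\<in>X. (abs_sum X G F g f k j / sqrt (D j))\<^sup>2)"
    unfolding abs_sum_Suc[OF X] by (rule Cauchy_Schwarz_ineq_sum)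
  then show ?thesis using X by (simp add: sqrt_D subset_iff cong: sum.cong)
qed

text \<open>One Cauchy-Schwarz per index: each matrix costs its Hilbert-Schmidt norm, the end vector
  its weighted norm. The induction alternates between \<open>F\<close> and \<open>G\<close>.\<close>

lemma abs_sum_l2:
  assumes "finite X" "X \<subseteq> J" "whs_le J D F \<rho>" "whs_le J D G \<rho>" "wl2_le J D f \<tau>" "wl2_le J D g \<tau>"
  shows "(\<Sum>i\<in>X. (abs_sum X F G f g k i)\<^sup>2 / D i) \<le> (\<rho> ^ k * \<tau>)\<^sup>2"
  using assms
proof (induction k arbitrary: F G f g)
  case 0
  then show ?case using wl2_leD(1)[of J D f \<tau> X] by (simp add: abs_sum_def)
next
  case (Suc k)
  have "(\<Sum>i\<in>X. (abs_sum X F G f g (Suc k) i)\<^sup>2 / D i) \<le> (\<Sum>i\<in>X. (\<Sum>j\<in>X. (cmod (F i j))\<^sup>2 / D j) * (\<rho> ^ k * \<tau>)\<^sup>2 / D i)"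
  proof (intro sum_mono divide_right_mono)
    fix i assume i: "i \<in> X"
    show "0 \<le> D i" using D_pos i Suc.prems by (auto simp: less_imp_le)
    have "(\<Sum>j\<in>X. (cmod (F i j))\<^sup>2 / D j) \<ge> 0"
      using D_pos Suc.prems by (intro sum_nonneg divide_nonneg_pos) auto
    then show "(abs_sum X F G f g (Suc k) i)\<^sup>2 \<le> (\<Sum>j\<in>X. (cmod (F i j))\<^sup>2 / D j) * (\<rho> ^ k * \<tau>)\<^sup>2"
      using abs_sum_Suc_sq_le[OF Suc.prems(1,2)] Suc.IH[OF Suc.prems(1,2,4,3,6,5)]
      by (meson mult_left_mono order_trans)
  qed
  also have "\<dots> = (\<Sum>i\<in>X. \<Sum>j\<in>X. (cmod (F i j))\<^sup>2 / (D i * D j)) * (\<rho> ^ k * \<tau>)\<^sup>2"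
    by (simp add: sum_distrib_left sum_divide_distrib mult_ac)
  also have "\<dots> \<le> \<rho>\<^sup>2 * (\<rho> ^ k * \<tau>)\<^sup>2"
    using Suc.prems by (intro mult_right_mono whs_leD(1)) auto
  finally show ?case by (simp add: power_mult_distrib mult_ac)
qed

text \<open>The starting index may be resonant, hence outside \<open>J\<close>, so the first row has
  its own bound \<sigma>. Of the k + 1 matrices only the remaining k contribute a factor
  \<rho>.\<close>

lemma abs_sum_Suc_le:
  assumes X: "finite X" "X \<subseteq> J" and hs: "whs_le J D F \<rho>" "whs_le J D G \<rho>" and v: "wl2_le J D f \<tau>" "wl2_le J D g \<tau>"
    and row: "wl2_le J D (F i) \<sigma>"
  shows "abs_sum X F G f g (Suc k) i \<le> \<sigma> * \<rho> ^ k * \<tau>"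
proof (rule power2_le_imp_le)
  have "(abs_sum X F G f g (Suc k) i)\<^sup>2 \<le> \<sigma>\<^sup>2 * (\<rho> ^ k * \<tau>)\<^sup>2"
    using D_pos X
    by (intro order_trans[OF abs_sum_Suc_sq_le[OF X]] mult_mono wl2_leD(1)[OF row] abs_sum_l2[OF X hs(2,1) v(2,1)])
       (auto intro!: sum_nonneg divide_nonneg_pos)
  then show "(abs_sum X F G f g (Suc k) i)\<^sup>2 \<le> (\<sigma> * \<rho> ^ k * \<tau>)\<^sup>2" by (simp add: power_mult_distrib mult_ac)
qed (use whs_leD(2)[OF hs(1)] wl2_leD(2)[OF row] wl2_leD(2)[OF v(1)] in auto)

lemma abs_partial_sum_le:
  assumes hs: "whs_le J D F \<rho>" "whs_le J D G \<rho>" and v: "wl2_le J D f \<tau>" "wl2_le J D g \<tau>"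
    and row: "wl2_le J D (F i) \<sigma>" and Y: "finite Y" "Y \<subseteq> tuples J (Suc k)"
  shows "(\<Sum>js\<in>Y. cmod (gchain F G f g i js) * (\<Prod>j\<leftarrow>js. 1 / D j)) \<le> \<sigma> * \<rho> ^ k * \<tau>"
proof -
  define X where "X = (\<Union>js\<in>Y. set js)"
  have X: "finite X" "X \<subseteq> J" and YX: "Y \<subseteq> tuples X (Suc k)"
    using Y by (auto simp: X_def tuples_def)
  have "(\<Sum>js\<in>Y. cmod (gchain F G f g i js) * (\<Prod>j\<leftarrow>js. 1 / D j)) \<le> abs_sum X F G f g (Suc k) i"
    unfolding abs_sum_def
  proof (intro sum_mono2 finite_tuples X YX mult_nonneg_nonneg prod_list_nonneg)
    fix js x assume "js \<in> tuples X (Suc k) - Y" "x \<in> set (map (\<lambda>j. 1 / D j) js)"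
    then show "0 \<le> x" using X D_pos by (auto simp: tuples_def subset_iff less_imp_le)
  qed auto
  also have "\<dots> \<le> \<sigma> * \<rho> ^ k * \<tau>" by (rule abs_sum_Suc_le[OF X hs v row])
  finally show ?thesis .
qed

lemma abs_summable:
  assumes hs: "whs_le J D F \<rho>" "whs_le J D G \<rho>" and v: "wl2_le J D f \<tau>" "wl2_le J D g \<tau>"
    and row: "wl2_le J D (F i) \<sigma>"
  shows "(\<lambda>js. cmod (gchain F G f g i js) * (\<Prod>j\<leftarrow>js. 1 / D j)) summable_on tuples J (Suc k)"
    "(\<Sum>\<^sub>\<infinity>js\<in>tuples J (Suc k). cmod (gchain F G f g i js) * (\<Prod>j\<leftarrow>js. 1 / D j)) \<le> \<sigma> * \<rho> ^ k * \<tau>"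
proof -
  show *: "(\<lambda>js. cmod (gchain F G f g i js) * (\<Prod>j\<leftarrow>js. 1 / D j)) summable_on tuples J (Suc k)"
    using D_pos
    by (intro nonneg_bdd_above_summable_on bdd_aboveI2[where M = "\<sigma> * \<rho> ^ k * \<tau>"] abs_partial_sum_le[OF hs v row]
        mult_nonneg_nonneg prod_list_nonneg) (auto simp: tuples_def subset_iff less_imp_le)
  show "(\<Sum>\<^sub>\<infinity>js\<in>tuples J (Suc k). cmod (gchain F G f g i js) * (\<Prod>j\<leftarrow>js. 1 / D j)) \<le> \<sigma> * \<rho> ^ k * \<tau>"
    by (rule infsum_le_finite_sums[OF * abs_partial_sum_le[OF hs v row]])
qed

text \<open>The coefficient \<open>c\<close> stands for a product of inverse denominators or for a
  difference of two such products, so that size and Lipschitz bounds come from one estimate.\<close>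

lemma norm_infsum_tuples_le:
  assumes hs: "whs_le J D F \<rho>" "whs_le J D G \<rho>" and v: "wl2_le J D f \<tau>" "wl2_le J D g \<tau>"
    and row: "wl2_le J D (F i) \<sigma>" and K: "K \<ge> 0"
    and c: "\<And>js. js \<in> tuples J (Suc k) \<Longrightarrow> cmod (c js) \<le> K * (\<Prod>j\<leftarrow>js. 1 / D j)"
  shows "(\<lambda>js. norm (gchain F G f g i js * c js)) summable_on tuples J (Suc k)"
    "cmod (\<Sum>\<^sub>\<infinity>js\<in>tuples J (Suc k). gchain F G f g i js * c js) \<le> K * (\<sigma> * \<rho> ^ k * \<tau>)"
proof -
  let ?w = "\<lambda>js. cmod (gchain F G f g i js) * (\<Prod>j\<leftarrow>js. 1 / D j)"
  have le: "cmod (gchain F G f g i js * c js) \<le> K * ?w js" if "js \<in> tuples J (Suc k)" for js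
    using mult_left_mono[OF c[OF that], of "cmod (gchain F G f g i js)"] by (simp add: norm_mult mult_ac)
  note S = summable_on_cmult_right[OF abs_summable(1)[OF hs v row, of k], of K]
  show 1: "(\<lambda>js. norm (gchain F G f g i js * c js)) summable_on tuples J (Suc k)"
    using le by (intro summable_on_comparison_test[OF S]) auto
  have "cmod (\<Sum>\<^sub>\<infinity>js\<in>tuples J (Suc k). gchain F G f g i js * c js) \<le> (\<Sum>\<^sub>\<infinity>js\<in>tuples J (Suc k). cmod (gchain F G f g i js * c js))"
    by (rule norm_infsum_bound[OF 1])
  also have "\<dots> \<le> (\<Sum>\<^sub>\<infinity>js\<in>tuples J (Suc k). K * ?w js)"
    by (rule infsum_mono[OF 1 S le])
  also have "\<dots> = K * (\<Sum>\<^sub>\<infinity>js\<in>tuples J (Suc k). ?w js)"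
    by (rule infsum_cmult_right')
  also have "\<dots> \<le> K * (\<sigma> * \<rho> ^ k * \<tau>)"
    by (intro mult_left_mono K abs_summable(2)[OF hs v row])
  finally show "cmod (\<Sum>\<^sub>\<infinity>js\<in>tuples J (Suc k). gchain F G f g i js * c js) \<le> K * (\<sigma> * \<rho> ^ k * \<tau>)" .
qed

text \<open>Allows chains to start at an off-resonant index, so that the expansion also recovers the
  off-resonant coefficients. The bound depends on \<open>i\<close>, which is harmless for one fixed
  row.\<close>

lemma whs_le_row:
  assumes hs: "whs_le J D F \<rho>" and i: "i \<in> J"
  shows "wl2_le J D (F i) (\<rho> * sqrt (D i))"
  unfolding wl2_le_def
proof (intro conjI allI impI)
  show "0 \<le> \<rho> * sqrt (D i)" using whs_leD(2)[OF hs] D_pos[OF i] by simp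
  fix X assume X: "finite X" "X \<subseteq> J"
  let ?X = "insert i X"
  have "(\<Sum>j\<in>X. (cmod (F i j))\<^sup>2 / D j) / D i \<le> (\<Sum>j\<in>?X. (cmod (F i j))\<^sup>2 / D j) / D i"
    using X i D_pos by (intro divide_right_mono sum_mono2) (auto simp: less_imp_le)
  also have "\<dots> = (\<Sum>j\<in>?X. (cmod (F i j))\<^sup>2 / (D i * D j))"
    by (simp add: sum_divide_distrib mult.commute)
  also have "\<dots> \<le> (\<Sum>i\<in>?X. \<Sum>j\<in>?X. (cmod (F i j))\<^sup>2 / (D i * D j))"
    using X i D_pos
    by (intro member_le_sum[of i ?X "\<lambda>i. \<Sum>j\<in>?X. (cmod (F i j))\<^sup>2 / (D i * D j)"] sum_nonneg divide_nonneg_pos mult_pos_pos) auto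
  also have "\<dots> \<le> \<rho>\<^sup>2" using X i by (intro whs_leD[OF hs]) auto
  finally show "(\<Sum>j\<in>X. (cmod (F i j))\<^sup>2 / D j) \<le> (\<rho> * sqrt (D i))\<^sup>2"
    using D_pos[OF i] by (simp add: power_mult_distrib field_simps)
qed

lemma wl2_le_mono: "wl2_le J D f s \<Longrightarrow> s \<le> t \<Longrightarrow> wl2_le J D f t"
  unfolding wl2_le_def by (meson order_trans power_mono)

end

section \<open>Neumann expansion with perturbed denominators\<close>

definition tsum where
  "tsum J d F G f g k i = (\<Sum>\<^sub>\<infinity>js\<in>tuples J k. gchain F G f g i js / (\<Prod>j\<leftarrow>js. d j))"

lemma tsum_0 [simp]: "tsum J d F G f g 0 i = f i"
  by (simp add: tsum_def)

text \<open>\<open>D\<close> is the distance at z = 0 and \<open>d\<close> the denominator at z. At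
  least half of the distance survives as long as z stays in the disc around the n-th unperturbed
  eigenvalue.\<close>

locale perturbed = weighted +
  fixes d :: "int \<Rightarrow> complex"
  assumes d_ge: "j \<in> J \<Longrightarrow> cmod (d j) \<ge> D j / 2"
begin

lemma d_nz: "j \<in> J \<Longrightarrow> d j \<noteq> 0"
  using d_ge[of j] D_pos[of j] by auto

lemma inverse_prod_le: "js \<in> tuples J k \<Longrightarrow> cmod (1 / (\<Prod>j\<leftarrow>js. d j)) \<le> 2 ^ k * (\<Prod>j\<leftarrow>js. 1 / D j)"
proof (induction k arbitrary: js)
  case (Suc k)
  then obtain j js' where js: "js = j # js'" "j \<in> J" "js' \<in> tuples J k" by (auto simp: tuples_Suc)
  have "cmod (1 / (\<Prod>j\<leftarrow>js. d j)) = 1 / cmod (d j) * cmod (1 / (\<Prod>j\<leftarrow>js'. d j))"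
    by (simp add: js norm_mult norm_divide)
  also have "\<dots> \<le> 2 / D j * (2 ^ k * (\<Prod>j\<leftarrow>js'. 1 / D j))"
    using d_ge[OF js(2)] D_pos[OF js(2)] d_nz[OF js(2)] Suc.IH[OF js(3)]
    by (intro mult_mono) (auto simp: field_simps)
  finally show ?case by (simp add: js mult_ac)
qed simp

context
  fixes F G f g \<rho> \<tau>
  assumes hs: "whs_le J D F \<rho>" "whs_le J D G \<rho>" and v: "wl2_le J D f \<tau>" "wl2_le J D g \<tau>"
begin

lemma tsum_summable:
  assumes row: "wl2_le J D (F i) \<sigma>"
  shows "(\<lambda>js. norm (gchain F G f g i js / (\<Prod>j\<leftarrow>js. d j))) summable_on tuples J k"
proof (cases k)
  case (Suc k')
  then show ?thesis
    using norm_infsum_tuples_le(1)[OF hs v row _ inverse_prod_le, of "Suc k'"] by simp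
qed simp

lemma tsum_le:
  assumes row: "wl2_le J D (F i) \<sigma>"
  shows "cmod (tsum J d F G f g (Suc k) i) \<le> 2 ^ Suc k * (\<sigma> * \<rho> ^ k * \<tau>)"
  unfolding tsum_def
  using norm_infsum_tuples_le(2)[OF hs v row _ inverse_prod_le, of "Suc k"] by simp

end

text \<open>\<open>tsum\<close> with order \<open>k\<close> is the component \<open>i\<close> of the
  alternating product F (1/d) G (1/d) ... applied to the end vector, with \<open>k\<close> matrices.
  Splitting off the first one is Fubini for absolutely summable families.\<close>

lemma tsum_Suc:
  assumes hs: "whs_le J D F \<rho>" "whs_le J D G \<rho>" and v: "wl2_le J D f \<tau>" "wl2_le J D g \<tau>"
    and row: "wl2_le J D (F i) \<sigma>"
  shows "((\<lambda>j. F i j / d j * tsum J d G F g f k j) has_sum tsum J d F G f g (Suc k) i) J"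
proof -
  let ?h = "\<lambda>(j, js). F i j / d j * (gchain G F g f j js / (\<Prod>j\<leftarrow>js. d j))"
  let ?e = "\<lambda>(j, js). j # js"
  have h: "(\<lambda>js. gchain F G f g i js / (\<Prod>j\<leftarrow>js. d j)) \<circ> ?e = ?h"
    by (auto simp: fun_eq_iff)
  have "((\<lambda>js. gchain F G f g i js / (\<Prod>j\<leftarrow>js. d j)) has_sum tsum J d F G f g (Suc k) i) (?e ` (J \<times> tuples J k))"
    unfolding tsum_def tuples_Suc[symmetric]
    by (rule has_sum_infsum[OF abs_summable_summable[OF tsum_summable[OF hs v row]]])
  then have S: "(?h has_sum tsum J d F G f g (Suc k) i) (J \<times> tuples J k)"
    unfolding has_sum_reindex[OF inj_on_Cons] h .
  show ?thesis
  proof (rule has_sum_SigmaD[OF S])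
    fix j assume j: "j \<in> J"
    show "((\<lambda>js. ?h (j, js)) has_sum F i j / d j * tsum J d G F g f k j) (tuples J k)"
      unfolding tsum_def prod.case
      by (rule has_sum_cmult_right[OF has_sum_infsum[OF abs_summable_summable[OF
          tsum_summable[OF hs(2,1) v(2,1) whs_le_row[OF hs(2) j]]]]])
  qed
qed

lemma tsum_add:
  assumes hs: "whs_le J D F \<rho>" "whs_le J D G \<rho>" and row: "wl2_le J D (F i) \<sigma>"
    and v: "wl2_le J D f \<tau>" "wl2_le J D g \<tau>" "wl2_le J D f' \<tau>'" "wl2_le J D g' \<tau>'"
  shows "tsum J d F G (\<lambda>i. f i + f' i) (\<lambda>i. g i + g' i) k i = tsum J d F G f g k i + tsum J d F G f' g' k i"
  unfolding tsum_def gchain_add add_divide_distrib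
  by (intro infsum_add) (rule abs_summable_summable, rule tsum_summable[OF hs _ _ row], fact v, fact v)+

lemma tsum_scale:
  "tsum J d F G (\<lambda>i. b * f i) (\<lambda>i. a * g i) k i = (if even k then b else a) * tsum J d F G f g k i"
proof -
  have "tsum J d F G (\<lambda>i. b * f i) (\<lambda>i. a * g i) k i = (\<Sum>\<^sub>\<infinity>js\<in>tuples J k. (if even k then b else a) * (gchain F G f g i js / (\<Prod>j\<leftarrow>js. d j)))"
    unfolding tsum_def by (intro infsum_cong) (auto simp: gchain_scale tuples_def)
  then show ?thesis by (simp only: infsum_cmult_right' tsum_def)
qed

text \<open>With B = F b, A = G a and the off-resonant equations d a = f + B, d b = g + A, one
  substitution reads B = F (1/d) g + F (1/d) A. Applied at the end of a chain it gives the claim.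
  The equation for \<open>B i\<close> is a separate hypothesis since \<open>i\<close> may be
  resonant.\<close>

lemma tsum_step:
  assumes "whs_le J D F \<rho>" "whs_le J D G \<rho>" "wl2_le J D f \<tau>" "wl2_le J D g \<tau>" "wl2_le J D A \<tau>'" "wl2_le J D B \<tau>'"
    "wl2_le J D (F i) \<sigma>"
    "B i = (\<Sum>\<^sub>\<infinity>m\<in>J. F i m * b m)"
    "\<And>i. i \<in> J \<Longrightarrow> A i = (\<Sum>\<^sub>\<infinity>m\<in>J. G i m * a m)" "\<And>i. i \<in> J \<Longrightarrow> B i = (\<Sum>\<^sub>\<infinity>m\<in>J. F i m * b m)"
    "\<And>m. m \<in> J \<Longrightarrow> d m * a m = f m + B m" "\<And>m. m \<in> J \<Longrightarrow> d m * b m = g m + A m"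
  shows "tsum J d F G B A k i = tsum J d F G f g (Suc k) i + tsum J d F G B A (Suc k) i"
  using assms
proof (induction k arbitrary: F G f g A B a b i \<sigma>)
  case 0
  note 1 = tsum_Suc[OF 0(1-4,7), of 0] and 2 = tsum_Suc[OF 0(1,2,6,5,7), of 0]
  have "((\<lambda>m. F i m / d m * g m + F i m / d m * A m) has_sum
     (tsum J d F G f g (Suc 0) i + tsum J d F G B A (Suc 0) i)) J"
    using has_sum_add[OF 1 2] by (simp only: tsum_0)
  also have "?this \<longleftrightarrow> ((\<lambda>m. F i m * b m) has_sum (tsum J d F G f g (Suc 0) i + tsum J d F G B A (Suc 0) i)) J"
  proof (rule has_sum_cong)
    fix m assume m: "m \<in> J"
    have "b m = (g m + A m) / d m" unfolding 0(12)[OF m, symmetric] using d_nz[OF m] by simp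
    show "F i m / d m * g m + F i m / d m * A m = F i m * b m"
      unfolding \<open>b m = _\<close> by (simp add: distrib_left add_divide_distrib)
  qed
  finally show ?case using 0(8) by (simp only: infsumI tsum_0)
next
  case (Suc k)
  note 1 = tsum_Suc[OF Suc.prems(1-4,7), of "Suc k"] and 2 = tsum_Suc[OF Suc.prems(1,2,6,5,7), of "Suc k"]
    and 3 = tsum_Suc[OF Suc.prems(1,2,6,5,7), of k]
  have "tsum J d G F A B k j = tsum J d G F g f (Suc k) j + tsum J d G F A B (Suc k) j" if j: "j \<in> J" for j
    by (rule Suc.IH[OF Suc.prems(2,1,4,3,6,5) whs_le_row[OF Suc.prems(2) j] Suc.prems(9)[OF j] Suc.prems(10,9,12,11)])
  then have "F i j / d j * tsum J d G F A B k j =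
      F i j / d j * tsum J d G F g f (Suc k) j + F i j / d j * tsum J d G F A B (Suc k) j" if "j \<in> J" for j
    using that by (simp only: distrib_left)
  from has_sum_cong[THEN iffD2, OF this has_sum_add[OF 1 2]]
  have "((\<lambda>j. F i j / d j * tsum J d G F A B k j) has_sum
     (tsum J d F G f g (Suc (Suc k)) i + tsum J d F G B A (Suc (Suc k)) i)) J" .
  with 3 show ?case by (rule has_sum_unique)
qed

text \<open>Iterating \<open>tsum_step\<close> leaves a remainder whose end vectors are
  \<open>A\<close> and \<open>B\<close> themselves. Each order costs at most 2/8 = 1/4, so any
  finite bound \<tau>' on these vectors makes it vanish in the limit.\<close>

theorem neumann_expansion:
  assumes hs: "whs_le J D F \<rho>" "whs_le J D G \<rho>" and v: "wl2_le J D f \<tau>" "wl2_le J D g \<tau>" "wl2_le J D A \<tau>'" "wl2_le J D B \<tau>'"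
    and row: "wl2_le J D (F i) \<sigma>" and Bi: "B i = (\<Sum>\<^sub>\<infinity>m\<in>J. F i m * b m)"
    and AB: "\<And>i. i \<in> J \<Longrightarrow> A i = (\<Sum>\<^sub>\<infinity>m\<in>J. G i m * a m)" "\<And>i. i \<in> J \<Longrightarrow> B i = (\<Sum>\<^sub>\<infinity>m\<in>J. F i m * b m)"
    and ab: "\<And>m. m \<in> J \<Longrightarrow> d m * a m = f m + B m" "\<And>m. m \<in> J \<Longrightarrow> d m * b m = g m + A m"
    and \<rho>: "\<rho> \<le> 1 / 8"
  shows "(\<lambda>k. tsum J d F G f g (Suc k) i) sums B i"
proof -
  have eq: "(\<Sum>k<K. tsum J d F G f g (Suc k) i) = B i - tsum J d F G B A K i" for K
  proof (induction K)
    case 0 show ?case by simp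
  next
    case (Suc K)
    have "b - x + y = b - z" if "x = y + z" for b x y z :: complex using that by simp
    from this[OF tsum_step[OF hs v row Bi AB ab]] show ?case unfolding sum.lessThan_Suc Suc .
  qed
  have r: "cmod (tsum J d F G B A (Suc k) i) \<le> 2 * \<sigma> * \<tau>' * (1 / 4) ^ k" for k
  proof -
    have "cmod (tsum J d F G B A (Suc k) i) \<le> 2 ^ Suc k * (\<sigma> * \<rho> ^ k * \<tau>')"
      by (rule tsum_le[OF hs v(4,3) row])
    also have "\<dots> \<le> 2 ^ Suc k * (\<sigma> * (1 / 8) ^ k * \<tau>')"
      using \<rho> whs_leD(2)[OF hs(1)] wl2_leD(2)[OF row] wl2_leD(2)[OF v(3)]
      by (intro mult_left_mono mult_right_mono power_mono) auto
    also have "\<dots> = 2 * \<sigma> * \<tau>' * ((2 ^ k) * (1 / 8) ^ k)" by (simp only: power_Suc mult_ac)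
    also have "(2 ^ k) * (1 / 8) ^ k = (1 / 4 :: real) ^ k" unfolding power_mult_distrib[symmetric] by simp
    finally show ?thesis .
  qed
  have "(\<lambda>k. 2 * \<sigma> * \<tau>' * (1 / 4) ^ k) \<longlonglongrightarrow> 2 * \<sigma> * \<tau>' * 0"
    by (intro tendsto_intros LIMSEQ_power_zero) simp
  then have "(\<lambda>k. tsum J d F G B A (Suc k) i) \<longlonglongrightarrow> 0"
    by (intro Lim_null_comparison[OF always_eventually[OF allI[OF r]]]) (simp only: mult_zero_right)
  then have "(\<lambda>k. B i - tsum J d F G B A (Suc k) i) \<longlonglongrightarrow> B i - 0"
    by (intro tendsto_intros)
  then have "(\<lambda>k. \<Sum>k<Suc k. tsum J d F G f g (Suc k) i) \<longlonglongrightarrow> B i" unfolding eq diff_0_right .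
  then show ?thesis unfolding sums_def by (subst (asm) filterlim_sequentially_Suc)
qed

end

section \<open>Lipschitz dependence on the denominators\<close>

lemma (in weighted) inverse_prod_diff_le:
  assumes "perturbed J D d" "perturbed J D d'" and \<delta>: "\<delta> > 0" "\<And>j. j \<in> J \<Longrightarrow> D j \<ge> \<delta>"
    and h: "\<And>j. j \<in> J \<Longrightarrow> d j - d' j = h"
  shows "js \<in> tuples J k \<Longrightarrow> cmod (1 / (\<Prod>j\<leftarrow>js. d j) - 1 / (\<Prod>j\<leftarrow>js. d' j)) \<le> real k * cmod h * (2 / \<delta>) * 2 ^ k * (\<Prod>j\<leftarrow>js. 1 / D j)"
proof (induction k arbitrary: js)
  case (Suc k)
  interpret d: perturbed J D d by fact
  interpret d': perturbed J D d' by fact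
  obtain j js' where js: "js = j # js'" and j: "j \<in> J" and js': "js' \<in> tuples J k"
    using Suc.prems by (auto simp: tuples_Suc)
  define p where "p = 1 / (\<Prod>j\<leftarrow>js'. d j)"
  define p' where "p' = 1 / (\<Prod>j\<leftarrow>js'. d' j)"
  define w where "w = (\<Prod>j\<leftarrow>js'. 1 / D j)"
  have D: "D j > 0" by (rule D_pos[OF j])
  have w: "w \<ge> 0" unfolding w_def using js' D_pos
    by (intro prod_list_nonneg) (auto simp: tuples_def less_imp_le)
  have i: "cmod (1 / d j) \<le> 2 / D j" "cmod (1 / d' j) \<le> 2 / D j" "cmod (1 / d' j) \<le> 2 / \<delta>"
    using d.d_ge[OF j] d'.d_ge[OF j] d.d_nz[OF j] d'.d_nz[OF j] D \<delta>(1) \<delta>(2)[OF j]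
    by (auto simp: norm_divide divide_simps)
  \<comment> \<open>Telescoping over the positions of the tuple, which produces the factor k. A
    single difference of inverses is h over two denominators: one stays as the weight, the other is
    bounded below uniformly through \<delta>.\<close>
  have "1 / (\<Prod>j\<leftarrow>js. d j) - 1 / (\<Prod>j\<leftarrow>js. d' j) = (1 / d j - 1 / d' j) * p + (1 / d' j) * (p - p')"
    unfolding js p_def p'_def by (simp add: algebra_simps)
  also have "1 / d j - 1 / d' j = - h * (1 / d j) * (1 / d' j)"
    unfolding h[OF j, symmetric] using d.d_nz[OF j] d'.d_nz[OF j] by (simp add: field_simps)
  finally have "cmod (1 / (\<Prod>j\<leftarrow>js. d j) - 1 / (\<Prod>j\<leftarrow>js. d' j)) \<le>
     cmod (- h * (1 / d j) * (1 / d' j)) * cmod p + cmod (1 / d' j) * cmod (p - p')"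
    by (metis norm_triangle_ineq norm_mult)
  also have "\<dots> \<le> (cmod h * (2 / D j) * (2 / \<delta>)) * (2 ^ k * w)
      + (2 / D j) * (real k * cmod h * (2 / \<delta>) * 2 ^ k * w)"
  proof (intro add_mono mult_mono)
    show "cmod (- h * (1 / d j) * (1 / d' j)) \<le> cmod h * (2 / D j) * (2 / \<delta>)"
      unfolding norm_mult norm_minus_cancel using D by (intro mult_mono i order_refl) auto
    show "cmod p \<le> 2 ^ k * w" unfolding p_def w_def by (rule d.inverse_prod_le[OF js'])
    show "cmod (1 / d' j) \<le> 2 / D j" by (rule i)
    show "cmod (p - p') \<le> real k * cmod h * (2 / \<delta>) * 2 ^ k * w"
      unfolding p_def p'_def w_def by (rule Suc.IH[OF js'])
  qed (use D \<delta>(1) w in auto)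
  also have "\<dots> = real (Suc k) * cmod h * (2 / \<delta>) * 2 ^ Suc k * (\<Prod>j\<leftarrow>js. 1 / D j)"
    unfolding js w_def by (simp add: algebra_simps add_divide_distrib)
  finally show ?case .
qed simp

text \<open>Absorbs the number of telescoping terms into a geometric factor.\<close>

lemma Suc_le_two_power: "real (Suc k) \<le> 2 ^ k"
  by (induction k) auto

lemma (in weighted) tsum_lipschitz:
  assumes d: "perturbed J D d" "perturbed J D d'" and \<delta>: "\<delta> > 0" "\<And>j. j \<in> J \<Longrightarrow> D j \<ge> \<delta>"
    and h: "\<And>j. j \<in> J \<Longrightarrow> d j - d' j = h"
    and hs: "whs_le J D F \<rho>" "whs_le J D G \<rho>" and v: "wl2_le J D f \<tau>" "wl2_le J D g \<tau>" 
    and row: "wl2_le J D (F i) \<sigma>" and \<rho>: "\<rho> \<le> 1 / 8"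
  shows "cmod (tsum J d F G f g (Suc k) i - tsum J d' F G f g (Suc k) i) \<le> 4 * \<sigma> * \<tau> / \<delta> * cmod h * (1 / 2) ^ k"
proof -
  interpret d: perturbed J D d by fact
  interpret d': perturbed J D d' by fact
  define K where "K = real (Suc k) * cmod h * (2 / \<delta>) * 2 ^ Suc k"
  have K: "K \<ge> 0" using \<delta>(1) by (simp add: K_def)
  have nn: "\<sigma> \<ge> 0" "\<tau> \<ge> 0" "\<rho> \<ge> 0" using wl2_leD(2)[OF row] wl2_leD(2)[OF v(1)] whs_leD(2)[OF hs(1)] by auto
  have "tsum J d F G f g (Suc k) i - tsum J d' F G f g (Suc k) i
    = (\<Sum>\<^sub>\<infinity>js\<in>tuples J (Suc k). gchain F G f g i js / (\<Prod>j\<leftarrow>js. d j) + - (gchain F G f g i js / (\<Prod>j\<leftarrow>js. d' j)))"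
    unfolding tsum_def
    by (subst infsum_add)
       (simp_all add: infsum_uminus summable_on_uminus
          abs_summable_summable[OF d.tsum_summable[OF hs v row]] abs_summable_summable[OF d'.tsum_summable[OF hs v row]])
  also have "\<dots> = (\<Sum>\<^sub>\<infinity>js\<in>tuples J (Suc k). gchain F G f g i js * (1 / (\<Prod>j\<leftarrow>js. d j) - 1 / (\<Prod>j\<leftarrow>js. d' j)))"
    by (simp add: right_diff_distrib)
  also have "cmod \<dots> \<le> K * (\<sigma> * \<rho> ^ k * \<tau>)"
    by (rule norm_infsum_tuples_le(2)[OF hs v row K])
       (unfold K_def, rule inverse_prod_diff_le[OF d \<delta> h])
  also have "\<dots> \<le> (2 ^ k * cmod h * (2 / \<delta>) * 2 ^ Suc k) * (\<sigma> * (1 / 8) ^ k * \<tau>)"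
    unfolding K_def using \<delta>(1) nn \<rho> Suc_le_two_power[of k]
    by (intro mult_mono power_mono) auto
  also have "\<dots> = 4 * \<sigma> * \<tau> / \<delta> * cmod h * (2 ^ k * 2 ^ k * (1 / 8) ^ k)"
    by (simp add: field_simps)
  \<comment> \<open>One power of 2 comes from the halved denominators, one from the number of
    telescoping terms; 1/8 is the threshold that leaves ratio 1/2.\<close>
  also have "2 ^ k * 2 ^ k * (1 / 8) ^ k = (1 / 2 :: real) ^ k"
    unfolding power_mult_distrib[symmetric] by simp
  finally show ?thesis .
qed

text \<open>\<open>r\<close> selects the orders that occur: all of them for Hill, those of one
  parity for Dirac.\<close>

lemma (in perturbed) tsum_summable_seq:
  assumes hs: "whs_le J D F \<rho>" "whs_le J D G \<rho>" and v: "wl2_le J D f \<tau>" "wl2_le J D g \<tau>" 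
    and row: "wl2_le J D (F i) \<sigma>" and \<rho>: "\<rho> \<le> 1 / 8" and r: "\<And>k. r k \<ge> k"
  shows "summable (\<lambda>k. tsum J d F G f g (Suc (r k)) i)"
proof (rule summable_comparison_test'[where N = 0])
  have nn: "\<sigma> \<ge> 0" "\<tau> \<ge> 0" "\<rho> \<ge> 0" using wl2_leD(2)[OF row] wl2_leD(2)[OF v(1)] whs_leD(2)[OF hs(1)] by auto
  show "summable (\<lambda>k. 2 * \<sigma> * \<tau> * (1 / 4) ^ k)" by (intro summable_mult summable_geometric) simp
  fix k
  have "cmod (tsum J d F G f g (Suc (r k)) i) \<le> 2 ^ Suc (r k) * (\<sigma> * \<rho> ^ r k * \<tau>)"
    by (rule tsum_le[OF hs v row])
  also have "\<dots> \<le> 2 ^ Suc (r k) * (\<sigma> * (1 / 8) ^ r k * \<tau>)"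
    using nn \<rho> by (intro mult_left_mono mult_right_mono power_mono) auto
  also have "\<dots> = 2 * \<sigma> * \<tau> * (2 ^ r k * (1 / 8) ^ r k)" by simp
  also have "2 ^ r k * (1 / 8) ^ r k = (1 / 4 :: real) ^ r k"
    unfolding power_mult_distrib[symmetric] by simp
  also have "2 * \<sigma> * \<tau> * (1 / 4) ^ r k \<le> 2 * \<sigma> * \<tau> * (1 / 4) ^ k"
    using nn by (intro mult_left_mono power_decreasing r) auto
  finally show "cmod (tsum J d F G f g (Suc (r k)) i) \<le> 2 * \<sigma> * \<tau> * (1 / 4) ^ k" .
qed

lemma (in weighted) suminf_tsum_lipschitz:
  assumes d: "perturbed J D d" "perturbed J D d'" and \<delta>: "\<delta> > 0" "\<And>j. j \<in> J \<Longrightarrow> D j \<ge> \<delta>"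
    and h: "\<And>j. j \<in> J \<Longrightarrow> d j - d' j = h"
    and hs: "whs_le J D F \<rho>" "whs_le J D G \<rho>" and v: "wl2_le J D f \<tau>" "wl2_le J D g \<tau>" 
    and row: "wl2_le J D (F i) \<sigma>" and \<rho>: "\<rho> \<le> 1 / 8" and r: "\<And>k. r k \<ge> k"
  shows "cmod ((\<Sum>k. tsum J d F G f g (Suc (r k)) i) - (\<Sum>k. tsum J d' F G f g (Suc (r k)) i)) \<le> 8 * \<sigma> * \<tau> / \<delta> * cmod h"
proof -
  have nn: "\<sigma> \<ge> 0" "\<tau> \<ge> 0" using wl2_leD(2)[OF row] wl2_leD(2)[OF v(1)] by auto
  let ?C = "4 * \<sigma> * \<tau> / \<delta> * cmod h"
  have C: "?C \<ge> 0" using nn \<delta>(1) by simp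
  note s = perturbed.tsum_summable_seq[OF d(1) hs v row \<rho> r] perturbed.tsum_summable_seq[OF d(2) hs v row \<rho> r]
  have g: "(\<lambda>k. ?C * (1 / 2) ^ k) sums (?C * (1 / (1 - 1 / 2)))"
    by (intro sums_mult geometric_sums) simp
  have le: "cmod (tsum J d F G f g (Suc (r k)) i - tsum J d' F G f g (Suc (r k)) i) \<le> ?C * (1 / 2) ^ k" for k
  proof -
    have "cmod (tsum J d F G f g (Suc (r k)) i - tsum J d' F G f g (Suc (r k)) i) \<le> ?C * (1 / 2) ^ r k"
      by (rule tsum_lipschitz[OF d \<delta> h hs v row \<rho>])
    also have "\<dots> \<le> ?C * (1 / 2) ^ k"
      using C by (intro mult_left_mono power_decreasing r) auto
    finally show ?thesis .
  qed
  have "cmod ((\<Sum>k. tsum J d F G f g (Suc (r k)) i) - (\<Sum>k. tsum J d' F G f g (Suc (r k)) i))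
    = cmod (\<Sum>k. tsum J d F G f g (Suc (r k)) i - tsum J d' F G f g (Suc (r k)) i)"
    by (simp add: suminf_diff[OF s])
  also have "\<dots> \<le> (\<Sum>k. ?C * (1 / 2) ^ k)"
    by (rule norm_suminf_le[OF le sums_summable[OF g]])
  also have "\<dots> = 8 * \<sigma> * \<tau> / \<delta> * cmod h" using sums_unique[OF g] by simp
  finally show ?thesis .
qed

section \<open>Symmetries of chains, which make the two diagonal entries of the reduced system
  equal\<close>

lemma chain_snoc:
  "chain F G a (js @ [j]) b = chain F G a js j * (if even (length js) then G else F) j b"
  by (induction F G a js b rule: chain.induct) auto

text \<open>Reading a chain backwards transposes each matrix; the parity of the length decides which
  of \<open>F\<close> and \<open>G\<close> comes first.\<close>

lemma chain_rev:
  "chain F G a js b = (if even (length js) then chain (\<lambda>i j. F j i) (\<lambda>i j. G j i) else chain (\<lambda>i j. G j i) (\<lambda>i j. F j i)) b (rev js) a"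
  by (induction F G a js b rule: chain.induct) (auto simp: chain_snoc)

text \<open>Together with reversal this exchanges n and -n for Hill chains, whose entries depend on
  i - j only.\<close>

lemma chain_reflect:
  "chain (\<lambda>i j. F (- i) (- j)) (\<lambda>i j. G (- i) (- j)) a js b = chain F G (- a) (map uminus js) (- b)"
proof (induction js arbitrary: F G a)
  case (Cons j js)
  show ?case using Cons[of G F j] by simp
qed simp

lemma determinant_2x2:
  fixes x y z \<alpha> p q :: complex
  assumes "z * x = \<alpha> * x + p * y" "z * y = q * x + \<alpha> * y" "x \<noteq> 0 \<or> y \<noteq> 0"
  shows "(z - \<alpha>)\<^sup>2 = p * q"
proof -
  have e: "(z - \<alpha>) * x = p * y" "(z - \<alpha>) * y = q * x" using assms by (simp_all add: algebra_simps)
  have "((z - \<alpha>)\<^sup>2 - p * q) * x = 0" "((z - \<alpha>)\<^sup>2 - p * q) * y = 0"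
    using e by algebra+
  then show ?thesis using assms(3) by auto
qed

section \<open>Weighted norms of Fourier coefficient matrices\<close>

definition sums_bounded :: "('a \<Rightarrow> real) \<Rightarrow> real \<Rightarrow> bool" where
  "sums_bounded u U \<longleftrightarrow> (\<forall>x. u x \<ge> 0) \<and> (\<forall>X. finite X \<longrightarrow> sum u X \<le> U)"

lemma sums_boundedD: "sums_bounded u U \<Longrightarrow> u x \<ge> 0" "sums_bounded u U \<Longrightarrow> finite X \<Longrightarrow> sum u X \<le> U"
  "sums_bounded u U \<Longrightarrow> U \<ge> 0"
  unfolding sums_bounded_def by (auto dest: spec[of _ "{}"])

lemma sums_bounded_reindex:
  assumes "sums_bounded u U" "inj p" "finite X"
  shows "(\<Sum>j\<in>X. u (p j)) \<le> U"
  using sums_boundedD(2)[OF assms(1), of "p ` X"] assms(3) inj_on_subset[OF assms(2), of X]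
  by (simp add: sum.reindex)

text \<open>A change of variables from (i, j) to (\<open>p i\<close>, \<open>q i j\<close>): the
  inner sum has the same bound for every fixed \<open>i\<close>, so the double sum factors.\<close>

lemma double_sum_le:
  assumes \<phi>: "sums_bounded \<phi> P" and u: "sums_bounded u U" and p: "inj p" and q: "\<And>i. inj (q i)" and X: "finite X"
  shows "(\<Sum>i\<in>X. \<Sum>j\<in>X. \<phi> (p i) * u (q i j)) \<le> P * U"
proof -
  have "(\<Sum>i\<in>X. \<Sum>j\<in>X. \<phi> (p i) * u (q i j)) = (\<Sum>i\<in>X. \<phi> (p i) * (\<Sum>j\<in>X. u (q i j)))"
    by (simp add: sum_distrib_left)
  also have "\<dots> \<le> (\<Sum>i\<in>X. \<phi> (p i) * U)"
    by (intro sum_mono mult_left_mono sums_bounded_reindex[OF u q X] sums_boundedD(1)[OF \<phi>])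
  also have "\<dots> \<le> P * U"
    unfolding sum_distrib_right[symmetric]
    by (intro mult_right_mono sums_bounded_reindex[OF \<phi> p X] sums_boundedD(3)[OF u])
  finally show ?thesis .
qed

definition cubic_weight :: "int \<Rightarrow> real" where
  "cubic_weight a = (1 / sqrt \<bar>real_of_int a\<bar>) ^ 3"

text \<open>Twice zeta(3/2). The term at 0 vanishes because \<open>0 powr x = 0\<close>, in
  accordance with \<open>cubic_weight 0 = 0\<close>, which rests on division by zero.\<close>

definition cubic_total :: real where
  "cubic_total = 2 * (\<Sum>n. real n powr (- 3 / 2))"

lemma cubic_weight_nat: "cubic_weight (int n) = real n powr (- 3 / 2)" "cubic_weight (- int n) = real n powr (- 3 / 2)"
proof -
  have "(1 / sqrt x) ^ 3 = x powr (- 3 / 2)" if "x \<ge> 0" for x :: real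
  proof (cases "x = 0")
    case False
    then have "1 / sqrt x = x powr (- 1 / 2)" using that
      by (simp add: powr_half_sqrt [symmetric] powr_minus_divide)
    then show ?thesis using False by (simp add: powr_power)
  qed simp
  then show "cubic_weight (int n) = real n powr (- 3 / 2)" "cubic_weight (- int n) = real n powr (- 3 / 2)"
    by (simp_all add: cubic_weight_def)
qed

lemma cubic_weight_bounded: "sums_bounded cubic_weight cubic_total"
  unfolding sums_bounded_def
proof (intro conjI allI impI)
  show nn: "cubic_weight a \<ge> 0" for a by (simp add: cubic_weight_def)
  fix X :: "int set" assume X: "finite X"
  obtain N where N: "\<And>a. a \<in> X \<Longrightarrow> nat \<bar>a\<bar> \<le> N"
    using finite_nat_set_iff_bounded_le[THEN iffD1, of "(\<lambda>a. nat \<bar>a\<bar>) ` X"] X by auto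
  have s: "summable (\<lambda>n. real n powr (- 3 / 2))" by (simp add: summable_real_powr_iff)
  have "X \<subseteq> int ` {..N} \<union> (\<lambda>n. - int n) ` {..N}"
  proof
    fix a assume "a \<in> X"
    from N[OF this] show "a \<in> int ` {..N} \<union> (\<lambda>n. - int n) ` {..N}"
      by (cases a rule: int_cases2) auto
  qed
  then have "sum cubic_weight X \<le> sum cubic_weight (int ` {..N} \<union> (\<lambda>n. - int n) ` {..N})"
    by (intro sum_mono2 nn) auto
  also have "\<dots> \<le> sum cubic_weight (int ` {..N}) + sum cubic_weight ((\<lambda>n. - int n) ` {..N})"
    using nn by (subst sum.union_inter[symmetric]) (auto intro!: sum_nonneg)
  also have "\<dots> = 2 * (\<Sum>n\<le>N. real n powr (- 3 / 2))"
    by (simp add: sum.reindex inj_on_def cubic_weight_nat)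
  also have "\<dots> \<le> cubic_total"
    unfolding cubic_total_def by (intro mult_left_mono sum_le_suminf s) auto
  finally show "sum cubic_weight X \<le> cubic_total" .
qed

text \<open>Half a power of decay is traded. With x, y the square roots of |a|, |b| one has sqrt(1 +
  |a + b|) <= 2 (x + y), and for u = 1/x, v = 1/y the mixed terms obey u v^2 + u^2 v <= u^3 + v^3.
  What remains is summable in each variable separately, times a factor decaying in a + b; in the
  applications a + b is 2n, or 2n minus a frequency.\<close>

lemma inverse_mult_le:
  fixes a b :: int
  assumes "a \<noteq> 0" "b \<noteq> 0"
  shows "1 / (\<bar>real_of_int a\<bar> * \<bar>real_of_int b\<bar>) \<le> 2 * (cubic_weight a + cubic_weight b) / sqrt (1 + \<bar>real_of_int (a + b)\<bar>)"
proof -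
  define x where "x = sqrt \<bar>real_of_int a\<bar>"
  define y where "y = sqrt \<bar>real_of_int b\<bar>"
  have xy: "x \<ge> 1" "y \<ge> 1" using assms by (auto simp: x_def y_def)
  have x2: "\<bar>real_of_int a\<bar> = x\<^sup>2" "\<bar>real_of_int b\<bar> = y\<^sup>2" by (auto simp: x_def y_def)
  define u where "u = 1 / x"
  define v where "v = 1 / y"
  have uv: "u > 0" "v > 0" using xy by (auto simp: u_def v_def)
  define S where "S = sqrt (1 + \<bar>real_of_int (a + b)\<bar>)"
  have S: "S > 0" by (simp add: S_def)
  have "S \<le> 2 * (x + y)"
    unfolding S_def
  proof (rule real_le_lsqrt)
    have "1 + \<bar>real_of_int (a + b)\<bar> \<le> 1 + x\<^sup>2 + y\<^sup>2" unfolding x2[symmetric] by simp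
    also have "1 \<le> x\<^sup>2" using xy(1) by simp
    also have "x\<^sup>2 + x\<^sup>2 + y\<^sup>2 \<le> (2 * (x + y))\<^sup>2" using xy by (simp add: power2_eq_square algebra_simps)
    finally show "1 + \<bar>real_of_int (a + b)\<bar> \<le> (2 * (x + y))\<^sup>2" by simp
  qed (use xy in auto)
  then have "1 / (x\<^sup>2 * y\<^sup>2) * S \<le> 1 / (x\<^sup>2 * y\<^sup>2) * (2 * (x + y))"
    by (intro mult_left_mono) auto
  also have "\<dots> = 2 * (u * v\<^sup>2 + u\<^sup>2 * v)"
    using xy by (simp add: u_def v_def field_simps power2_eq_square)
  also have "\<dots> \<le> 2 * (u ^ 3 + v ^ 3)"
  proof -
    have "0 \<le> (u - v)\<^sup>2 * (u + v)" using uv by simp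
    then show ?thesis by (simp add: power2_eq_square power3_eq_cube algebra_simps)
  qed
  finally have "1 / (x\<^sup>2 * y\<^sup>2) \<le> 2 * (u ^ 3 + v ^ 3) / S" using S by (simp only: pos_le_divide_eq)
  moreover have "cubic_weight a = u ^ 3" "cubic_weight b = v ^ 3"
    by (simp_all only: cubic_weight_def u_def v_def x_def y_def)
  ultimately show ?thesis by (simp only: x2 S_def)
qed

section \<open>Damped sums that tend to 0 with growing index\<close>

definition tail_weight :: "(int \<Rightarrow> real) \<Rightarrow> int \<Rightarrow> int \<Rightarrow> real" where
  "tail_weight w n r = w r / sqrt (1 + \<bar>real_of_int (2 * n - r)\<bar>)"

text \<open>Total of the squared coefficients, where only frequencies near 2n escape damping. Both
  the Dirac and the Hill bounds owe their smallness to this quantity.\<close>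

definition tail_sum :: "(int \<Rightarrow> real) \<Rightarrow> int \<Rightarrow> real" where
  "tail_sum w n = (\<Sum>\<^sub>\<infinity>r. tail_weight w n r)"

lemma sums_bounded_summable: "sums_bounded u U \<Longrightarrow> u summable_on A"
  by (rule nonneg_bdd_above_summable_on) (auto simp: sums_bounded_def intro!: bdd_aboveI2)

lemma tail_weight_le:
  assumes "sums_bounded w W"
  shows "0 \<le> tail_weight w n r" "tail_weight w n r \<le> w r"
  using sums_boundedD(1)[OF assms, of r] by (auto simp: tail_weight_def divide_le_eq mult_le_cancel_left1)

lemma tail_weight_summable:
  assumes "sums_bounded w W"
  shows "tail_weight w n summable_on A"
  using tail_weight_le[OF assms] by (intro summable_on_comparison_test[OF sums_bounded_summable[OF assms]]) auto

lemma tail_weight_bounded: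
  assumes "sums_bounded w W"
  shows "sums_bounded (tail_weight w n) (tail_sum w n)"
  unfolding sums_bounded_def tail_sum_def
  using tail_weight_le[OF assms] tail_weight_summable[OF assms] by (auto intro!: finite_sum_le_infsum)

lemma filterlim_abs_cofinite: "filterlim (\<lambda>n::int. \<bar>real_of_int n\<bar>) at_top cofinite"
  unfolding filterlim_at_top eventually_cofinite
proof
  fix Z :: real
  have "{n::int. \<not> Z \<le> \<bar>real_of_int n\<bar>} \<subseteq> {- \<lceil>\<bar>Z\<bar>\<rceil>..\<lceil>\<bar>Z\<bar>\<rceil>}"
    by (auto; linarith)
  then show "finite {n::int. \<not> Z \<le> \<bar>real_of_int n\<bar>}" by (rule finite_subset) simp
qed

lemma eventually_abs_ge: "eventually (\<lambda>n::int. \<bar>real_of_int n\<bar> \<ge> c) cofinite"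
  using filterlim_abs_cofinite unfolding filterlim_at_top by blast

lemma inverse_sqrt_tendsto_0: "((\<lambda>n::int. 1 / sqrt \<bar>real_of_int n\<bar>) \<longlongrightarrow> 0) cofinite"
  by (intro tendsto_divide_0[OF tendsto_const] filterlim_at_top_imp_at_infinity
      filterlim_compose[OF sqrt_at_top filterlim_abs_cofinite])

lemma inverse_abs_tendsto_0: "((\<lambda>n::int. 1 / \<bar>real_of_int n\<bar>) \<longlongrightarrow> 0) cofinite"
  by (intro tendsto_divide_0[OF tendsto_const] filterlim_at_top_imp_at_infinity filterlim_abs_cofinite)

lemma tail_weight_tendsto_0: "((\<lambda>n. tail_weight w n r) \<longlongrightarrow> 0) cofinite"
proof (rule Lim_null_comparison)
  show "((\<lambda>n::int. \<bar>w r\<bar> * (1 / sqrt \<bar>real_of_int n\<bar>)) \<longlongrightarrow> 0) cofinite"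
    by (rule tendsto_mult_right_zero[OF inverse_sqrt_tendsto_0])
  show "\<forall>\<^sub>F n in cofinite. norm (tail_weight w n r) \<le> \<bar>w r\<bar> * (1 / sqrt \<bar>real_of_int n\<bar>)"
    using eventually_abs_ge[of "1 + \<bar>real_of_int r\<bar>"]
  proof eventually_elim
    case (elim n)
    have "sqrt \<bar>real_of_int n\<bar> \<le> sqrt (1 + \<bar>real_of_int (2 * n - r)\<bar>)" using elim by simp
    then have "\<bar>w r\<bar> / sqrt (1 + \<bar>real_of_int (2 * n - r)\<bar>) \<le> \<bar>w r\<bar> / sqrt \<bar>real_of_int n\<bar>"
      using elim by (intro divide_left_mono mult_pos_pos) auto
    then show ?case by (simp add: tail_weight_def)
  qed
qed

text \<open>Dominated convergence by hand: a finite set carries all but e/2 of the mass of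
  \<open>w\<close>, and on it each of the finitely many damping factors tends to 0.\<close>

lemma tail_sum_tendsto_0:
  assumes w: "sums_bounded w W"
  shows "(tail_sum w \<longlongrightarrow> 0) cofinite"
proof (rule tendstoI)
  fix e :: real assume e: "e > 0"
  note ws = sums_bounded_summable[OF w]
  have "(w has_sum infsum w UNIV) UNIV" using ws by simp
  then have "eventually (\<lambda>F. dist (sum w F) (infsum w UNIV) < e / 2) (finite_subsets_at_top UNIV)"
    unfolding has_sum_def using e by (intro tendstoD) auto
  then obtain F where F: "finite F" "dist (sum w F) (infsum w UNIV) < e / 2"
    unfolding eventually_finite_subsets_at_top by auto
  have tl: "infsum w (UNIV - F) < e / 2"
  proof -
    have "infsum w (UNIV - F) = infsum w UNIV - infsum w F" by (rule infsum_Diff[OF ws ws subset_UNIV])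
    then show ?thesis using F(2) infsum_finite[OF F(1), of w] unfolding dist_real_def by linarith
  qed
  have le: "tail_sum w n \<le> (\<Sum>r\<in>F. tail_weight w n r) + infsum w (UNIV - F)" for n
  proof -
    note ts = tail_weight_summable[OF w, of n]
    have "tail_sum w n = (\<Sum>r\<in>F. tail_weight w n r) + infsum (tail_weight w n) (UNIV - F)"
      unfolding tail_sum_def using infsum_Diff[OF ts ts subset_UNIV, of F] infsum_finite[OF F(1), of "tail_weight w n"] by linarith
    moreover have "infsum (tail_weight w n) (UNIV - F) \<le> infsum w (UNIV - F)"
      by (rule infsum_mono[OF ts ws tail_weight_le(2)[OF w]])
    ultimately show ?thesis by simp
  qed
  have "((\<lambda>n. \<Sum>r\<in>F. tail_weight w n r) \<longlongrightarrow> (\<Sum>r\<in>F. 0)) cofinite"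
    by (intro tendsto_sum tail_weight_tendsto_0)
  then have "eventually (\<lambda>n. (\<Sum>r\<in>F. tail_weight w n r) < e / 2) cofinite"
    using e by (intro order_tendstoD(2)) auto
  then show "eventually (\<lambda>n. dist (tail_sum w n) 0 < e) cofinite"
  proof eventually_elim
    case (elim n)
    have "tail_sum w n \<ge> 0" using sums_boundedD(3)[OF tail_weight_bounded[OF w]] .
    then show ?case using elim le[of n] tl by (simp add: dist_real_def)
  qed
qed

lemma inverse_le_inverse_sqrt:
  assumes "x \<ge> 1"
  shows "1 / x \<le> 2 / sqrt (1 + x)"
proof -
  have "sqrt (1 + x) \<le> sqrt ((1 + x)\<^sup>2)"
    using assms by (intro real_sqrt_le_mono) (simp add: power2_eq_square)
  also have "\<dots> \<le> 2 * x" using assms by simp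
  finally show ?thesis using assms by (simp add: field_simps)
qed

lemma abs_int_ge_1: "(a :: int) \<noteq> 0 \<Longrightarrow> \<bar>real_of_int a\<bar> \<ge> 1"
  by (metis Ints_of_int Ints_nonzero_abs_ge1 of_int_eq_0_iff)

section \<open>Weighted norms of the Dirac and the Hill matrices\<close>

abbreviation "dirac_dist n j \<equiv> \<bar>real_of_int (n - j)\<bar>"
abbreviation "hill_dist n j \<equiv> \<bar>(real_of_int n)\<^sup>2 - (real_of_int j)\<^sup>2\<bar>"

text \<open>The growth of the squared Hill coefficients relative to those of \<open>q\<close>; the
  value 1 at 0 makes room for the constant \<open>C\<close>.\<close>

definition square_or_one :: "int \<Rightarrow> real" where "square_or_one r = (if r = 0 then 1 else (real_of_int r)\<^sup>2)"

lemma hill_dist_eq: "hill_dist n j = dirac_dist n j * \<bar>real_of_int (n + j)\<bar>"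
  by (simp add: abs_mult[symmetric] power2_eq_square algebra_simps)

text \<open>The distance is a product a b of nonzero integers with a + b >= 2|n|, and (a - 1)(b - 1)
  >= 0 gives 2|n| <= a b + 1 <= 2 a b. This is the \<delta> that compensates the growth of the Hill
  coupling vectors.\<close>

lemma hill_dist_ge_abs:
  assumes "j \<noteq> n" "j \<noteq> - n"
  shows "hill_dist n j \<ge> \<bar>real_of_int n\<bar>"
proof -
  define a where "a = \<bar>real_of_int (n - j)\<bar>"
  define b where "b = \<bar>real_of_int (n + j)\<bar>"
  have ge: "a \<ge> 1" "b \<ge> 1" unfolding a_def b_def using assms by (auto intro!: abs_int_ge_1 simp: add_eq_0_iff)
  have "2 * \<bar>real_of_int n\<bar> \<le> a + b" unfolding a_def b_def by simp
  moreover have "0 \<le> (a - 1) * (b - 1)" using ge by simp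
  ultimately have "\<bar>real_of_int n\<bar> \<le> a * b"
    using ge mult_mono[of 1 a 1 b] by (simp add: algebra_simps)
  then show ?thesis unfolding hill_dist_eq a_def b_def .
qed

context
  fixes w :: "int \<Rightarrow> real" and W :: real and n :: int
  assumes w: "sums_bounded w W" and w_sym: "\<And>r. w (- r) = w r"
begin

lemma tail_sum_nonneg: "tail_sum w n \<ge> 0"
  using sums_boundedD(3)[OF tail_weight_bounded[OF w]] .

text \<open>Use \<open>inverse_mult_le\<close> with a = n - i and b = n - j: then a + b = 2n - (i +
  j), so the damping is that of \<open>tail_weight\<close> at frequency i + j. The 4 is the factor 2
  of that inequality times two summands.\<close>

lemma dirac_whs_le:
  assumes J: "n \<notin> J" and F: "\<And>i j. (cmod (F i j))\<^sup>2 \<le> w (i + j)"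
  shows "whs_le J (dirac_dist n) F (sqrt (4 * cubic_total * tail_sum w n))"
  unfolding whs_le_def
proof (intro conjI allI impI)
  have C: "cubic_total \<ge> 0" by (rule sums_boundedD(3)[OF cubic_weight_bounded])
  show "0 \<le> sqrt (4 * cubic_total * tail_sum w n)" using C tail_sum_nonneg by simp
  fix X assume X: "finite X" "X \<subseteq> J"
  let ?T = "\<lambda>i j. 2 * (cubic_weight (n - i) * tail_weight w n (i + j)) + 2 * (cubic_weight (n - j) * tail_weight w n (i + j))"
  have "(\<Sum>i\<in>X. \<Sum>j\<in>X. (cmod (F i j))\<^sup>2 / (dirac_dist n i * dirac_dist n j))
    \<le> (\<Sum>i\<in>X. \<Sum>j\<in>X. ?T i j)"
  proof (intro sum_mono)
    fix i j assume ij: "i \<in> X" "j \<in> X"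
    have ne: "n - i \<noteq> 0" "n - j \<noteq> 0" using ij X J by auto
    have "(cmod (F i j))\<^sup>2 / (dirac_dist n i * dirac_dist n j)
      \<le> w (i + j) * (1 / (dirac_dist n i * dirac_dist n j))"
      using F[of i j] by (simp add: divide_right_mono)
    also have "\<dots> \<le> w (i + j) * (2 * (cubic_weight (n - i) + cubic_weight (n - j)) / sqrt (1 + \<bar>real_of_int ((n - i) + (n - j))\<bar>))"
      by (intro mult_left_mono inverse_mult_le ne sums_boundedD(1)[OF w])
    also have "\<dots> = ?T i j"
      by (simp add: tail_weight_def ring_distribs add_divide_distrib algebra_simps)
    finally show "(cmod (F i j))\<^sup>2 / (dirac_dist n i * dirac_dist n j)
      \<le> ?T i j" .
  qed
  also have "\<dots> = 2 * (\<Sum>i\<in>X. \<Sum>j\<in>X. cubic_weight (n - i) * tail_weight w n (i + j)) + 2 * (\<Sum>j\<in>X. \<Sum>i\<in>X. cubic_weight (n - j) * tail_weight w n (i + j))"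
    by (subst (3) sum.swap) (simp add: sum.distrib sum_distrib_left)
  also have "\<dots> \<le> 2 * (cubic_total * tail_sum w n) + 2 * (cubic_total * tail_sum w n)"
    by (intro add_mono mult_left_mono double_sum_le[OF cubic_weight_bounded tail_weight_bounded[OF w]] X)
       (auto simp: inj_on_def)
  also have "\<dots> = (sqrt (4 * cubic_total * tail_sum w n))\<^sup>2" using C tail_sum_nonneg by simp
  finally show "(\<Sum>i\<in>X. \<Sum>j\<in>X. (cmod (F i j))\<^sup>2 / (dirac_dist n i * dirac_dist n j)) \<le> (sqrt (4 * cubic_total * tail_sum w n))\<^sup>2" .
qed

lemma dirac_wl2_le:
  assumes J: "n \<notin> J" and f: "\<And>j. (cmod (f j))\<^sup>2 \<le> w (n + j)"
  shows "wl2_le J (dirac_dist n) f (sqrt (2 * tail_sum w n))"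
  unfolding wl2_le_def
proof (intro conjI allI impI)
  show "0 \<le> sqrt (2 * tail_sum w n)" using tail_sum_nonneg by simp
  fix X assume X: "finite X" "X \<subseteq> J"
  have "(\<Sum>j\<in>X. (cmod (f j))\<^sup>2 / dirac_dist n j) \<le> (\<Sum>j\<in>X. 2 * tail_weight w n (n + j))"
  proof (intro sum_mono)
    fix j assume j: "j \<in> X"
    then have ne: "n - j \<noteq> 0" using X J by auto
    have "(cmod (f j))\<^sup>2 / dirac_dist n j \<le> w (n + j) * (1 / dirac_dist n j)"
      using f[of j] by (simp add: divide_right_mono)
    also have "\<dots> \<le> w (n + j) * (2 / sqrt (1 + dirac_dist n j))"
      by (intro mult_left_mono inverse_le_inverse_sqrt abs_int_ge_1 ne sums_boundedD(1)[OF w])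
    also have "\<dots> = 2 * tail_weight w n (n + j)" by (simp add: tail_weight_def algebra_simps)
    finally show "(cmod (f j))\<^sup>2 / dirac_dist n j \<le> 2 * tail_weight w n (n + j)" .
  qed
  also have "\<dots> \<le> 2 * tail_sum w n"
    unfolding sum_distrib_left[symmetric]
    by (intro mult_left_mono sums_bounded_reindex[OF tail_weight_bounded[OF w]] X) (auto simp: inj_on_def)
  finally show "(\<Sum>j\<in>X. (cmod (f j))\<^sup>2 / dirac_dist n j) \<le> (sqrt (2 * tail_sum w n))\<^sup>2" using tail_sum_nonneg by simp
qed

text \<open>With \<open>a = n - i\<close>, \<open>b = n + i\<close>, \<open>c = n - j\<close>, \<open>d = n + j\<close> one has \<open>i - j = c - a = b - d\<close>, so the growth
  \<open>(i - j)\<^sup>2 \<le> (|a| + |c|) (|b| + |d|)\<close> of the coefficients is absorbed by the weight \<open>|a b c d|\<close>: the quotient is at most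
  \<open>1/|a b| + 1/|a d| + 1/|c b| + 1/|c d|\<close>.\<close>

lemma hill_whs_le:
  assumes J: "n \<notin> J" "- n \<notin> J" and F: "\<And>i j. (cmod (F i j))\<^sup>2 \<le> square_or_one (i - j) * w (i - j)"
  shows "whs_le J (hill_dist n) F (sqrt (8 * cubic_total * (W / sqrt (1 + 2 * \<bar>real_of_int n\<bar>) + tail_sum w n)))"
  unfolding whs_le_def
proof (intro conjI allI impI)
  have C: "cubic_total \<ge> 0" by (rule sums_boundedD(3)[OF cubic_weight_bounded])
  have W: "W \<ge> 0" by (rule sums_boundedD(3)[OF w])
  define S where "S = sqrt (1 + 2 * \<bar>real_of_int n\<bar>)"
  have S: "S > 0" unfolding S_def by simp
  show "0 \<le> sqrt (8 * cubic_total * (W / sqrt (1 + 2 * \<bar>real_of_int n\<bar>) + tail_sum w n))" using C W tail_sum_nonneg by simp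
  fix X assume X: "finite X" "X \<subseteq> J"
  let ?c = cubic_weight and ?tw = "tail_weight w n"
  \<comment> \<open>Two terms from each of the four inverse products. The pairs (a, b) and (c, d)
    have sum 2n, hence the denominator \<open>S\<close>; (a, d) and (c, b) have sums 2n - (i - j)
    and 2n - (j - i), hence the tails, the second one by symmetry of \<open>w\<close>.\<close>
  let ?T = "\<lambda>i j. 2 * (?c (n - i) * (w (i - j) / S)) + 2 * (?c (n + i) * (w (i - j) / S))
      + (2 * (?c (n - i) * ?tw (i - j)) + 2 * (?c (n + j) * ?tw (i - j)))
      + (2 * (?c (n - j) * ?tw (j - i)) + 2 * (?c (n + i) * ?tw (j - i)))
      + (2 * (?c (n - j) * (w (i - j) / S)) + 2 * (?c (n + j) * (w (i - j) / S)))"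
  have "(\<Sum>i\<in>X. \<Sum>j\<in>X. (cmod (F i j))\<^sup>2 / (hill_dist n i * hill_dist n j))
    \<le> (\<Sum>i\<in>X. \<Sum>j\<in>X. ?T i j)"
  proof (intro sum_mono)
    fix i j assume ij: "i \<in> X" "j \<in> X"
    have ne: "n - i \<noteq> 0" "n - j \<noteq> 0" "n + i \<noteq> 0" "n + j \<noteq> 0"
      using ij X J by (auto simp: add_eq_0_iff)
    define a where "a = \<bar>real_of_int (n - i)\<bar>"
    define b where "b = \<bar>real_of_int (n + i)\<bar>"
    define c where "c = \<bar>real_of_int (n - j)\<bar>"
    define d where "d = \<bar>real_of_int (n + j)\<bar>"
    have ge: "a \<ge> 1" "b \<ge> 1" "c \<ge> 1" "d \<ge> 1" unfolding a_def b_def c_def d_def using ne by (auto intro!: abs_int_ge_1)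
    have sq: "square_or_one (i - j) \<le> (a + c) * (b + d)"
    proof (cases "i = j")
      case True
      have "1 * 1 \<le> (a + c) * (b + d)" using ge by (intro mult_mono) auto
      then show ?thesis using True by (simp add: square_or_one_def)
    next
      case False
      have "\<bar>real_of_int (i - j)\<bar> * \<bar>real_of_int (i - j)\<bar> \<le> (a + c) * (b + d)"
        by (intro mult_mono) (auto simp: a_def b_def c_def d_def)
      then show ?thesis using False by (simp add: square_or_one_def power2_eq_square abs_mult[symmetric])
    qed
    have "(cmod (F i j))\<^sup>2 / (hill_dist n i * hill_dist n j) \<le> w (i - j) * (square_or_one (i - j) / (a * b * (c * d)))"
      unfolding hill_dist_eq a_def[symmetric] b_def[symmetric] c_def[symmetric] d_def[symmetric]
      using F[of i j] ge by (simp add: divide_right_mono mult.commute)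
    also have "\<dots> \<le> w (i - j) * ((a + c) * (b + d) / (a * b * (c * d)))"
      using ge by (intro mult_left_mono divide_right_mono sq sums_boundedD(1)[OF w]) auto
    also have "(a + c) * (b + d) / (a * b * (c * d)) = 1 / (a * b) + 1 / (a * d) + 1 / (c * b) + 1 / (c * d)"
      using ge by (simp add: field_simps)
    also have "w (i - j) * (1 / (a * b) + 1 / (a * d) + 1 / (c * b) + 1 / (c * d)) \<le>
      w (i - j) * (2 * (?c (n - i) + ?c (n + i)) / sqrt (1 + \<bar>real_of_int ((n - i) + (n + i))\<bar>)
       + 2 * (?c (n - i) + ?c (n + j)) / sqrt (1 + \<bar>real_of_int ((n - i) + (n + j))\<bar>)
       + 2 * (?c (n - j) + ?c (n + i)) / sqrt (1 + \<bar>real_of_int ((n - j) + (n + i))\<bar>)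
       + 2 * (?c (n - j) + ?c (n + j)) / sqrt (1 + \<bar>real_of_int ((n - j) + (n + j))\<bar>))"
      unfolding a_def b_def c_def d_def
      by (intro mult_left_mono add_mono inverse_mult_le ne sums_boundedD(1)[OF w])
    also have "\<dots> = ?T i j"
    proof -
      have e: "sqrt (1 + \<bar>real_of_int ((n - i) + (n + i))\<bar>) = S" "sqrt (1 + \<bar>real_of_int ((n - j) + (n + j))\<bar>) = S"
        by (simp_all add: S_def abs_mult)
      have t: "w (i - j) * (2 * (x + y) / s) = 2 * (x * (w (i - j) / s)) + 2 * (y * (w (i - j) / s))" for x y s
        by (simp add: algebra_simps add_divide_distrib)
      have u: "w (i - j) / sqrt (1 + \<bar>real_of_int ((n - i) + (n + j))\<bar>) = ?tw (i - j)"
        by (simp add: tail_weight_def algebra_simps)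
      have "w (i - j) = w (j - i)" using w_sym[of "i - j"] by simp
      then have v: "w (i - j) / sqrt (1 + \<bar>real_of_int ((n - j) + (n + i))\<bar>) = ?tw (j - i)"
        by (simp add: tail_weight_def algebra_simps)
      show ?thesis unfolding e distrib_left[of "w (i - j)"] t u v ..
    qed
    finally show "(cmod (F i j))\<^sup>2 / (hill_dist n i * hill_dist n j) \<le> ?T i j" .
  qed
  also have "\<dots> = 2 * (\<Sum>i\<in>X. \<Sum>j\<in>X. ?c (n - i) * (w (i - j) / S)) + 2 * (\<Sum>i\<in>X. \<Sum>j\<in>X. ?c (n + i) * (w (i - j) / S))
      + (2 * (\<Sum>i\<in>X. \<Sum>j\<in>X. ?c (n - i) * ?tw (i - j)) + 2 * (\<Sum>i\<in>X. \<Sum>j\<in>X. ?c (n + j) * ?tw (i - j)))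
      + (2 * (\<Sum>i\<in>X. \<Sum>j\<in>X. ?c (n - j) * ?tw (j - i)) + 2 * (\<Sum>i\<in>X. \<Sum>j\<in>X. ?c (n + i) * ?tw (j - i)))
      + (2 * (\<Sum>i\<in>X. \<Sum>j\<in>X. ?c (n - j) * (w (i - j) / S)) + 2 * (\<Sum>i\<in>X. \<Sum>j\<in>X. ?c (n + j) * (w (i - j) / S)))"
    by (simp only: sum.distrib sum_distrib_left)
  also have "\<dots> \<le> 2 * (cubic_total * (W / S)) + 2 * (cubic_total * (W / S))
      + (2 * (cubic_total * tail_sum w n) + 2 * (cubic_total * tail_sum w n))
      + (2 * (cubic_total * tail_sum w n) + 2 * (cubic_total * tail_sum w n))
      + (2 * (cubic_total * (W / S)) + 2 * (cubic_total * (W / S)))"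
  proof -
    have ws: "sums_bounded (\<lambda>r. w r / S) (W / S)"
      using w S unfolding sums_bounded_def by (auto simp: sum_divide_distrib[symmetric] divide_right_mono)
    have swap: "(\<Sum>i\<in>X. \<Sum>j\<in>X. \<phi> i j) = (\<Sum>j\<in>X. \<Sum>i\<in>X. \<phi> i j)" for \<phi> :: "int \<Rightarrow> int \<Rightarrow> real"
      by (rule sum.swap)
    note D1 = double_sum_le[OF cubic_weight_bounded ws _ _ X(1)]
    note D2 = double_sum_le[OF cubic_weight_bounded tail_weight_bounded[OF w] _ _ X(1)]
    show ?thesis
    proof (intro add_mono mult_left_mono)
      show "(\<Sum>i\<in>X. \<Sum>j\<in>X. ?c (n - i) * (w (i - j) / S)) \<le> cubic_total * (W / S)"
        "(\<Sum>i\<in>X. \<Sum>j\<in>X. ?c (n + i) * (w (i - j) / S)) \<le> cubic_total * (W / S)"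
        by (rule D1; simp add: inj_on_def)+
      show "(\<Sum>i\<in>X. \<Sum>j\<in>X. ?c (n - i) * ?tw (i - j)) \<le> cubic_total * tail_sum w n"
        "(\<Sum>i\<in>X. \<Sum>j\<in>X. ?c (n + i) * ?tw (j - i)) \<le> cubic_total * tail_sum w n"
        by (rule D2; simp add: inj_on_def)+
      show "(\<Sum>i\<in>X. \<Sum>j\<in>X. ?c (n + j) * ?tw (i - j)) \<le> cubic_total * tail_sum w n"
        "(\<Sum>i\<in>X. \<Sum>j\<in>X. ?c (n - j) * ?tw (j - i)) \<le> cubic_total * tail_sum w n"
        by (subst swap, rule D2; simp add: inj_on_def)+
      show "(\<Sum>i\<in>X. \<Sum>j\<in>X. ?c (n - j) * (w (i - j) / S)) \<le> cubic_total * (W / S)"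
        "(\<Sum>i\<in>X. \<Sum>j\<in>X. ?c (n + j) * (w (i - j) / S)) \<le> cubic_total * (W / S)"
        by (subst swap, rule D1; simp add: inj_on_def)+
    qed simp_all
  qed
  also have "\<dots> = (sqrt (8 * cubic_total * (W / S + tail_sum w n)))\<^sup>2"
    using C W S tail_sum_nonneg by (simp add: algebra_simps)
  finally show "(\<Sum>i\<in>X. \<Sum>j\<in>X. (cmod (F i j))\<^sup>2 / (hill_dist n i * hill_dist n j)) \<le> (sqrt (8 * cubic_total * (W / sqrt (1 + 2 * \<bar>real_of_int n\<bar>) + tail_sum w n)))\<^sup>2"
    unfolding S_def .
qed

text \<open>As a + b = 2n, the quotient a^2 / |a b| = |a| / |b| is at most 1 + 2|n| / |b|. The
  squared norms obtained this way are o(|n|), and the Lipschitz constants divide them by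
  |n|.\<close>

lemma hill_wl2_le_aux:
  assumes a: "a \<noteq> 0" "b \<noteq> (0::int)" and ab: "a + b = 2 * n" and x: "x \<le> square_or_one a * w a"
  shows "x / (\<bar>real_of_int a\<bar> * \<bar>real_of_int b\<bar>) \<le> w a + 4 * \<bar>real_of_int n\<bar> * tail_weight w n a"
proof -
  define \<alpha> where "\<alpha> = \<bar>real_of_int a\<bar>"
  define \<beta> where "\<beta> = \<bar>real_of_int b\<bar>"
  have ge: "\<alpha> \<ge> 1" "\<beta> \<ge> 1" unfolding \<alpha>_def \<beta>_def using a by (auto intro!: abs_int_ge_1)
  have "real_of_int a + real_of_int b = 2 * real_of_int n" using ab by (metis of_int_add of_int_mult of_int_numeral)
  then have le: "\<alpha> \<le> \<beta> + 2 * \<bar>real_of_int n\<bar>" unfolding \<alpha>_def \<beta>_def by linarith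
  have "square_or_one a = \<alpha> * \<alpha>" using a by (simp add: square_or_one_def \<alpha>_def power2_eq_square abs_mult[symmetric])
  then have "x / (\<alpha> * \<beta>) \<le> \<alpha> * \<alpha> * w a / (\<alpha> * \<beta>)"
    using x ge by (intro divide_right_mono) auto
  also have "\<dots> = w a * (\<alpha> / \<beta>)" using ge by simp
  also have "\<dots> \<le> w a * (1 + 2 * \<bar>real_of_int n\<bar> * (1 / \<beta>))"
    using le ge by (intro mult_left_mono sums_boundedD(1)[OF w]) (simp add: field_simps)
  also have "\<dots> \<le> w a * (1 + 2 * \<bar>real_of_int n\<bar> * (2 / sqrt (1 + \<beta>)))"
    by (intro mult_left_mono add_left_mono sums_boundedD(1)[OF w] inverse_le_inverse_sqrt ge) auto
  also have "\<dots> = w a + 4 * \<bar>real_of_int n\<bar> * tail_weight w n a"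
  proof -
    have "2 * n - a = b" using ab by simp
    then show ?thesis by (simp add: tail_weight_def \<beta>_def algebra_simps)
  qed
  finally show ?thesis unfolding \<alpha>_def \<beta>_def .
qed

text \<open>The alternatives cover the rows and columns at n and at -n; they differ by which of n -
  j and n + j is the frequency and which the remaining factor of the distance.\<close>

lemma hill_wl2_le:
  assumes J: "n \<notin> J" "- n \<notin> J" 
    and f: "(\<forall>j. (cmod (f j))\<^sup>2 \<le> square_or_one (n - j) * w (n - j)) \<or> (\<forall>j. (cmod (f j))\<^sup>2 \<le> square_or_one (n + j) * w (n + j))"
  shows "wl2_le J (hill_dist n) f (sqrt (W + 4 * \<bar>real_of_int n\<bar> * tail_sum w n))"
  unfolding wl2_le_def
proof (intro conjI allI impI)
  have W: "W \<ge> 0" by (rule sums_boundedD(3)[OF w])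
  show "0 \<le> sqrt (W + 4 * \<bar>real_of_int n\<bar> * tail_sum w n)" using tail_sum_nonneg W by simp
  fix X assume X: "finite X" "X \<subseteq> J"
  have ne: "n - j \<noteq> 0" "n + j \<noteq> 0" if "j \<in> X" for j using that X J by (auto simp: add_eq_0_iff)
  obtain p where p: "inj p" "\<And>j. j \<in> X \<Longrightarrow> (cmod (f j))\<^sup>2 / hill_dist n j \<le> w (p j) + 4 * \<bar>real_of_int n\<bar> * tail_weight w n (p j)"
    using f
  proof
    assume 1: "\<forall>j. (cmod (f j))\<^sup>2 \<le> square_or_one (n - j) * w (n - j)"
    show ?thesis
    proof (rule that)
      show "inj (\<lambda>j. n - j)" by (simp add: inj_on_def)
      show "(cmod (f j))\<^sup>2 / hill_dist n j \<le> w (n - j) + 4 * \<bar>real_of_int n\<bar> * tail_weight w n (n - j)" if "j \<in> X" for j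
        unfolding hill_dist_eq using 1 ne[OF that] by (intro hill_wl2_le_aux) auto
    qed
  next
    assume 1: "\<forall>j. (cmod (f j))\<^sup>2 \<le> square_or_one (n + j) * w (n + j)"
    show ?thesis
    proof (rule that)
      show "inj (\<lambda>j. n + j)" by (simp add: inj_on_def)
      show "(cmod (f j))\<^sup>2 / hill_dist n j \<le> w (n + j) + 4 * \<bar>real_of_int n\<bar> * tail_weight w n (n + j)" if "j \<in> X" for j
        unfolding hill_dist_eq mult.commute[of "\<bar>real_of_int (n - j)\<bar>"] using 1 ne[OF that] by (intro hill_wl2_le_aux) auto
    qed
  qed
  have "(\<Sum>j\<in>X. (cmod (f j))\<^sup>2 / hill_dist n j) \<le> (\<Sum>j\<in>X. w (p j)) + 4 * \<bar>real_of_int n\<bar> * (\<Sum>j\<in>X. tail_weight w n (p j))"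
    unfolding sum_distrib_left sum.distrib[symmetric] by (intro sum_mono p(2))
  also have "\<dots> \<le> W + 4 * \<bar>real_of_int n\<bar> * tail_sum w n"
    by (intro add_mono mult_left_mono sums_bounded_reindex[OF w p(1) X(1)]
        sums_bounded_reindex[OF tail_weight_bounded[OF w] p(1) X(1)]) auto
  finally show "(\<Sum>j\<in>X. (cmod (f j))\<^sup>2 / hill_dist n j) \<le> (sqrt (W + 4 * \<bar>real_of_int n\<bar> * tail_sum w n))\<^sup>2"
    using tail_sum_nonneg W by simp
qed

end

section \<open>Bounded sums and weighted vectors built from Fourier coefficients\<close>

lemma sums_bounded_add: "sums_bounded u U \<Longrightarrow> sums_bounded v V \<Longrightarrow> sums_bounded (\<lambda>x. u x + v x) (U + V)"
  by (auto simp: sums_bounded_def sum.distrib intro: add_mono)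

lemma sums_bounded_scale: "sums_bounded u U \<Longrightarrow> c \<ge> 0 \<Longrightarrow> sums_bounded (\<lambda>x. c * u x) (c * U)"
  by (auto simp: sums_bounded_def sum_distrib_left[symmetric] intro: mult_left_mono)

lemma sums_bounded_compose: "sums_bounded u U \<Longrightarrow> inj p \<Longrightarrow> sums_bounded (\<lambda>x. u (p x)) U"
  using sums_bounded_reindex[of u U p] by (auto simp: sums_bounded_def)

lemma sums_bounded_single: "c \<ge> 0 \<Longrightarrow> sums_bounded (\<lambda>x. if x = a then c else 0) c"
  by (auto simp: sums_bounded_def)

lemma sums_bounded_fourier:
  "L2_pi f \<Longrightarrow> sums_bounded (\<lambda>m. (cmod (fourier_coeff f m))\<^sup>2) (2 * L2_sq f / pi)"
  using bessel by (auto simp: sums_bounded_def)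

text \<open>Symmetrised so that the weight is even, as the estimates of the matrices assume, and
  dominates coefficients at both signs.\<close>

lemma sums_bounded_fourier_sym:
  assumes "L2_pi f"
  shows "sums_bounded (\<lambda>m. (cmod (fourier_coeff f m))\<^sup>2 + (cmod (fourier_coeff f (- m)))\<^sup>2) (2 * L2_sq f / pi + 2 * L2_sq f / pi)"
  by (intro sums_bounded_add sums_bounded_compose[OF sums_bounded_fourier[OF assms], of uminus] sums_bounded_fourier assms)
     (simp add: inj_on_def)

context weighted
begin

lemma wl2_leI:
  assumes u: "sums_bounded u U" and f: "\<And>j. j \<in> J \<Longrightarrow> (cmod (f j))\<^sup>2 \<le> D j * u j"
  shows "wl2_le J D f (sqrt U)"
  unfolding wl2_le_def
proof (intro conjI allI impI)
  have U: "U \<ge> 0" by (rule sums_boundedD(3)[OF u])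
  then show "0 \<le> sqrt U" by simp
  fix X assume X: "finite X" "X \<subseteq> J"
  have "(\<Sum>j\<in>X. (cmod (f j))\<^sup>2 / D j) \<le> sum u X"
    using X f D_pos by (intro sum_mono) (simp add: pos_divide_le_eq mult.commute subset_iff)
  also have "\<dots> \<le> U" by (rule sums_boundedD(2)[OF u X(1)])
  finally show "(\<Sum>j\<in>X. (cmod (f j))\<^sup>2 / D j) \<le> (sqrt U)\<^sup>2" using U by simp
qed

lemma wl2_le_scale: "wl2_le J D f t \<Longrightarrow> wl2_le J D (\<lambda>j. c * f j) (cmod c * t)"
  unfolding wl2_le_def
proof (intro conjI allI impI; elim conjE)
  fix X assume t: "0 \<le> t" and "\<forall>X. finite X \<longrightarrow> X \<subseteq> J \<longrightarrow> (\<Sum>j\<in>X. (cmod (f j))\<^sup>2 / D j) \<le> t\<^sup>2" "finite X" "X \<subseteq> J"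
  then have "(cmod c)\<^sup>2 * (\<Sum>j\<in>X. (cmod (f j))\<^sup>2 / D j) \<le> (cmod c)\<^sup>2 * t\<^sup>2" by (intro mult_left_mono) auto
  then show "(\<Sum>j\<in>X. (cmod (c * f j))\<^sup>2 / D j) \<le> (cmod c * t)\<^sup>2"
    by (simp add: norm_mult power_mult_distrib sum_distrib_left)
qed simp

lemma wl2_le_add:
  assumes f: "wl2_le J D f s" and g: "wl2_le J D g t"
  shows "wl2_le J D (\<lambda>j. f j + g j) (sqrt (2 * s\<^sup>2 + 2 * t\<^sup>2))"
  unfolding wl2_le_def
proof (intro conjI allI impI)
  show "0 \<le> sqrt (2 * s\<^sup>2 + 2 * t\<^sup>2)" by simp
  fix X assume X: "finite X" "X \<subseteq> J"
  have "(\<Sum>j\<in>X. (cmod (f j + g j))\<^sup>2 / D j) \<le> (\<Sum>j\<in>X. 2 * ((cmod (f j))\<^sup>2 / D j) + 2 * ((cmod (g j))\<^sup>2 / D j))"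
  proof (intro sum_mono)
    fix j assume j: "j \<in> X"
    have "(cmod (f j + g j))\<^sup>2 / D j \<le> (2 * (cmod (f j))\<^sup>2 + 2 * (cmod (g j))\<^sup>2) / D j"
      using D_pos[of j] X j cmod_add_square_le by (intro divide_right_mono) auto
    then show "(cmod (f j + g j))\<^sup>2 / D j \<le> 2 * ((cmod (f j))\<^sup>2 / D j) + 2 * ((cmod (g j))\<^sup>2 / D j)"
      by (simp add: add_divide_distrib)
  qed
  also have "\<dots> \<le> 2 * s\<^sup>2 + 2 * t\<^sup>2"
    unfolding sum.distrib sum_distrib_left[symmetric]
    by (intro add_mono mult_left_mono wl2_leD(1)[OF f] wl2_leD(1)[OF g] X) auto
  finally show "(\<Sum>j\<in>X. (cmod (f j + g j))\<^sup>2 / D j) \<le> (sqrt (2 * s\<^sup>2 + 2 * t\<^sup>2))\<^sup>2" by simp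
qed

lemma wl2_le_cong: "wl2_le J D f t \<Longrightarrow> (\<And>j. j \<in> J \<Longrightarrow> f j = g j) \<Longrightarrow> wl2_le J D g t"
proof -
  assume f: "wl2_le J D f t" and eq: "\<And>j. j \<in> J \<Longrightarrow> f j = g j"
  have "(\<Sum>j\<in>X. (cmod (g j))\<^sup>2 / D j) = (\<Sum>j\<in>X. (cmod (f j))\<^sup>2 / D j)" if "X \<subseteq> J" for X
    using that by (intro sum.cong refl) (simp add: eq subset_iff)
  with f show "wl2_le J D g t" unfolding wl2_le_def by simp
qed

end

text \<open>The coefficients of \<open>y\<close> and of \<open>y'\<close> are square summable and
  the distance grows at most like 1 + j^2, so even after multiplication by the denominator the
  weighted norm is finite. \<open>s\<close> is the identity or negation, the latter for the reversed
  first Dirac component.\<close>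

lemma (in perturbed) wl2_le_sobolev:
  assumes y: "L2_pi y" "L2_pi y'" and s: "inj s"
    and deriv: "\<And>j. j \<in> J \<Longrightarrow> cmod (fourier_coeff y' (s j)) = \<bar>real_of_int j\<bar> * cmod (fourier_coeff y (s j))"
    and d: "\<And>j. j \<in> J \<Longrightarrow> cmod (d j) \<le> 2 * D j" and D: "\<And>j. j \<in> J \<Longrightarrow> 4 * D j \<le> K * (1 + (real_of_int j)\<^sup>2)" and K: "K \<ge> 0"
  shows "\<exists>t. wl2_le J D (\<lambda>j. d j * fourier_coeff y (s j)) t"
proof (rule exI, rule wl2_leI)
  let ?b = "\<lambda>j. cmod (fourier_coeff y (s j))" and ?b' = "\<lambda>j. cmod (fourier_coeff y' (s j))"
  show "sums_bounded (\<lambda>j. K * ((?b j)\<^sup>2 + (?b' j)\<^sup>2)) (K * (2 * L2_sq y / pi + 2 * L2_sq y' / pi))"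
    by (rule sums_bounded_scale[OF sums_bounded_add[OF sums_bounded_compose[OF sums_bounded_fourier[OF y(1)] s]
      sums_bounded_compose[OF sums_bounded_fourier[OF y(2)] s]] K])
  fix j assume j: "j \<in> J"
  have "(cmod (d j))\<^sup>2 \<le> (2 * D j)\<^sup>2" by (intro power_mono d[OF j]) simp
  also have "\<dots> = D j * (4 * D j)" by (simp add: power2_eq_square)
  also have "\<dots> \<le> D j * (K * (1 + (real_of_int j)\<^sup>2))"
    using D_pos[OF j] by (intro mult_left_mono D[OF j]) simp
  finally have "(cmod (d j))\<^sup>2 * (?b j)\<^sup>2 \<le> D j * (K * (1 + (real_of_int j)\<^sup>2)) * (?b j)\<^sup>2"
    by (rule mult_right_mono) simp
  also have "\<dots> = D j * (K * ((?b j)\<^sup>2 + (?b' j)\<^sup>2))"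
    unfolding deriv[OF j] by (simp add: power_mult_distrib algebra_simps)
  finally show "(cmod (d j * fourier_coeff y (s j)))\<^sup>2 \<le> D j * (K * ((?b j)\<^sup>2 + (?b' j)\<^sup>2))"
    by (simp add: norm_mult power_mult_distrib)
qed

section \<open>The Dirac operator\<close>

lemma has_sum_insertD:
  fixes f :: "'a \<Rightarrow> complex"
  assumes "(f has_sum s) (insert a A)" "a \<notin> A"
  shows "(f has_sum (s - f a)) A"
proof -
  have "(f has_sum (s - f a)) (insert a A - {a})"
    by (rule has_sum_Diff[OF assms(1) has_sum_finite[of "{a}", simplified]]) auto
  then show ?thesis using assms(2) by simp
qed

definition dirac_index :: "int \<Rightarrow> int set" where
  "dirac_index n = {j. even (j - n) \<and> j \<noteq> n}"

definition dirac_denom :: "int \<Rightarrow> complex \<Rightarrow> int \<Rightarrow> complex" where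
  "dirac_denom n z j = of_int n - of_int j + z"

lemma dirac_perturbed:
  assumes "cmod z \<le> 1 / 2"
  shows "perturbed (dirac_index n) (dirac_dist n) (dirac_denom n z)"
proof
  fix j assume j: "j \<in> dirac_index n"
  define \<Delta> where "\<Delta> = dirac_dist n j"
  have ge: "\<Delta> \<ge> 1" unfolding \<Delta>_def by (rule abs_int_ge_1) (use j in \<open>auto simp: dirac_index_def\<close>)
  then show "0 < dirac_dist n j" unfolding \<Delta>_def by linarith
  have "\<Delta> = cmod (of_int n - of_int j)"
    unfolding \<Delta>_def of_int_diff[symmetric] norm_of_int ..
  also have "\<dots> \<le> cmod (dirac_denom n z j) + cmod z"
    unfolding dirac_denom_def using norm_triangle_ineq4[of "of_int n - of_int j + z" z] by simp
  finally have "\<Delta> / 2 \<le> cmod (dirac_denom n z j)" using ge assms by linarith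
  then show "dirac_dist n j / 2 \<le> cmod (dirac_denom n z j)" unfolding \<Delta>_def .
qed

lemma dirac_sum_eq_tsum:
  "dirac_sum F G n z k = tsum (dirac_index n) (dirac_denom n z) F G (\<lambda>i. F i n) (\<lambda>i. G i n) k n"
  unfolding dirac_sum_def tsum_def chain_eq_gchain dirac_index_def dirac_denom_def ..

text \<open>For odd \<open>k\<close> there is an even number of alternating factors, so a reversed
  chain starts with the other matrix. Both diagonal entries of the reduced Dirac system are
  therefore equal.\<close>

lemma dirac_sum_rev:
  assumes "\<And>i j. F i j = F j i" "\<And>i j. G i j = G j i" "odd k"
  shows "dirac_sum F G n z k = dirac_sum G F n z k"
proof -
  have b: "bij_betw rev (tuples J k) (tuples J k)" for J
    by (rule bij_betwI[where g = rev]) (auto simp: tuples_def)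
  have FF: "(\<lambda>i j. F j i) = F" "(\<lambda>i j. G j i) = G" using assms by (auto simp: fun_eq_iff)
  have "dirac_sum F G n z k = (\<Sum>\<^sub>\<infinity>js\<in>tuples {j. even (j - n) \<and> j \<noteq> n} k.
        chain G F n (rev js) n / (\<Prod>j\<leftarrow>rev js. of_int n - of_int j + z))"
    unfolding dirac_sum_def
    by (intro infsum_cong arg_cong2[of _ _ _ _ "(/)"])
       (use assms(3) in \<open>auto simp: tuples_def chain_rev[of F G] FF rev_map[symmetric] prod_list.rev\<close>)
  also have "\<dots> = dirac_sum G F n z k"
    unfolding dirac_sum_def by (rule infsum_reindex_bij_betw[OF b])
  finally show ?thesis .
qed

section \<open>Coupling matrices and reduction of the Dirac operator\<close>

locale dirac_potential =
  fixes P Q :: "real \<Rightarrow> complex"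
  assumes P: "L2_pi P" and Q: "L2_pi Q"
begin

text \<open>Multiplication by P and Q as matrices, where the first component is expanded in
  exp(-ijx) and the second in exp(ijx). This explains the sums of indices and makes both matrices
  symmetric.\<close>

definition "Fp i j = fourier_coeff P (- i - j)"
definition "Fq i j = fourier_coeff Q (i + j)"

definition "weight r = ((cmod (fourier_coeff P r))\<^sup>2 + (cmod (fourier_coeff P (- r)))\<^sup>2)
   + ((cmod (fourier_coeff Q r))\<^sup>2 + (cmod (fourier_coeff Q (- r)))\<^sup>2)"

definition "weight_total = (2 * L2_sq P / pi + 2 * L2_sq P / pi) + (2 * L2_sq Q / pi + 2 * L2_sq Q / pi)"

lemma weight_bounded: "sums_bounded weight weight_total"
  unfolding weight_def weight_total_def by (intro sums_bounded_add sums_bounded_fourier_sym P Q)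

lemma weight_sym: "weight (- r) = weight r"
  by (simp add: weight_def)

lemma F_le: "(cmod (Fp i j))\<^sup>2 \<le> weight (i + j)" "(cmod (Fq i j))\<^sup>2 \<le> weight (i + j)"
proof -
  have "- i - j = - (i + j)" by simp
  then show "(cmod (Fp i j))\<^sup>2 \<le> weight (i + j)" unfolding Fp_def weight_def by simp
qed (simp add: Fq_def weight_def)

lemma F_sym: "Fp i j = Fp j i" "Fq i j = Fq j i"
proof -
  have "- i - j = - j - i" by simp
  then show "Fp i j = Fp j i" by (simp only: Fp_def)
  show "Fq i j = Fq j i" by (simp only: Fq_def add.commute)
qed

definition "hs_bound n = sqrt (4 * cubic_total * tail_sum weight n)"
definition "l2_bound n = sqrt (2 * tail_sum weight n)"

abbreviation "bounded_vec n f \<equiv> wl2_le (dirac_index n) (dirac_dist n) f (l2_bound n)"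
abbreviation "bounded_mat n F \<equiv> whs_le (dirac_index n) (dirac_dist n) F (hs_bound n)"

lemma matrix_bounds:
  "bounded_mat n Fp" "bounded_mat n Fq"
  "bounded_vec n (\<lambda>j. Fp j n)" "bounded_vec n (\<lambda>j. Fq j n)"
  "bounded_vec n (Fp n)" "bounded_vec n (Fq n)"
proof -
  have F_le': "(cmod (Fp j n))\<^sup>2 \<le> weight (n + j)" "(cmod (Fq j n))\<^sup>2 \<le> weight (n + j)" for j
    using F_le[of j n] by (simp_all only: add.commute)
  have J: "n \<notin> dirac_index n" by (simp add: dirac_index_def)
  show "bounded_mat n Fp" "bounded_mat n Fq"
    unfolding hs_bound_def by (rule dirac_whs_le[OF weight_bounded weight_sym J F_le(1)] dirac_whs_le[OF weight_bounded weight_sym J F_le(2)])+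
  show "bounded_vec n (\<lambda>j. Fp j n)" "bounded_vec n (\<lambda>j. Fq j n)"
    "bounded_vec n (Fp n)" "bounded_vec n (Fq n)"
    unfolding l2_bound_def by (rule dirac_wl2_le[OF weight_bounded weight_sym J], rule F_le' F_le)+
qed

definition "alpha n z = (\<Sum>k. dirac_sum Fp Fq n z (2 * k + 1))"

lemma beta_eqs:
  "beta_minus (Dirac P Q) n z = Fp n n + (\<Sum>k. dirac_sum Fp Fq n z (2 * k + 2))"
  "beta_plus (Dirac P Q) n z = Fq n n + (\<Sum>k. dirac_sum Fq Fp n z (2 * k + 2))"
  by (simp_all add: Fp_def [abs_def] Fq_def [abs_def])

text \<open>The general constant 8 \<sigma> \<tau> / \<delta> with both norms equal to
  \<open>l2_bound n\<close> and \<delta> = 1, because distinct integers differ by at least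
  1.\<close>

lemma lipschitz:
  assumes z: "cmod z \<le> 1 / 2" "cmod z' \<le> 1 / 2" and small: "hs_bound n \<le> 1 / 8"
  shows "cmod (alpha n z - alpha n z') \<le> 16 * tail_sum weight n * cmod (z - z')"
    "cmod (beta_minus (Dirac P Q) n z - beta_minus (Dirac P Q) n z') \<le> 16 * tail_sum weight n * cmod (z - z')"
    "cmod (beta_plus (Dirac P Q) n z - beta_plus (Dirac P Q) n z') \<le> 16 * tail_sum weight n * cmod (z - z')"
proof -
  note p = dirac_perturbed[OF z(1), of n] dirac_perturbed[OF z(2), of n]
  interpret perturbed "dirac_index n" "dirac_dist n" "dirac_denom n z" by (rule p)
  have ge: "dirac_dist n j \<ge> 1" if "j \<in> dirac_index n" for j
    by (rule abs_int_ge_1) (use that in \<open>auto simp: dirac_index_def\<close>)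
  have dd: "dirac_denom n z j - dirac_denom n z' j = z - z'" if "j \<in> dirac_index n" for j by (simp add: dirac_denom_def)
  have "l2_bound n * l2_bound n = 2 * tail_sum weight n"
    using tail_sum_nonneg[OF weight_bounded weight_sym, of n] by (simp add: l2_bound_def)
  then have c: "8 * l2_bound n * l2_bound n / 1 * x = 16 * tail_sum weight n * x" for x by simp
  note L = suminf_tsum_lipschitz[OF p zero_less_one ge dd _ _ _ _ _ small]
  show "cmod (alpha n z - alpha n z') \<le> 16 * tail_sum weight n * cmod (z - z')"
    unfolding alpha_def dirac_sum_eq_tsum Suc_eq_plus1[symmetric] c[symmetric] by (rule L[OF _ _ matrix_bounds(1,2,3,4,5)]) simp_all
  have e: "2 * k + 2 = Suc (2 * k + 1)" for k :: nat by simp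
  show "cmod (beta_minus (Dirac P Q) n z - beta_minus (Dirac P Q) n z') \<le> 16 * tail_sum weight n * cmod (z - z')"
    unfolding beta_eqs add_diff_cancel_left dirac_sum_eq_tsum e c[symmetric] by (rule L[OF _ _ matrix_bounds(1,2,3,4,5)]) simp_all
  show "cmod (beta_plus (Dirac P Q) n z - beta_plus (Dirac P Q) n z') \<le> 16 * tail_sum weight n * cmod (z - z')"
    unfolding beta_eqs add_diff_cancel_left dirac_sum_eq_tsum e c[symmetric] by (rule L[OF _ _ matrix_bounds(2,1,4,3,6)]) simp_all
qed

text \<open>Odd orders end in a multiple of \<open>a\<close> and build the diagonal entry, even
  orders end in a multiple of \<open>b\<close> and build the off-diagonal one. Grouping consecutive
  terms in pairs separates the two subseries.\<close>

lemma row_sum: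
  assumes z: "cmod z \<le> 1 / 2" and small: "hs_bound n \<le> 1 / 8"
    and FG: "F = Fp \<and> G = Fq \<or> F = Fq \<and> G = Fp"
    and s: "(\<lambda>k. (if even (Suc k) then b else a) * dirac_sum F G n z (Suc k)) sums B"
  shows "B = (\<Sum>k. dirac_sum F G n z (2 * k + 1)) * a + (\<Sum>k. dirac_sum F G n z (2 * k + 2)) * b"
proof -
  interpret perturbed "dirac_index n" "dirac_dist n" "dirac_denom n z" by (rule dirac_perturbed[OF z])
  have "summable (\<lambda>k. dirac_sum F G n z (Suc (r k)))" if "\<And>k. r k \<ge> k" for r
    unfolding dirac_sum_eq_tsum using FG
  proof (elim disjE conjE; hypsubst)
    show "summable (\<lambda>k. tsum (dirac_index n) (dirac_denom n z) Fp Fq (\<lambda>i. Fp i n) (\<lambda>i. Fq i n) (Suc (r k)) n)"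
      by (rule tsum_summable_seq[OF matrix_bounds(1,2,3,4,5) small that])
    show "summable (\<lambda>k. tsum (dirac_index n) (dirac_denom n z) Fq Fp (\<lambda>i. Fq i n) (\<lambda>i. Fp i n) (Suc (r k)) n)"
      by (rule tsum_summable_seq[OF matrix_bounds(2,1,4,3,6) small that])
  qed
  from this[of "\<lambda>k. 2 * k"] this[of "\<lambda>k. 2 * k + 1"]
  have "summable (\<lambda>k. dirac_sum F G n z (2 * k + 1))" "summable (\<lambda>k. dirac_sum F G n z (2 * k + 2))"
    by simp_all
  then have "(\<lambda>k. dirac_sum F G n z (2 * k + 1) * a + dirac_sum F G n z (2 * k + 2) * b)
     sums ((\<Sum>k. dirac_sum F G n z (2 * k + 1)) * a + (\<Sum>k. dirac_sum F G n z (2 * k + 2)) * b)"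
    by (intro sums_add sums_mult2 summable_sums)
  moreover have "(\<lambda>k. dirac_sum F G n z (2 * k + 1) * a + dirac_sum F G n z (2 * k + 2) * b) sums B"
  proof -
    \<comment> \<open>The series is indexed from 0 but starts at order 1, so the k-th pair holds the
      orders 2k + 1 and 2k + 2.\<close>
    have "{k * 2..<k * 2 + 2} = {k * 2, Suc (k * 2)}" for k :: nat by auto
    then show ?thesis using sums_group[OF s, of 2] by (simp add: mult.commute)
  qed
  ultimately show ?thesis by (rule sums_unique2[symmetric])
qed

lemma eigenvalue_equation:
  assumes ev: "is_eigenvalue scale2 (dirac_graph P Q (per_sign n)) \<mu>" and \<mu>: "\<mu> = of_int n + z"
    and z: "cmod z \<le> 1 / 2" and small: "hs_bound n \<le> 1 / 8"
  shows "(z - alpha n z)\<^sup>2 = beta_minus (Dirac P Q) n z * beta_plus (Dirac P Q) n z"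
proof -
  let ?J = "dirac_index n" and ?D = "dirac_dist n" and ?d = "dirac_denom n z"
  interpret perturbed ?J ?D ?d by (rule dirac_perturbed[OF z])
  from ev obtain y y' :: "real \<Rightarrow> complex ^ 2" where y0: "y \<noteq> 0" and out: "\<And>x. x \<notin> {0..pi} \<Longrightarrow> y x = 0"
    and W: "\<And>i. W12 (\<lambda>x. y x $ i) (\<lambda>x. y' x $ i)"
    and eq: "AE x in leb_pi. \<mu> * y x $ 1 = \<i> * y' x $ 1 + P x * y x $ 2"
      "AE x in leb_pi. \<mu> * y x $ 2 = Q x * y x $ 1 - \<i> * y' x $ 2"
    and per: "y pi = per_sign n *s y 0"
    unfolding is_eigenvalue_def dirac_graph_def scale2_def by auto
  have W11: "W11 (\<lambda>x. y x $ i) (\<lambda>x. y' x $ i)" and Ly': "L2_pi (\<lambda>x. y' x $ i)" for i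
    using W[of i] by (auto simp: W12_def)
  have cy: "continuous_on {0..pi} (\<lambda>x. y x $ i)" for i by (rule W11_continuous[OF W11])
  have Ly: "L2_pi (\<lambda>x. y x $ i)" for i by (rule L2_on_continuous[OF cy])
  have per_i: "y pi $ i = per_sign n * y 0 $ i" for i using per by simp
  let ?c = fourier_coeff
  let ?y1 = "\<lambda>x. y x $ 1" and ?y2 = "\<lambda>x. y x $ 2" and ?y1' = "\<lambda>x. y' x $ 1" and ?y2' = "\<lambda>x. y' x $ 2"
    and ?Py = "\<lambda>x. P x * y x $ 2" and ?Qy = "\<lambda>x. Q x * y x $ 1"
  \<comment> \<open>The free operator acts on the first component by \<open>i d/dx\<close>, whose eigenfunction for \<open>j\<close> is \<open>exp(-ijx)\<close>.\<close>
  define a where "a j = ?c ?y1 (- j)" for j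
  define b where "b j = ?c ?y2 j" for j
  have deriv: "?c (\<lambda>x. y' x $ i) j = \<i> * of_int j * ?c (\<lambda>x. y x $ i) j" if "even (j - n)" for i j
    by (rule fourier_coeff_deriv[OF W11 per_i that])
  have I: "integrable leb_pi (\<lambda>x. y x $ i)" "integrable leb_pi (\<lambda>x. y' x $ i)" 
    "integrable leb_pi (\<lambda>x. P x * y x $ i)" "integrable leb_pi (\<lambda>x. Q x * y x $ i)" for i
    using L2_on_integrable[OF Ly] L2_on_integrable[OF Ly'] L2_on_mult_integrable[OF P Ly] L2_on_mult_integrable[OF Q Ly]
    by auto
  have e1: "\<mu> * ?c ?y1 j = \<i> * ?c ?y1' j + ?c ?Py j"
    and e2: "\<mu> * ?c ?y2 j = - \<i> * ?c ?y2' j + ?c ?Qy j" for j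
  proof -
    have ii: "integrable leb_pi (\<lambda>x. \<i> * y' x $ i)" "integrable leb_pi (\<lambda>x. \<mu> * y x $ i)" for i
      using I by simp_all
    have "?c (\<lambda>x. \<mu> * y x $ 1) j = ?c (\<lambda>x. \<i> * y' x $ 1 + P x * y x $ 2) j"
      "?c (\<lambda>x. \<mu> * y x $ 2) j = ?c (\<lambda>x. Q x * y x $ 1 - \<i> * y' x $ 2) j"
      by (rule fourier_coeff_cong_AE[OF ii(2) Bochner_Integration.integrable_add[OF ii(1) I(3)] eq(1)]
          fourier_coeff_cong_AE[OF ii(2) Bochner_Integration.integrable_diff[OF I(4) ii(1)] eq(2)])+
    moreover have "?c (\<lambda>x. \<i> * y' x $ 1 + P x * y x $ 2) j = \<i> * ?c ?y1' j + ?c ?Py j"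
      unfolding fourier_coeff_add[OF ii(1) I(3)] fourier_coeff_scale[OF I(2)] ..
    moreover have "?c (\<lambda>x. Q x * y x $ 1 - \<i> * y' x $ 2) j = - \<i> * ?c ?y2' j + ?c ?Qy j"
      unfolding fourier_coeff_diff[OF I(4) ii(1)] fourier_coeff_scale[OF I(2)] by simp
    ultimately show "\<mu> * ?c ?y1 j = \<i> * ?c ?y1' j + ?c ?Py j"
      "\<mu> * ?c ?y2 j = - \<i> * ?c ?y2' j + ?c ?Qy j"
      by (simp_all only: fourier_coeff_scale[OF I(1)])
  qed
  \<comment> \<open>\<open>f\<close> and \<open>g\<close> carry the coupling to the two resonant
    unknowns \<open>b n\<close> and \<open>a n\<close>; \<open>B\<close> and \<open>A\<close>
    collect the off-resonant rest.\<close>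
  define f where "f i = b n * Fp i n" for i
  define g where "g i = a n * Fq i n" for i
  define B where "B i = (\<Sum>\<^sub>\<infinity>m\<in>?J. Fp i m * b m)" for i
  define A where "A i = (\<Sum>\<^sub>\<infinity>m\<in>?J. Fq i m * a m)" for i
  have cl: "{m. even (m - n)} = insert n ?J" "n \<notin> ?J" by (auto simp: dirac_index_def)
  have aB: "?d j * a j = f j + B j" if j: "even (j - n)" for j
  proof -
    have j': "even (- j - n)" using j by simp
    have "((\<lambda>m. Fp j m * b m) has_sum ?c ?Py (- j)) (insert n ?J)"
      using parseval[OF P Ly, of "- j" 2 n] unfolding cl(1) Fp_def b_def .
    from infsumI[OF has_sum_insertD[OF this cl(2)]]
    have "B j = ?c ?Py (- j) - Fp j n * b n" unfolding B_def .
    then show ?thesis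
      using e1[of "- j"] unfolding deriv[OF j'] a_def[symmetric]
      by (simp add: f_def dirac_denom_def \<mu> algebra_simps)
  qed
  have bA: "?d j * b j = g j + A j" if j: "even (j - n)" for j
  proof -
    \<comment> \<open>The first component is indexed with reversed sign, and the residue class is
      closed under negation.\<close>
    have "bij_betw uminus {m. even (m - n)} {m. even (m - n)}"
      by (rule bij_betwI[where g = uminus]) auto
    from has_sum_reindex_bij_betw[OF this, of "\<lambda>m. ?c Q (j - m) * ?c ?y1 m"]
    have "((\<lambda>m. Fq j m * a m) has_sum ?c ?Qy j) (insert n ?J)"
      using parseval[OF Q Ly, of j 1 n] unfolding cl(1) Fq_def a_def by simp
    from infsumI[OF has_sum_insertD[OF this cl(2)]]
    have "A j = ?c ?Qy j - Fq j n * a n" unfolding A_def .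
    then show ?thesis
      using e2[of j] unfolding deriv[OF j] b_def[symmetric]
      by (simp add: g_def dirac_denom_def \<mu> algebra_simps)
  qed
  note vf = wl2_le_scale[OF matrix_bounds(3), of "b n", folded f_def] and vg = wl2_le_scale[OF matrix_bounds(4), of "a n", folded g_def]
  \<comment> \<open>The second bound may depend on \<open>n\<close>: for the remainder in the
    Neumann expansion only finiteness of the norms of \<open>A\<close> and \<open>B\<close>
    matters.\<close>
  have dj: "cmod (?d j) \<le> 2 * ?D j" "4 * ?D j \<le> 8 * (1 + (real_of_int n)\<^sup>2) * (1 + (real_of_int j)\<^sup>2)" if j: "j \<in> ?J" for j
  proof -
    have "?D j \<ge> 1" by (rule abs_int_ge_1) (use j in \<open>auto simp: dirac_index_def\<close>)
    moreover have "x + cmod z \<le> 2 * x" if "x \<ge> 1" for x using z that by simp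
    moreover have "cmod (?d j) \<le> cmod (of_int (n - j)) + cmod z" unfolding dirac_denom_def of_int_diff by (rule norm_triangle_ineq)
    ultimately show "cmod (?d j) \<le> 2 * ?D j" unfolding norm_of_int by (meson order_trans)
    have "\<bar>x - y\<bar> \<le> 2 * ((1 + x\<^sup>2) * (1 + y\<^sup>2))" for x y :: real
    proof -
      have "\<bar>x\<bar> \<le> 1 + x\<^sup>2" for x :: real using sum_squares_bound[of 1 "\<bar>x\<bar>"] by simp
      from this[of x] this[of y] have "\<bar>x - y\<bar> \<le> (1 + x\<^sup>2) + (1 + y\<^sup>2)" by linarith
      moreover have "(1 + x\<^sup>2) + (1 + y\<^sup>2) \<le> 2 * ((1 + x\<^sup>2) * (1 + y\<^sup>2))" by (simp add: algebra_simps)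
      ultimately show ?thesis by linarith
    qed
    moreover have "4 * x \<le> 8 * t" if "x \<le> 2 * t" for x t :: real using that by simp
    ultimately show "4 * ?D j \<le> 8 * (1 + (real_of_int n)\<^sup>2) * (1 + (real_of_int j)\<^sup>2)"
      unfolding of_int_diff mult.assoc by blast
  qed
  obtain U where da: "wl2_le ?J ?D (\<lambda>j. ?d j * a j) U"
    using wl2_le_sobolev[OF Ly Ly', of uminus 1 1, OF _ _ dj, folded a_def] deriv
    by (auto simp: inj_on_def a_def norm_mult dirac_index_def)
  obtain U' where db: "wl2_le ?J ?D (\<lambda>j. ?d j * b j) U'"
    using wl2_le_sobolev[OF Ly Ly', of "\<lambda>j. j" 2 2, OF _ _ dj, folded b_def] deriv
    by (auto simp: inj_on_def b_def norm_mult dirac_index_def)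
  obtain t where vB: "wl2_le ?J ?D B t"
    using wl2_le_cong[OF wl2_le_add[OF da wl2_le_scale[OF vf, of "- 1"]], of B] aB by (fastforce simp: dirac_index_def)
  obtain t' where vA: "wl2_le ?J ?D A t'"
    using wl2_le_cong[OF wl2_le_add[OF db wl2_le_scale[OF vg, of "- 1"]], of A] bA by (fastforce simp: dirac_index_def)
  define \<tau> where "\<tau> = max (cmod (b n) * l2_bound n) (cmod (a n) * l2_bound n)"
  define \<tau>' where "\<tau>' = max t t'"
  have v: "wl2_le ?J ?D f \<tau>" "wl2_le ?J ?D g \<tau>" "wl2_le ?J ?D A \<tau>'" "wl2_le ?J ?D B \<tau>'"
    using wl2_le_mono[OF vf] wl2_le_mono[OF vg] wl2_le_mono[OF vA] wl2_le_mono[OF vB] by (auto simp: \<tau>_def \<tau>'_def)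
  have ab: "?d m * a m = f m + B m" "?d m * b m = g m + A m" if "m \<in> ?J" for m
    using that aB bA by (auto simp: dirac_index_def)
  have NB: "(\<lambda>k. (if even (Suc k) then b n else a n) * tsum ?J ?d Fp Fq (\<lambda>i. Fp i n) (\<lambda>i. Fq i n) (Suc k) i) sums B i"
    if row: "wl2_le ?J ?D (Fp i) \<sigma>" for i \<sigma>
    using neumann_expansion[OF matrix_bounds(1,2) v(1,2,3,4) row B_def A_def B_def ab small]
    unfolding f_def g_def tsum_scale .
  have NA: "(\<lambda>k. (if even (Suc k) then a n else b n) * tsum ?J ?d Fq Fp (\<lambda>i. Fq i n) (\<lambda>i. Fp i n) (Suc k) i) sums A i"
    if row: "wl2_le ?J ?D (Fq i) \<sigma>" for i \<sigma>
    using neumann_expansion[OF matrix_bounds(2,1) v(2,1,4,3) row A_def B_def A_def ab(2,1) small]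
    unfolding f_def g_def tsum_scale .
  have Bn: "B n = alpha n z * a n + (\<Sum>k. dirac_sum Fp Fq n z (2 * k + 2)) * b n"
    unfolding alpha_def
    by (rule row_sum[OF z small]) (use NB[OF matrix_bounds(5)] in \<open>simp_all add: dirac_sum_eq_tsum\<close>)
  have An: "A n = alpha n z * b n + (\<Sum>k. dirac_sum Fq Fp n z (2 * k + 2)) * a n"
  proof -
    have "dirac_sum Fq Fp n z (2 * k + 1) = dirac_sum Fp Fq n z (2 * k + 1)" for k
      by (rule dirac_sum_rev) (simp_all add: F_sym)
    then have "alpha n z = (\<Sum>k. dirac_sum Fq Fp n z (2 * k + 1))" unfolding alpha_def by simp
    then show ?thesis
      by (simp only:) (rule row_sum[OF z small]; use NA[OF matrix_bounds(6)] in \<open>simp_all add: dirac_sum_eq_tsum\<close>)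
  qed
  show ?thesis
  proof (rule determinant_2x2)
    show "z * a n = alpha n z * a n + beta_minus (Dirac P Q) n z * b n"
      using aB[of n] by (simp add: dirac_denom_def f_def Bn beta_eqs algebra_simps del: beta_minus.simps)
    show "z * b n = beta_plus (Dirac P Q) n z * a n + alpha n z * b n"
      using bA[of n] by (simp add: dirac_denom_def g_def An beta_eqs algebra_simps del: beta_plus.simps)
    show "a n \<noteq> 0 \<or> b n \<noteq> 0"
    proof (rule ccontr)
      \<comment> \<open>If both resonant coefficients vanish, so do \<open>f\<close> and
        \<open>g\<close>. Then the expansion gives B = A = 0 at every off-resonant index, all
        coefficients vanish, and so does \<open>y\<close>.\<close>
      assume "\<not> (a n \<noteq> 0 \<or> b n \<noteq> 0)"
      then have 0: "a n = 0" "b n = 0" by auto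
      have zero: "a j = 0" "b j = 0" if j: "even (j - n)" for j
      proof -
        have "a j = 0 \<and> b j = 0"
        proof (cases "j = n")
          case False
          then have J: "j \<in> ?J" using j by (simp add: dirac_index_def)
          have "(\<lambda>k::nat. 0::complex) sums B j" "(\<lambda>k::nat. 0::complex) sums A j"
            using NB[OF whs_le_row[OF matrix_bounds(1) J]] NA[OF whs_le_row[OF matrix_bounds(2) J]] by (simp_all add: 0 if_distrib cong: if_cong)
          then have "B j = 0" "A j = 0" using sums_unique2[OF _ sums_zero] by auto
          then show ?thesis using ab[OF J] d_nz[OF J] by (simp add: f_def g_def 0)
        qed (use 0 in simp)
        then show "a j = 0" "b j = 0" by auto
      qed
      have "y x = 0" for x
      proof (cases "x \<in> {0..pi}")
        case True
        have "y x $ 1 = 0"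
          by (rule fourier_unique[OF cy _ True, where n = n]) (use zero(1)[of "- j" for j] in \<open>simp add: a_def\<close>)
        moreover have "y x $ 2 = 0"
          by (rule fourier_unique[OF cy _ True, where n = n]) (use zero(2) in \<open>simp add: b_def\<close>)
        ultimately show ?thesis by (simp add: vec_eq_iff forall_2)
      qed (rule out)
      then show False using y0 by (simp add: fun_eq_iff)
    qed
  qed
qed

end

section \<open>The Hill operator\<close>

definition hill_index :: "int \<Rightarrow> int set" where
  "hill_index n = {j. even (j - n) \<and> j \<noteq> n \<and> j \<noteq> - n}"

definition hill_denom :: "int \<Rightarrow> complex \<Rightarrow> int \<Rightarrow> complex" where
  "hill_denom n z j = (of_int n)\<^sup>2 - (of_int j)\<^sup>2 + z"

lemma hill_index_not: "n \<notin> hill_index n" "- n \<notin> hill_index n"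
  by (auto simp: hill_index_def)

lemma hill_dist_ge: "j \<in> hill_index n \<Longrightarrow> hill_dist n j \<ge> \<bar>real_of_int n\<bar>"
  by (rule hill_dist_ge_abs) (auto simp: hill_index_def)

lemma hill_perturbed:
  assumes n: "n \<ge> 1" and z: "cmod z \<le> of_int n / 4"
  shows "perturbed (hill_index n) (hill_dist n) (hill_denom n z)"
proof
  fix j assume j: "j \<in> hill_index n"
  define \<Delta> where "\<Delta> = hill_dist n j"
  have ge: "\<Delta> \<ge> of_int n" unfolding \<Delta>_def using hill_dist_ge[OF j] n by linarith
  have n1: "real_of_int n \<ge> 1" using n by simp
  show "0 < hill_dist n j" using ge n1 unfolding \<Delta>_def by linarith
  have "(of_int n)\<^sup>2 - (of_int j)\<^sup>2 = complex_of_real ((real_of_int n)\<^sup>2 - (real_of_int j)\<^sup>2)" by simp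
  then have "\<Delta> = cmod ((of_int n)\<^sup>2 - (of_int j)\<^sup>2)" unfolding \<Delta>_def by (simp only: norm_of_real)
  also have "\<dots> \<le> cmod (hill_denom n z j) + cmod z"
    unfolding hill_denom_def using norm_triangle_ineq4[of "(of_int n)\<^sup>2 - (of_int j)\<^sup>2 + z" z] by simp
  finally have "\<Delta> / 2 \<le> cmod (hill_denom n z j)" using ge z n1 by linarith
  then show "hill_dist n j / 2 \<le> cmod (hill_denom n z j)" unfolding \<Delta>_def .
qed

section \<open>Coupling matrix and reduction of the Hill operator\<close>

locale hill_potential =
  fixes C :: complex and q :: "real \<Rightarrow> complex"
  assumes q: "L2_pi q"
begin

definition "Fv i j = hill_coeff C q (i - j)"

definition "weight r = ((cmod (fourier_coeff q r))\<^sup>2 + (cmod (fourier_coeff q (- r)))\<^sup>2)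
   + (if r = 0 then (cmod C)\<^sup>2 else 0)"

definition "weight_total = (2 * L2_sq q / pi + 2 * L2_sq q / pi) + (cmod C)\<^sup>2"

lemma weight_bounded: "sums_bounded weight weight_total"
  unfolding weight_def weight_total_def by (intro sums_bounded_add sums_bounded_fourier_sym q sums_bounded_single) simp

lemma weight_sym: "weight (- r) = weight r"
  by (simp add: weight_def)

lemma coeff_le: "(cmod (hill_coeff C q r))\<^sup>2 \<le> square_or_one r * weight r"
  by (simp add: hill_coeff_def weight_def square_or_one_def norm_mult power_mult_distrib distrib_left)

lemma coeff_le': "(cmod (hill_coeff C q (- r)))\<^sup>2 \<le> square_or_one r * weight r"
  using coeff_le[of "- r"] by (cases "r = 0") (simp_all add: weight_sym square_or_one_def)

definition "hs_bound n = sqrt (8 * cubic_total * (weight_total / sqrt (1 + 2 * \<bar>real_of_int n\<bar>) + tail_sum weight n))"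
definition "l2_bound n = sqrt (weight_total + 4 * \<bar>real_of_int n\<bar> * tail_sum weight n)"

abbreviation "bounded_vec n f \<equiv> wl2_le (hill_index n) (hill_dist n) f (l2_bound n)"
abbreviation "bounded_mat n F \<equiv> whs_le (hill_index n) (hill_dist n) F (hs_bound n)"

lemma matrix_bounds:
  "bounded_mat n Fv"
  "bounded_vec n (\<lambda>j. Fv j n)" "bounded_vec n (\<lambda>j. Fv j (- n))"
  "bounded_vec n (Fv n)" "bounded_vec n (Fv (- n))"
proof -
  show "bounded_mat n Fv"
    unfolding hs_bound_def by (rule hill_whs_le[OF weight_bounded weight_sym hill_index_not]) (unfold Fv_def, rule coeff_le)
  have e: "j - n = - (n - j)" "j - - n = n + j" "- n - j = - (n + j)" for j by simp_all
  note V = hill_wl2_le[OF weight_bounded weight_sym hill_index_not]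
  show "bounded_vec n (\<lambda>j. Fv j n)"
    unfolding l2_bound_def by (rule V, unfold Fv_def e, intro disjI1 allI, rule coeff_le')
  show "bounded_vec n (\<lambda>j. Fv j (- n))"
    unfolding l2_bound_def by (rule V, unfold Fv_def e, intro disjI2 allI, rule coeff_le)
  show "bounded_vec n (Fv n)"
    unfolding l2_bound_def by (rule V, unfold Fv_def, intro disjI1 allI, rule coeff_le)
  show "bounded_vec n (Fv (- n))"
    unfolding l2_bound_def by (rule V, unfold Fv_def e, intro disjI2 allI, rule coeff_le')
qed

abbreviation "hsum n z a b k \<equiv> hill_sum C q n z a b k"

lemma hill_sum_eq_tsum:
  "hsum n z a b k = tsum (hill_index n) (hill_denom n z) Fv Fv (\<lambda>i. Fv i b) (\<lambda>i. Fv i b) k a"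
  unfolding hill_sum_def tsum_def chain_eq_gchain hill_index_def hill_denom_def Fv_def Let_def ..

text \<open>Reversing and negating a tuple preserves the denominators, which are even in each index,
  and exchanges the end points n and -n. Thus both diagonal entries of the reduced system are
  \<open>alpha n z\<close>.\<close>

lemma hill_sum_reflect: "hsum n z (- n) (- n) k = hsum n z n n k"
proof -
  let ?J = "{j. even (j - n) \<and> j \<noteq> n \<and> j \<noteq> - n}"
  let ?r = "\<lambda>js. map uminus (rev js)"
  have b: "bij_betw ?r (tuples ?J k) (tuples ?J k)"
  proof -
    have J: "- j \<in> ?J" if "j \<in> ?J" for j using that by auto
    have "uminus ` set js \<subseteq> ?J" if "set js \<subseteq> ?J" for js
      by (rule image_subsetI, rule J, rule subsetD[OF that])
    then have "?r js \<in> tuples ?J k" if "js \<in> tuples ?J k" for js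
      using that unfolding tuples_def by simp
    then have *: "?r \<in> tuples ?J k \<rightarrow> tuples ?J k" by (rule funcsetI)
    show ?thesis by (rule bij_betwI[OF * *]) (simp_all add: rev_map o_def)
  qed
  let ?F = "\<lambda>i j. hill_coeff C q (i - j)"
  have T: "(\<lambda>i j. ?F j i) = (\<lambda>i j. ?F (- i) (- j))" by (simp add: fun_eq_iff)
  have c: "chain ?F ?F n js n = chain ?F ?F (- n) (?r js) (- n)" for js
  proof -
    have "chain ?F ?F n js n = chain (\<lambda>i j. ?F j i) (\<lambda>i j. ?F j i) n (rev js) n"
      by (subst chain_rev) simp
    also have "\<dots> = chain ?F ?F (- n) (?r js) (- n)" unfolding T by (rule chain_reflect)
    finally show ?thesis .
  qed
  have p: "(\<Prod>j\<leftarrow>?r js. (of_int n)\<^sup>2 - (of_int j)\<^sup>2 + z) = (\<Prod>j\<leftarrow>js. (of_int n)\<^sup>2 - (of_int j)\<^sup>2 + z)" for js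
    by (simp add: rev_map[symmetric] prod_list.rev o_def)
  have "hsum n z n n k = (\<Sum>\<^sub>\<infinity>js\<in>tuples ?J k. chain ?F ?F (- n) (?r js) (- n) / (\<Prod>j\<leftarrow>?r js. (of_int n)\<^sup>2 - (of_int j)\<^sup>2 + z))"
    unfolding hill_sum_def Let_def c p ..
  also have "\<dots> = hsum n z (- n) (- n) k"
    unfolding hill_sum_def Let_def by (rule infsum_reindex_bij_betw[OF b])
  finally show ?thesis ..
qed

definition "alpha n z = C + (\<Sum>k. hsum n z n n (k + 1))"

lemma beta_eqs:
  "beta_minus (Hill C q) n z = Fv (- n) n + (\<Sum>k. hsum n z (- n) n (k + 1))"
  "beta_plus (Hill C q) n z = Fv n (- n) + (\<Sum>k. hsum n z n (- n) (k + 1))"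
  by (simp_all add: Fv_def)

lemma tail_nonneg: "tail_sum weight n \<ge> 0"
  by (rule tail_sum_nonneg[OF weight_bounded weight_sym])

text \<open>The general constant 8 \<sigma> \<tau> / \<delta> with both norms equal to
  \<open>l2_bound n\<close> and \<delta> = |n|; this division turns a growing norm into a vanishing
  constant.\<close>

lemma lipschitz:
  assumes n: "n \<ge> 1" and z: "cmod z \<le> of_int n / 4" "cmod z' \<le> of_int n / 4" and small: "hs_bound n \<le> 1 / 8"
  defines "L \<equiv> 8 * (weight_total / \<bar>real_of_int n\<bar> + 4 * tail_sum weight n)"
  shows "cmod (alpha n z - alpha n z') \<le> L * cmod (z - z')"
    "cmod (beta_minus (Hill C q) n z - beta_minus (Hill C q) n z') \<le> L * cmod (z - z')"
    "cmod (beta_plus (Hill C q) n z - beta_plus (Hill C q) n z') \<le> L * cmod (z - z')"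
proof -
  note p = hill_perturbed[OF n z(1)] hill_perturbed[OF n z(2)]
  interpret perturbed "hill_index n" "hill_dist n" "hill_denom n z" by (rule p)
  have n0: "0 < \<bar>real_of_int n\<bar>" using n by simp
  have dd: "hill_denom n z j - hill_denom n z' j = z - z'" if "j \<in> hill_index n" for j by (simp add: hill_denom_def)
  have W: "weight_total \<ge> 0" by (rule sums_boundedD(3)[OF weight_bounded])
  have "l2_bound n * l2_bound n = weight_total + 4 * \<bar>real_of_int n\<bar> * tail_sum weight n"
    using W tail_nonneg[of n] by (simp add: l2_bound_def)
  then have "8 * l2_bound n * l2_bound n / \<bar>real_of_int n\<bar> = L" using n0 by (simp add: L_def field_simps)
  note S = suminf_tsum_lipschitz[OF p n0 hill_dist_ge dd _ _ _ _ _ small, where r = "\<lambda>k. k" and \<sigma> = "l2_bound n" and \<tau> = "l2_bound n", unfolded this]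
  show "cmod (alpha n z - alpha n z') \<le> L * cmod (z - z')"
    unfolding alpha_def add_diff_cancel_left hill_sum_eq_tsum Suc_eq_plus1[symmetric]
    by (rule S[OF _ _ matrix_bounds(1,1,2,2,4)]) simp_all
  show "cmod (beta_minus (Hill C q) n z - beta_minus (Hill C q) n z') \<le> L * cmod (z - z')"
    unfolding beta_eqs add_diff_cancel_left hill_sum_eq_tsum Suc_eq_plus1[symmetric]
    by (rule S[OF _ _ matrix_bounds(1,1,2,2,5)]) simp_all
  show "cmod (beta_plus (Hill C q) n z - beta_plus (Hill C q) n z') \<le> L * cmod (z - z')"
    unfolding beta_eqs add_diff_cancel_left hill_sum_eq_tsum Suc_eq_plus1[symmetric]
    by (rule S[OF _ _ matrix_bounds(1,1,3,3,4)]) simp_all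
qed

lemma eigenvalue_equation:
  assumes ev: "is_eigenvalue scale1 (hill_graph C q (per_sign n)) \<mu>" and \<mu>: "\<mu> = (of_int n)\<^sup>2 + z"
    and n: "n \<ge> 1" and z: "cmod z \<le> of_int n / 4" and small: "hs_bound n \<le> 1 / 8"
  shows "(z - alpha n z)\<^sup>2 = beta_minus (Hill C q) n z * beta_plus (Hill C q) n z"
proof -
  let ?J = "hill_index n" and ?D = "hill_dist n" and ?d = "hill_denom n z"
  interpret perturbed ?J ?D ?d by (rule hill_perturbed[OF n z])
  from ev obtain y y' w w' where y0: "y \<noteq> 0" and out: "\<And>x. x \<notin> {0..pi} \<Longrightarrow> y x = 0"
    and W: "W12 y y'" "W11 w w'" and eq: "AE x in leb_pi. w x = y' x - q x * y x"
      "AE x in leb_pi. \<mu> * y x = - w' x - q x * y' x + C * y x"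
    and per: "y pi = per_sign n * y 0" "w pi = per_sign n * w 0"
    unfolding is_eigenvalue_def hill_graph_def scale1_def by blast
  have W11: "W11 y y'" and Ly': "L2_pi y'" using W by (auto simp: W12_def)
  have cy: "continuous_on {0..pi} y" by (rule W11_continuous[OF W11])
  have Ly: "L2_pi y" by (rule L2_on_continuous[OF cy])
  have I: "integrable leb_pi y" "integrable leb_pi y'" "integrable leb_pi w" "integrable leb_pi w'"
    "integrable leb_pi (\<lambda>x. q x * y x)" "integrable leb_pi (\<lambda>x. q x * y' x)"
    using L2_on_integrable[OF Ly] L2_on_integrable[OF Ly'] W11_integrable[OF W(2)]
      L2_on_integrable[OF L2_on_continuous[OF W11_continuous[OF W(2)]]]
      L2_on_mult_integrable[OF q Ly] L2_on_mult_integrable[OF q Ly'] by auto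
  define b where "b = fourier_coeff y"
  have dy: "fourier_coeff y' j = \<i> * of_int j * b j" if "even (j - n)" for j
    unfolding b_def by (rule fourier_coeff_deriv[OF W11 per(1) that])
  have dw: "fourier_coeff w' j = \<i> * of_int j * fourier_coeff w j" if "even (j - n)" for j
    by (rule fourier_coeff_deriv[OF W(2) per(2) that])
  have e1: "fourier_coeff w j = fourier_coeff y' j - fourier_coeff (\<lambda>x. q x * y x) j" for j
  proof -
    have "fourier_coeff w j = fourier_coeff (\<lambda>x. y' x - q x * y x) j"
      by (rule fourier_coeff_cong_AE[OF I(3) Bochner_Integration.integrable_diff[OF I(2,5)] eq(1)])
    then show ?thesis unfolding fourier_coeff_diff[OF I(2,5)] .
  qed
  have e2: "\<mu> * b j = - fourier_coeff w' j - fourier_coeff (\<lambda>x. q x * y' x) j + C * b j" for j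
  proof -
    have ii: "integrable leb_pi (\<lambda>x. (-1) * w' x)" "integrable leb_pi (\<lambda>x. C * y x)" "integrable leb_pi (\<lambda>x. \<mu> * y x)"
      using I by simp_all
    have eq': "AE x in leb_pi. \<mu> * y x = ((-1) * w' x - q x * y' x) + C * y x" using eq(2) by simp
    have "fourier_coeff (\<lambda>x. \<mu> * y x) j = fourier_coeff (\<lambda>x. ((-1) * w' x - q x * y' x) + C * y x) j"
      by (rule fourier_coeff_cong_AE[OF ii(3)
         Bochner_Integration.integrable_add[OF Bochner_Integration.integrable_diff[OF ii(1) I(6)] ii(2)] eq'])
    then show ?thesis
      unfolding fourier_coeff_add[OF Bochner_Integration.integrable_diff[OF ii(1) I(6)] ii(2)]
        fourier_coeff_diff[OF ii(1) I(6)] fourier_coeff_scale[OF I(4)] fourier_coeff_scale[OF I(1)] b_def by simp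
  qed
  have nn: "n \<noteq> - n" using n by simp
  have cl: "{m. even (m - n)} = insert n (insert (- n) ?J)" "n \<notin> insert (- n) ?J" "- n \<notin> ?J"
    using nn by (auto simp: hill_index_def)
  \<comment> \<open>The distribution q' never acts directly. Taking coefficients of \<open>w\<close>
    and \<open>w'\<close> leaves i j (q y)_j - (q y')_j, and termwise i j q(j - m) - q(j - m) i m =
    i (j - m) q(j - m) = V(j - m). Each of the two series converges by Parseval; the constant
    \<open>C\<close> enters through the single term m = j.\<close>
  have full: "((\<lambda>m. Fv j m * b m) has_sum (\<mu> - (of_int j)\<^sup>2) * b j) {m. even (m - n)}" if j: "even (j - n)" for j
  proof -
    have 1: "((\<lambda>m. \<i> * of_int j * (fourier_coeff q (j - m) * b m)) has_sum \<i> * of_int j * fourier_coeff (\<lambda>x. q x * y x) j) {m. even (m - n)}"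
      unfolding b_def by (rule has_sum_cmult_right[OF parseval[OF q Ly]])
    have 2: "((\<lambda>m. (- 1) * (fourier_coeff q (j - m) * fourier_coeff y' m)) has_sum (- 1) * fourier_coeff (\<lambda>x. q x * y' x) j) {m. even (m - n)}"
      by (rule has_sum_cmult_right[OF parseval[OF q Ly']])
    have 3: "((\<lambda>m. if m = j then C * b j else 0) has_sum C * b j) {m. even (m - n)}"
    proof -
      have "((\<lambda>m. if m = j then C * b j else 0) has_sum C * b j) {j}"
        using has_sum_finite[of "{j}" "\<lambda>m. if m = j then C * b j else 0"] by simp
      also have "?this \<longleftrightarrow> ?thesis" using j by (intro has_sum_cong_neutral) auto
      finally show ?thesis .
    qed
    have "((\<lambda>m. Fv j m * b m) has_sum (\<i> * of_int j * fourier_coeff (\<lambda>x. q x * y x) j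
       + (- 1) * fourier_coeff (\<lambda>x. q x * y' x) j + C * b j)) {m. even (m - n)}"
    proof (rule has_sum_cong[THEN iffD2, OF _ has_sum_add[OF has_sum_add[OF 1 2] 3]])
      fix m assume "m \<in> {m. even (m - n)}"
      then have m: "fourier_coeff y' m = \<i> * of_int m * b m" by (intro dy) simp
      show "Fv j m * b m = \<i> * of_int j * (fourier_coeff q (j - m) * b m)
          + (- 1) * (fourier_coeff q (j - m) * fourier_coeff y' m) + (if m = j then C * b j else 0)"
        unfolding m Fv_def hill_coeff_def by (cases "m = j") (simp_all add: algebra_simps)
    qed
    also have "\<i> * of_int j * fourier_coeff (\<lambda>x. q x * y x) j + (- 1) * fourier_coeff (\<lambda>x. q x * y' x) j + C * b j
      = (\<mu> - (of_int j)\<^sup>2) * b j"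
    proof -
      have "\<mu> * b j = - (\<i> * of_int j * (\<i> * of_int j * b j - fourier_coeff (\<lambda>x. q x * y x) j))
          - fourier_coeff (\<lambda>x. q x * y' x) j + C * b j"
        unfolding e2 dw[OF j] e1 dy[OF j] ..
      then show ?thesis by (simp add: algebra_simps power2_eq_square)
    qed
    finally show ?thesis .
  qed
  define f where "f i = b n * Fv i n + b (- n) * Fv i (- n)" for i
  define B where "B i = (\<Sum>\<^sub>\<infinity>m\<in>?J. Fv i m * b m)" for i
  have bB: "?d j * b j = f j + B j" if j: "even (j - n)" for j
  proof -
    note S = full[OF j, unfolded cl(1)]
    from infsumI[OF has_sum_insertD[OF has_sum_insertD[OF S cl(2)] cl(3)]]
    have "B j = (\<mu> - (of_int j)\<^sup>2) * b j - Fv j n * b n - Fv j (- n) * b (- n)" unfolding B_def .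
    then show ?thesis by (simp add: f_def hill_denom_def \<mu> algebra_simps)
  qed
  have v1: "wl2_le ?J ?D (\<lambda>i. b n * Fv i n) (cmod (b n) * l2_bound n)" "wl2_le ?J ?D (\<lambda>i. b (- n) * Fv i (- n)) (cmod (b (- n)) * l2_bound n)"
    by (rule wl2_le_scale[OF matrix_bounds(2)] wl2_le_scale[OF matrix_bounds(3)])+
  obtain \<tau> where vf: "wl2_le ?J ?D f \<tau>" using wl2_le_add[OF v1] unfolding f_def by blast
  have dj: "cmod (?d j) \<le> 2 * ?D j" "4 * ?D j \<le> 4 * (1 + (real_of_int n)\<^sup>2) * (1 + (real_of_int j)\<^sup>2)" if j: "j \<in> ?J" for j
  proof -
    define \<Delta> where "\<Delta> = ?D j"
    have ge: "\<Delta> \<ge> of_int n" unfolding \<Delta>_def using hill_dist_ge[OF j] n by linarith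
    have "(of_int n)\<^sup>2 - (of_int j)\<^sup>2 = complex_of_real ((real_of_int n)\<^sup>2 - (real_of_int j)\<^sup>2)" by simp
    then have \<Delta>: "\<Delta> = cmod ((of_int n)\<^sup>2 - (of_int j)\<^sup>2)" unfolding \<Delta>_def by (simp only: norm_of_real)
    have "cmod (?d j) \<le> \<Delta> + cmod z" unfolding \<Delta> hill_denom_def by (rule norm_triangle_ineq)
    also have "\<dots> \<le> 2 * \<Delta>" using z ge n by linarith
    finally show "cmod (?d j) \<le> 2 * ?D j" unfolding \<Delta>_def .
    have "\<bar>x\<^sup>2 - y\<^sup>2\<bar> \<le> (1 + x\<^sup>2) * (1 + y\<^sup>2)" for x y :: real
      using zero_le_power2[of x] zero_le_power2[of y] mult_nonneg_nonneg[of "x\<^sup>2" "y\<^sup>2"]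
      unfolding abs_le_iff by (simp add: algebra_simps)
    then show "4 * ?D j \<le> 4 * (1 + (real_of_int n)\<^sup>2) * (1 + (real_of_int j)\<^sup>2)"
      unfolding mult.assoc by (intro mult_left_mono) simp_all
  qed
  obtain U where db: "wl2_le ?J ?D (\<lambda>j. ?d j * b j) U"
    using wl2_le_sobolev[OF Ly Ly', of "\<lambda>j. j", OF _ _ dj] dy
    by (auto simp: inj_on_def b_def norm_mult hill_index_def)
  obtain \<tau>' where vB: "wl2_le ?J ?D B \<tau>'"
    using wl2_le_cong[OF wl2_le_add[OF db wl2_le_scale[OF vf, of "- 1"]], of B] bB by (fastforce simp: hill_index_def)
  have dB: "?d m * b m = f m + B m" if "m \<in> ?J" for m
    using that bB by (auto simp: hill_index_def)
  have NB: "(\<lambda>k. b n * tsum ?J ?d Fv Fv (\<lambda>i. Fv i n) (\<lambda>i. Fv i n) (Suc k) i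
      + b (- n) * tsum ?J ?d Fv Fv (\<lambda>i. Fv i (- n)) (\<lambda>i. Fv i (- n)) (Suc k) i) sums B i"
    if row: "wl2_le ?J ?D (Fv i) \<sigma>" for i \<sigma>
    using neumann_expansion[OF matrix_bounds(1,1) vf vf vB vB row B_def B_def B_def dB dB small]
    unfolding f_def tsum_add[OF matrix_bounds(1,1) row v1(1,1,2,2)] tsum_scale if_cancel .
  have sm: "summable (\<lambda>k. tsum ?J ?d Fv Fv (\<lambda>i. Fv i n) (\<lambda>i. Fv i n) (Suc k) i)"
    "summable (\<lambda>k. tsum ?J ?d Fv Fv (\<lambda>i. Fv i (- n)) (\<lambda>i. Fv i (- n)) (Suc k) i)"
    if row: "wl2_le ?J ?D (Fv i) \<sigma>" for i \<sigma>
    by (rule tsum_summable_seq[OF matrix_bounds(1,1,2,2) row small order_refl] tsum_summable_seq[OF matrix_bounds(1,1,3,3) row small order_refl])+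
  have Bi: "B i = b n * (\<Sum>k. hsum n z i n (k + 1)) + b (- n) * (\<Sum>k. hsum n z i (- n) (k + 1))"
    if row: "wl2_le ?J ?D (Fv i) \<sigma>" for i \<sigma>
    unfolding hill_sum_eq_tsum Suc_eq_plus1[symmetric]
    by (rule sums_unique2[OF NB[OF row] sums_add[OF sums_mult[OF summable_sums[OF sm(1)[OF row]]] sums_mult[OF summable_sums[OF sm(2)[OF row]]]]])
  have F0: "Fv n n = C" "Fv (- n) (- n) = C" by (simp_all add: Fv_def hill_coeff_def)
  show ?thesis
  \<comment> \<open>\<open>beta_minus\<close> couples n into the equation at -n, so the component at
    -n comes first.\<close>
  proof (rule determinant_2x2[of z "b (- n)" "alpha n z" _ "b n"])
    have "?d n = z" "?d (- n) = z" by (simp_all add: hill_denom_def)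
    then have "z * b n = f n + B n" "z * b (- n) = f (- n) + B (- n)" using bB[of n] bB[of "- n"] by simp_all
    then show "z * b n = beta_plus (Hill C q) n z * b (- n) + alpha n z * b n"
      "z * b (- n) = alpha n z * b (- n) + beta_minus (Hill C q) n z * b n"
      unfolding Bi[OF matrix_bounds(4)] Bi[OF matrix_bounds(5)] f_def F0 beta_eqs alpha_def hill_sum_reflect
      by (simp_all add: algebra_simps)
    show "b (- n) \<noteq> 0 \<or> b n \<noteq> 0"
    proof (rule ccontr)
      assume "\<not> (b (- n) \<noteq> 0 \<or> b n \<noteq> 0)"
      then have 0: "b n = 0" "b (- n) = 0" by auto
      have zero: "b j = 0" if j: "even (j - n)" for j
      proof (cases "j = n \<or> j = - n")
        case False
        then have J: "j \<in> ?J" using j by (simp add: hill_index_def)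
        have "B j = 0" using Bi[OF whs_le_row[OF matrix_bounds(1) J]] by (simp add: 0)
        then show ?thesis using dB[OF J] d_nz[OF J] by (simp add: f_def 0)
      qed (use 0 in auto)
      have "y x = 0" for x
      proof (cases "x \<in> {0..pi}")
        case True
        show ?thesis
          by (rule fourier_unique[OF cy _ True, where n = n]) (use zero in \<open>simp add: b_def\<close>)
      qed (rule out)
      then show False using y0 by (simp add: fun_eq_iff)
    qed
  qed
qed

end

section \<open>The spectral gap\<close>

text \<open>|a - sqrt b|^2 <= |a - sqrt b| |a + sqrt b| = |a^2 - b|. It needs no positive lower
  bound on b, which matters as the product of the two functionals may vanish.\<close>

lemma sqrt_diff_le:
  assumes "a \<ge> 0" "b \<ge> 0" "\<bar>a\<^sup>2 - b\<bar> \<le> e"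
  shows "\<bar>a - sqrt b\<bar> \<le> sqrt e"
proof -
  have e: "e \<ge> 0" using assms(3) by linarith
  have b: "b = (sqrt b)\<^sup>2" using assms(2) by simp
  have "\<bar>a - sqrt b\<bar>\<^sup>2 \<le> \<bar>a - sqrt b\<bar> * \<bar>a + sqrt b\<bar>"
    unfolding power2_eq_square using assms(1) real_sqrt_ge_zero[OF assms(2)] by (intro mult_left_mono) linarith+
  also have "\<dots> = \<bar>a\<^sup>2 - b\<bar>"
    unfolding abs_mult[symmetric] by (subst (3) b) (simp add: power2_eq_square algebra_simps)
  finally have "\<bar>a - sqrt b\<bar>\<^sup>2 \<le> e" using assms(3) by linarith
  then show ?thesis using real_le_rsqrt by blast
qed

lemma prod_diff_le:
  fixes p q p0 q0 :: complex
  assumes "cmod (p - p0) \<le> r" "cmod (q - q0) \<le> r"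
  shows "cmod (p * q - p0 * q0) \<le> r * (cmod p0 + cmod q0) + r\<^sup>2"
proof -
  have r: "r \<ge> 0" using assms(1) norm_ge_zero order_trans by blast
  have "p * q - p0 * q0 = (p - p0) * (q - q0) + ((p - p0) * q0 + p0 * (q - q0))" by (simp add: algebra_simps)
  then have "cmod (p * q - p0 * q0) \<le> cmod (p - p0) * cmod (q - q0) + (cmod (p - p0) * cmod q0 + cmod p0 * cmod (q - q0))"
    by (metis norm_mult norm_triangle_mono norm_triangle_ineq order_refl)
  also have "\<dots> \<le> r * r + (r * cmod q0 + cmod p0 * r)"
    using assms r by (intro add_mono mult_mono) auto
  finally show ?thesis by (simp add: power2_eq_square algebra_simps)
qed

text \<open>With s the geometric mean of |p0| and |q0|, the upper bound on the gap is the triangle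
  inequality for X - Y. The lower bound uses 2|X| <= |X + Y| + |X - Y| and the smallness of X + Y. A
  crude bound of the gap by 4 D comes first and makes all errors relative to D.\<close>

lemma gap_estimate:
  fixes x y :: complex
  assumes xy: "x \<noteq> y" and \<epsilon>: "0 \<le> \<epsilon>" "\<epsilon> \<le> 1 / 8"
    and sq: "(x - a1)\<^sup>2 = p1 * q1" "(y - a2)\<^sup>2 = p2 * q2"
    and a: "cmod (a1 - a2) \<le> \<epsilon> * cmod (x - y)"
    and p: "cmod (p1 - p0) \<le> \<epsilon> * cmod (x - y)" "cmod (p2 - p0) \<le> \<epsilon> * cmod (x - y)"
    and q: "cmod (q1 - q0) \<le> \<epsilon> * cmod (x - y)" "cmod (q2 - q0) \<le> \<epsilon> * cmod (x - y)"
  defines "D \<equiv> cmod p0 + cmod q0"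
  shows "D > 0" "\<bar>cmod (x - y) - 2 * sqrt (cmod p0 * cmod q0)\<bar> \<le> 14 * sqrt \<epsilon> * D"
proof -
  define g where "g = cmod (x - y)"
  define X where "X = x - a1"
  define Y where "Y = y - a2"
  define s where "s = sqrt (cmod p0 * cmod q0)"
  define e where "e = \<epsilon> * g * D + (\<epsilon> * g)\<^sup>2"
  define r where "r = sqrt \<epsilon>"
  have g: "g > 0" using xy by (simp add: g_def)
  have D0: "D \<ge> 0" by (simp add: D_def)
  have r: "r \<ge> 0" "r\<^sup>2 = \<epsilon>" "\<epsilon> \<le> r"
  proof -
    show "r \<ge> 0" "r\<^sup>2 = \<epsilon>" using \<epsilon> by (simp_all add: r_def)
    have "r \<le> 1" using \<epsilon> by (simp add: r_def)
    then have "r * r \<le> r * 1" using \<open>r \<ge> 0\<close> by (intro mult_left_mono)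
    then show "\<epsilon> \<le> r" using \<open>r\<^sup>2 = \<epsilon>\<close> by (simp add: power2_eq_square)
  qed
  have s: "0 \<le> s" "2 * s \<le> D"
  proof -
    show "0 \<le> s" by (simp add: s_def)
    have "s \<le> D / 2" unfolding s_def D_def using arith_geo_mean_sqrt[of "cmod p0" "cmod q0"] by simp
    then show "2 * s \<le> D" by simp
  qed
  have e0: "e \<ge> 0" using \<epsilon> g D0 by (simp add: e_def)
  have Xe: "cmod (p1 * q1 - p0 * q0) \<le> e" and Ye: "cmod (p2 * q2 - p0 * q0) \<le> e"
    unfolding e_def D_def g_def using prod_diff_le[OF p(1) q(1)] prod_diff_le[OF p(2) q(2)] by (simp_all add: mult_ac)
  have near: "\<bar>cmod Z - s\<bar> \<le> sqrt e" if "Z\<^sup>2 = pq" "cmod (pq - p0 * q0) \<le> e" for Z pq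
    unfolding s_def
  proof (rule sqrt_diff_le)
    have "\<bar>cmod (Z\<^sup>2) - cmod (p0 * q0)\<bar> \<le> cmod (Z\<^sup>2 - p0 * q0)" by (rule norm_triangle_ineq3)
    then show "\<bar>(cmod Z)\<^sup>2 - cmod p0 * cmod q0\<bar> \<le> e"
      using that(2) unfolding norm_mult norm_power[symmetric] that(1) by linarith
  qed auto
  have Xs: "\<bar>cmod X - s\<bar> \<le> sqrt e" and Ys: "\<bar>cmod Y - s\<bar> \<le> sqrt e"
    using near[OF sq(1) Xe] near[OF sq(2) Ye] by (simp_all add: X_def Y_def)
  have XY: "cmod (X - Y) \<le> g + \<epsilon> * g" "g \<le> cmod (X - Y) + \<epsilon> * g"
  proof -
    have eq: "X - Y = (x - y) - (a1 - a2)" by (simp add: X_def Y_def)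
    show "cmod (X - Y) \<le> g + \<epsilon> * g"
      unfolding eq using norm_triangle_ineq4[of "x - y" "a1 - a2"] a by (simp add: g_def)
    show "g \<le> cmod (X - Y) + \<epsilon> * g"
      unfolding eq using norm_triangle_sub[of "x - y" "a1 - a2"] a norm_triangle_ineq2[of "x - y" "a1 - a2"] by (simp add: g_def)
  qed
  have gle: "g \<le> 2 * s + 2 * sqrt e + \<epsilon> * g"
    using XY(2) norm_triangle_ineq4[of X Y] Xs Ys by linarith
  have g4: "g \<le> 4 * D"
  proof -
    \<comment> \<open>With u = \<epsilon> g, AM-GM for u D keeps this bound linear in g. Inserted
      into \<open>gle\<close> with 2 s <= D it yields g <= 2 D + 4 u, and \<epsilon> <= 1/8 absorbs
      4 u into half of g.\<close>
    have "sqrt e \<le> sqrt (((\<epsilon> * g + D) / 2 + \<epsilon> * g)\<^sup>2)"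
    proof (rule real_sqrt_le_mono)
      have "\<epsilon> * g * D \<le> ((\<epsilon> * g + D) / 2)\<^sup>2"
        using zero_le_power2[of "\<epsilon> * g - D"] by (simp add: power2_eq_square field_simps)
      moreover have "0 \<le> (\<epsilon> * g + D) / 2 * (\<epsilon> * g)" using \<epsilon> g D0 by simp
      moreover have "((\<epsilon> * g + D) / 2 + \<epsilon> * g)\<^sup>2 = ((\<epsilon> * g + D) / 2)\<^sup>2 + 2 * ((\<epsilon> * g + D) / 2 * (\<epsilon> * g)) + (\<epsilon> * g)\<^sup>2"
        by (simp add: power2_sum)
      ultimately show "e \<le> ((\<epsilon> * g + D) / 2 + \<epsilon> * g)\<^sup>2" unfolding e_def by linarith
    qed
    also have "\<dots> = (\<epsilon> * g + D) / 2 + \<epsilon> * g" using \<epsilon> g D0 by simp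
    finally have "sqrt e \<le> (\<epsilon> * g + D) / 2 + \<epsilon> * g" .
    moreover have "g \<le> 2 * D + 4 * u" if "r \<le> (u + D) / 2 + u" "g \<le> 2 * s + 2 * r + u" for u r
      using that s(2) by (simp add: field_simps)
    ultimately have "g \<le> 2 * D + 4 * (\<epsilon> * g)" using gle by blast
    moreover have "\<epsilon> * g \<le> 1 / 8 * g" using \<epsilon> g by (intro mult_right_mono) auto
    ultimately show ?thesis by linarith
  qed
  then show Dpos: "D > 0" using g by linarith
  have \<epsilon>g: "\<epsilon> * g \<le> 4 * (\<epsilon> * D)" using mult_left_mono[OF g4 \<epsilon>(1)] by simp
  have \<epsilon>rD: "\<epsilon> * D \<le> r * D" using r(3) D0 by (rule mult_right_mono)
  \<comment> \<open>By g <= 4 D the two parts of \<open>e\<close> are at most 4 and 2 times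
    \<epsilon> D^2; 9 is the next square above 6.\<close>
  have "sqrt e \<le> sqrt ((3 * r * D)\<^sup>2)"
  proof (rule real_sqrt_le_mono)
    have "\<epsilon> * g * D \<le> 4 * (\<epsilon> * D) * D" using \<epsilon>g D0 by (intro mult_right_mono)
    moreover have "(\<epsilon> * g)\<^sup>2 \<le> (4 * (\<epsilon> * D))\<^sup>2" using \<epsilon>g \<epsilon> g by (intro power_mono) auto
    moreover have "(4 * (\<epsilon> * D))\<^sup>2 \<le> 2 * (\<epsilon> * D\<^sup>2)"
    proof -
      have "(4 * (\<epsilon> * D))\<^sup>2 = (16 * \<epsilon>) * (\<epsilon> * D\<^sup>2)" by (simp add: power2_eq_square)
      also have "\<dots> \<le> 2 * (\<epsilon> * D\<^sup>2)" using \<epsilon> by (intro mult_right_mono) auto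
      finally show ?thesis .
    qed
    moreover have "(3 * r * D)\<^sup>2 = 9 * (\<epsilon> * D\<^sup>2)" using r(2) by (simp add: power_mult_distrib)
    moreover have "4 * (\<epsilon> * D) * D = 4 * (\<epsilon> * D\<^sup>2)" by (simp add: power2_eq_square)
    moreover have "0 \<le> \<epsilon> * D\<^sup>2" using \<epsilon> by simp
    ultimately show "e \<le> (3 * r * D)\<^sup>2" unfolding e_def by linarith
  qed
  also have "\<dots> = 3 * (r * D)" using r D0 by simp
  finally have se: "sqrt e \<le> 3 * (r * D)" .
  have up: "g \<le> 2 * s + 10 * (r * D)" using gle se \<epsilon>g \<epsilon>rD by linarith
  \<comment> \<open>Factor X^2 - Y^2: the product is at most 2 e, which carries a factor g, while |X
    - Y| is at least 7/8 of g. Dividing by g leaves 24/7 <= 4 times \<epsilon> D.\<close>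
  have "cmod (X + Y) \<le> 4 * (\<epsilon> * D)"
  proof -
    have "cmod (X + Y) * cmod (X - Y) = cmod (p1 * q1 - p2 * q2)"
      unfolding norm_mult[symmetric] sq(1)[symmetric] sq(2)[symmetric] X_def Y_def
      by (simp add: power2_eq_square algebra_simps)
    also have "\<dots> \<le> e + e"
      using norm_triangle_ineq4[of "p1 * q1 - p0 * q0" "p2 * q2 - p0 * q0"] Xe Ye by simp
    also have "\<dots> = 2 * (\<epsilon> * D + \<epsilon> * (\<epsilon> * g)) * g" by (simp add: e_def power2_eq_square algebra_simps)
    also have "\<dots> \<le> 2 * (\<epsilon> * D + 1 / 8 * (4 * (\<epsilon> * D))) * g"
    proof -
      have "\<epsilon> * (\<epsilon> * g) \<le> 1 / 8 * (4 * (\<epsilon> * D))" using \<epsilon> \<epsilon>g g by (rule_tac mult_mono) auto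
      then show ?thesis using g by (intro mult_right_mono mult_left_mono add_left_mono) auto
    qed
    finally have *: "cmod (X + Y) * cmod (X - Y) \<le> 3 * (\<epsilon> * D) * g" by (simp add: mult_ac)
    have "\<epsilon> * g \<le> 1 / 8 * g" using \<epsilon> g by (intro mult_right_mono) auto
    then have "7 / 8 * g \<le> cmod (X - Y)" using XY(2) by linarith
    then have "cmod (X + Y) * (7 / 8 * g) \<le> cmod (X + Y) * cmod (X - Y)" by (rule mult_left_mono) simp
    also note *
    finally have "(cmod (X + Y) * (7 / 8)) * g \<le> (3 * (\<epsilon> * D)) * g" by (simp add: mult_ac)
    then have "cmod (X + Y) * (7 / 8) \<le> 3 * (\<epsilon> * D)" using g by (rule mult_right_le_imp_le)
    moreover have "0 \<le> \<epsilon> * D" using \<epsilon> D0 by simp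
    ultimately show ?thesis by linarith
  qed
  moreover have "2 * cmod X \<le> cmod (X + Y) + cmod (X - Y)"
  proof -
    have "2 * X = (X + Y) + (X - Y)" by simp
    then have "cmod (2 * X) \<le> cmod (X + Y) + cmod (X - Y)" by (simp only:) (rule norm_triangle_ineq)
    then show ?thesis by (simp add: norm_mult)
  qed
  \<comment> \<open>The 14 is 4 from X + Y, 4 from \<epsilon> g in the bound for X - Y, and 6 from
    twice the error of |X| against s.\<close>
  ultimately have lo: "2 * s \<le> g + 14 * (r * D)" using XY(1) Xs se \<epsilon>g \<epsilon>rD by linarith
  have "0 \<le> r * D" using r D0 by simp
  then have "\<bar>g - 2 * s\<bar> \<le> 14 * (r * D)" using up lo by linarith
  then show "\<bar>cmod (x - y) - 2 * sqrt (cmod p0 * cmod q0)\<bar> \<le> 14 * sqrt \<epsilon> * D"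
    by (simp only: g_def s_def r_def mult.assoc)
qed

text \<open>The function 2 sqrt t / (1 + t) is invariant under inversion of t, so it does not matter
  which quotient the maximum picks. If one of the two numbers is 0, both sides are 0.\<close>

lemma t_bound_eq:
  fixes bm bp :: complex
  defines "D \<equiv> cmod bm + cmod bp"
  assumes "D > 0"
  shows "t_bound (if bm * bp \<noteq> 0 then ereal (max (cmod bm / cmod bp) (cmod bp / cmod bm)) else \<infinity>)
    = 2 * sqrt (cmod bm * cmod bp) / D"
proof (cases "bm * bp = 0")
  case True
  then have "cmod bm * cmod bp = 0" by auto
  then show ?thesis using True by (simp add: t_bound_def)
next
  case False
  have r: "2 * sqrt (x / y) / (1 + x / y) = 2 * sqrt (x * y) / (x + y)" if "x > 0" "y > 0" for x y :: real
  proof -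
    have "x / y = (x * y) / y\<^sup>2" using that by (simp add: power2_eq_square)
    then have "sqrt (x / y) = sqrt (x * y) / y" using that by (simp add: real_sqrt_divide)
    moreover have "1 + x / y = (x + y) / y" using that by (simp add: field_simps)
    ultimately show ?thesis using that by simp
  qed
  have p: "cmod bm > 0" "cmod bp > 0" using False by auto
  have "t_bound (ereal (max (cmod bm / cmod bp) (cmod bp / cmod bm))) = 2 * sqrt (cmod bm * cmod bp) / D"
    using r[OF p] r[OF p(2,1)] unfolding t_bound_def D_def
    by (auto simp: max_def mult.commute add.commute)
  then show ?thesis using False by simp
qed

section \<open>From the gap estimate to the asymptotics\<close>

lemma eventually_cofinite_int:
  assumes "eventually P (cofinite :: int filter)"
  shows "\<exists>N::nat. \<forall>n. \<bar>n\<bar> > int N \<longrightarrow> P n"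
proof -
  have "finite ((\<lambda>n. nat \<bar>n\<bar>) ` {n. \<not> P n})" using assms unfolding eventually_cofinite by simp
  then obtain N where N: "\<And>n. \<not> P n \<Longrightarrow> nat \<bar>n\<bar> \<le> N"
    unfolding finite_nat_set_iff_bounded_le by auto
  show ?thesis
  proof (intro exI allI impI)
    fix n :: int assume "\<bar>n\<bar> > int N"
    then show "P n" using N[of n] by linarith
  qed
qed

text \<open>Common interface of the two operators. \<open>S\<close> will be the smallness of the
  Hilbert-Schmidt norm, which holds off a finite set of indices.\<close>

lemma conclusion_from_estimates:
  fixes v :: potential and \<alpha> :: "int \<Rightarrow> complex \<Rightarrow> complex" and \<epsilon> :: "int \<Rightarrow> real"
  assumes \<epsilon>: "(\<epsilon> \<longlongrightarrow> 0) cofinite" "\<And>n. \<epsilon> n \<ge> 0" and S: "eventually S cofinite"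
    and lip: "\<And>n h. S n \<Longrightarrow> n \<in> indices v \<Longrightarrow> h \<in> {\<alpha> n, beta_minus v n, beta_plus v n} \<Longrightarrow>
        (\<epsilon> n)-lipschitz_on (cball 0 (radius v n)) h"
    and ev: "\<And>n z. S n \<Longrightarrow> n \<in> indices v \<Longrightarrow> cmod z \<le> radius v n \<Longrightarrow> per_eigenvalue v (per_sign n) (lam0 v n + z) \<Longrightarrow>
        (z - \<alpha> n z)\<^sup>2 = beta_minus v n z * beta_plus v n z"
    and M: "M = {n \<in> indices v. lam_plus v n \<noteq> lam_minus v n}"
  shows "\<exists>(Nstar::nat) (\<eta>::int \<Rightarrow> real).
    (\<forall>n. \<eta> n > 0) \<and> (\<eta> \<longlongrightarrow> 0) cofinite \<and>
    (\<forall>n\<in>M. \<bar>n\<bar> > int Nstar \<longrightarrow>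
       (let d = cmod (beta_minus v n (z_star v n)) + cmod (beta_plus v n (z_star v n)) in
        d \<noteq> 0 \<and>
        t_bound (t_ratio v n) - \<eta> n \<le> cmod (gam v n) / d \<and>
        cmod (gam v n) / d \<le> t_bound (t_ratio v n) + \<eta> n))"
proof -
  \<comment> \<open>The second summand makes the sequence strictly positive even where \<epsilon>
    vanishes.\<close>
  define \<eta> where "\<eta> n = 14 * sqrt (\<epsilon> n) + 1 / (1 + \<bar>real_of_int n\<bar>)" for n
  have "eventually (\<lambda>n. \<epsilon> n < 1 / 8) cofinite" using order_tendstoD(2)[OF \<epsilon>(1), of "1 / 8"] by simp
  from eventually_cofinite_int[OF eventually_conj[OF this S]]
  obtain N :: nat where N: "\<And>n. \<bar>n\<bar> > int N \<Longrightarrow> \<epsilon> n < 1 / 8" "\<And>n. \<bar>n\<bar> > int N \<Longrightarrow> S n"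
    by blast
  have \<eta>pos: "\<eta> n > 0" for n using \<epsilon>(2)[of n] by (simp add: \<eta>_def add_nonneg_pos)
  have "filterlim (\<lambda>n::int. 1 + \<bar>real_of_int n\<bar>) at_top cofinite"
    by (rule filterlim_tendsto_add_at_top[OF tendsto_const filterlim_abs_cofinite])
  then have "((\<lambda>n::int. 1 / (1 + \<bar>real_of_int n\<bar>)) \<longlongrightarrow> 0) cofinite"
    by (intro tendsto_divide_0[OF tendsto_const] filterlim_at_top_imp_at_infinity)
  then have "((\<lambda>n. 14 * sqrt (\<epsilon> n) + 1 / (1 + \<bar>real_of_int n\<bar>)) \<longlongrightarrow> 14 * sqrt 0 + 0) cofinite"
    by (intro tendsto_intros \<epsilon>(1))
  then have \<eta>0: "(\<eta> \<longlongrightarrow> 0) cofinite" by (simp add: \<eta>_def [abs_def])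
  have "(let d = cmod (beta_minus v n (z_star v n)) + cmod (beta_plus v n (z_star v n)) in
        d \<noteq> 0 \<and>
        t_bound (t_ratio v n) - \<eta> n \<le> cmod (gam v n) / d \<and>
        cmod (gam v n) / d \<le> t_bound (t_ratio v n) + \<eta> n)" if n: "n \<in> M" "\<bar>n\<bar> > int N" for n
  proof -
    have ne: "lam_plus v n \<noteq> lam_minus v n" and ind: "n \<in> indices v" using n M by auto
    \<comment> \<open>Without a pair both values default to \<open>lam0 v n\<close> and would
      coincide, contrary to membership in \<open>M\<close>.\<close>
    then obtain a b where ab: "eigenvalue_pair v n a b"
      unfolding lam_plus_def lam_minus_def by (metis (full_types))
    note lam = lam_eqI[OF ab]
    have eset: "{\<mu>. per_eigenvalue v (per_sign n) \<mu> \<and> cmod (\<mu> - lam0 v n) < radius v n} = {a, b}"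
      using ab unfolding eigenvalue_pair_def by blast
    have ev': "per_eigenvalue v (per_sign n) \<mu> \<and> cmod (\<mu> - lam0 v n) \<le> radius v n" if "\<mu> \<in> {a, b}" for \<mu>
      using that unfolding eset[symmetric] by auto
    define x where "x = b - lam0 v n"
    define y where "y = a - lam0 v n"
    define z where "z = z_star v n"
    have zeq: "z = (x + y) / 2" by (simp add: z_def z_star_def z_plus_def z_minus_def lam x_def y_def)
    have xyg: "x - y = gam v n" by (simp add: x_def y_def gam_def lam)
    have xr: "cmod x \<le> radius v n" and yr: "cmod y \<le> radius v n" using ev' by (auto simp: x_def y_def)
    \<comment> \<open>The disc is convex, so the midpoint of the two roots stays in the domain of
      the Lipschitz bounds.\<close>
    have zr: "cmod z \<le> radius v n"
      unfolding zeq using norm_triangle_ineq[of x y] xr yr by (simp add: norm_divide)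
    have half: "cmod (x - z) = cmod (x - y) / 2" "cmod (y - z) = cmod (x - y) / 2"
    proof -
      have e: "x - z = (x - y) / 2" "y - z = (y - x) / 2" by (simp_all add: zeq field_simps)
      show "cmod (x - z) = cmod (x - y) / 2" unfolding e(1) by (simp add: norm_divide)
      show "cmod (y - z) = cmod (x - y) / 2" unfolding e(2) norm_minus_commute[of x y] by (simp add: norm_divide)
    qed
    have le: "\<epsilon> n * (cmod (x - y) / 2) \<le> \<epsilon> n * cmod (x - y)"
      using \<epsilon>(2)[of n] by (intro mult_left_mono) auto
    have L: "cmod (h u - h u') \<le> \<epsilon> n * cmod (u - u')"
      if "cmod u \<le> radius v n" "cmod u' \<le> radius v n" "h \<in> {\<alpha> n, beta_minus v n, beta_plus v n}" for u u' h
      using that by (intro lipschitz_on_normD[OF lip[OF N(2)[OF n(2)] ind]]) auto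
    have sx: "(x - \<alpha> n x)\<^sup>2 = beta_minus v n x * beta_plus v n x"
      by (rule ev[OF N(2)[OF n(2)] ind xr]) (use ev' in \<open>simp add: x_def\<close>)
    have sy: "(y - \<alpha> n y)\<^sup>2 = beta_minus v n y * beta_plus v n y"
      by (rule ev[OF N(2)[OF n(2)] ind yr]) (use ev' in \<open>simp add: y_def\<close>)
    define d where "d = cmod (beta_minus v n z) + cmod (beta_plus v n z)"
    have xy: "x \<noteq> y" using ne by (simp add: lam x_def y_def)
    have pq: "cmod (beta_minus v n x - beta_minus v n z) \<le> \<epsilon> n * cmod (x - y)" "cmod (beta_minus v n y - beta_minus v n z) \<le> \<epsilon> n * cmod (x - y)"
      "cmod (beta_plus v n x - beta_plus v n z) \<le> \<epsilon> n * cmod (x - y)" "cmod (beta_plus v n y - beta_plus v n z) \<le> \<epsilon> n * cmod (x - y)"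
      using L[OF xr zr] L[OF yr zr] le unfolding half by (meson insertI1 insertI2 order_trans)+
    note G = gap_estimate[OF xy \<epsilon>(2) less_imp_le[OF N(1)[OF n(2)]] sx sy L[OF xr yr insertI1] pq, folded d_def]
    have t: "t_bound (t_ratio v n) = 2 * sqrt (cmod (beta_minus v n z) * cmod (beta_plus v n z)) / d"
      unfolding t_ratio_def Let_def z_def[symmetric] d_def by (rule t_bound_eq) (use G(1) in \<open>simp add: d_def\<close>)
    have "\<bar>cmod (gam v n) / d - t_bound (t_ratio v n)\<bar> = \<bar>cmod (x - y) - 2 * sqrt (cmod (beta_minus v n z) * cmod (beta_plus v n z))\<bar> / d"
      unfolding t xyg diff_divide_distrib[symmetric] using G(1) by (simp add: abs_divide)
    also have "\<dots> \<le> 14 * sqrt (\<epsilon> n) * d / d"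
      using G by (intro divide_right_mono) auto
    also have "\<dots> = 14 * sqrt (\<epsilon> n)" using G(1) by simp
    also have "\<dots> \<le> \<eta> n" by (simp add: \<eta>_def)
    finally have "\<bar>cmod (gam v n) / d - t_bound (t_ratio v n)\<bar> \<le> \<eta> n" .
    then show ?thesis unfolding Let_def z_def[symmetric] d_def[symmetric] using G(1) by linarith
  qed
  with \<eta>pos \<eta>0 show ?thesis by blast
qed

theorem proposition6:
  fixes v :: potential and M :: "int set"
  assumes "admissible v"
    and M_def: "M = {n \<in> indices v. lam_plus v n \<noteq> lam_minus v n}"
    and "infinite M"
  shows "\<exists>(Nstar::nat) (\<eta>::int \<Rightarrow> real).
    (\<forall>n. \<eta> n > 0) \<and> (\<eta> \<longlongrightarrow> 0) cofinite \<and>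
    (\<forall>n\<in>M. \<bar>n\<bar> > int Nstar \<longrightarrow>
       (let d = cmod (beta_minus v n (z_star v n)) + cmod (beta_plus v n (z_star v n)) in
        d \<noteq> 0 \<and>
        t_bound (t_ratio v n) - \<eta> n \<le> cmod (gam v n) / d \<and>
        cmod (gam v n) / d \<le> t_bound (t_ratio v n) + \<eta> n))"
proof (cases v)
  case (Hill C q)
  interpret hill_potential C q
    using assms(1) by unfold_locales (auto simp: Hill)
  note tl = tail_sum_tendsto_0[OF weight_bounded]
  have W: "weight_total \<ge> 0" by (rule sums_boundedD(3)[OF weight_bounded])
  \<comment> \<open>The Lipschitz constant of the Hill functionals: the growth of the coupling
    vectors has already been divided by |n|.\<close>
  define \<epsilon> where "\<epsilon> n = 8 * (weight_total / \<bar>real_of_int n\<bar> + 4 * tail_sum weight n)" for n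
  have "((\<lambda>n. 8 * (weight_total * (1 / \<bar>real_of_int n\<bar>) + 4 * tail_sum weight n)) \<longlongrightarrow> 8 * (weight_total * 0 + 4 * 0)) cofinite"
    by (intro tendsto_intros tl inverse_abs_tendsto_0)
  then have \<epsilon>0: "(\<epsilon> \<longlongrightarrow> 0) cofinite" by (simp add: \<epsilon>_def [abs_def])
  have \<epsilon>: "\<epsilon> n \<ge> 0" for n using W tail_nonneg[of n] by (simp add: \<epsilon>_def)
  have "((\<lambda>n::int. weight_total * (1 / sqrt (1 + 2 * \<bar>real_of_int n\<bar>))) \<longlongrightarrow> 0) cofinite"
  proof (rule tendsto_mult_right_zero)
    have "filterlim (\<lambda>n::int. 2 * \<bar>real_of_int n\<bar>) at_top cofinite"
      by (intro filterlim_tendsto_pos_mult_at_top[OF tendsto_const _ filterlim_abs_cofinite]) simp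
    then have "filterlim (\<lambda>n::int. 1 + 2 * \<bar>real_of_int n\<bar>) at_top cofinite"
      by (rule filterlim_tendsto_add_at_top[OF tendsto_const])
    then show "((\<lambda>n::int. 1 / sqrt (1 + 2 * \<bar>real_of_int n\<bar>)) \<longlongrightarrow> 0) cofinite"
      by (intro tendsto_divide_0[OF tendsto_const] filterlim_at_top_imp_at_infinity filterlim_compose[OF sqrt_at_top])
  qed
  then have "((\<lambda>n. sqrt (8 * cubic_total * (weight_total * (1 / sqrt (1 + 2 * \<bar>real_of_int n\<bar>)) + tail_sum weight n))) \<longlongrightarrow> sqrt (8 * cubic_total * (0 + 0))) cofinite"
    by (intro tendsto_intros tl)
  then have "(hs_bound \<longlongrightarrow> 0) cofinite" by (simp add: hs_bound_def [abs_def])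
  from order_tendstoD(2)[OF this, of "1 / 8"] have small: "eventually (\<lambda>n. hs_bound n \<le> 1 / 8) cofinite"
    by (auto elim: eventually_mono)
  show ?thesis
  proof (rule conclusion_from_estimates[OF \<epsilon>0 \<epsilon> small _ _ M_def, where \<alpha> = alpha])
    fix n :: int and z :: complex and h
    assume n: "hs_bound n \<le> 1 / 8" "n \<in> indices v"
    show "per_eigenvalue v (per_sign n) (lam0 v n + z) \<Longrightarrow> (z - alpha n z)\<^sup>2 = beta_minus v n z * beta_plus v n z"
      if z: "cmod z \<le> radius v n"
      using n(2) z unfolding Hill indices.simps radius.simps per_eigenvalue.simps lam0.simps
      by (intro eigenvalue_equation[OF _ refl _ _ n(1)]) auto
    assume h: "h \<in> {alpha n, beta_minus v n, beta_plus v n}"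
    show "(\<epsilon> n)-lipschitz_on (cball 0 (radius v n)) h"
    proof (intro lipschitz_onI \<epsilon>)
      fix x y :: complex assume "x \<in> cball 0 (radius v n)" "y \<in> cball 0 (radius v n)"
      then have xy: "cmod x \<le> of_int n / 4" "cmod y \<le> of_int n / 4" by (simp_all add: Hill)
      have "1 \<le> n" using n(2) by (simp add: Hill)
      note L = lipschitz[OF this xy n(1), folded \<epsilon>_def]
      from h L show "dist (h x) (h y) \<le> \<epsilon> n * dist x y"
        unfolding Hill dist_norm by (elim insertE emptyE) (simp_all del: beta_minus.simps beta_plus.simps)
    qed
  qed
next
  case (Dirac P Q)
  interpret dirac_potential P Q
    using assms(1) by unfold_locales (auto simp: Dirac)
  note tl = tail_sum_tendsto_0[OF weight_bounded]
  define \<epsilon> where "\<epsilon> n = 16 * tail_sum weight n" for n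
  have "((\<lambda>n. 16 * tail_sum weight n) \<longlongrightarrow> 16 * 0) cofinite"
    by (intro tendsto_intros tl)
  then have \<epsilon>0: "(\<epsilon> \<longlongrightarrow> 0) cofinite" by (simp add: \<epsilon>_def [abs_def])
  have \<epsilon>: "\<epsilon> n \<ge> 0" for n using tail_sum_nonneg[OF weight_bounded weight_sym, of n] by (simp add: \<epsilon>_def)
  have "((\<lambda>n. sqrt (4 * cubic_total * tail_sum weight n)) \<longlongrightarrow> sqrt (4 * cubic_total * 0)) cofinite"
    by (intro tendsto_intros tl)
  then have "(hs_bound \<longlongrightarrow> 0) cofinite" by (simp add: hs_bound_def [abs_def])
  from order_tendstoD(2)[OF this, of "1 / 8"] have small: "eventually (\<lambda>n. hs_bound n \<le> 1 / 8) cofinite"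
    by (auto elim: eventually_mono)
  show ?thesis
  proof (rule conclusion_from_estimates[OF \<epsilon>0 \<epsilon> small _ _ M_def, where \<alpha> = alpha])
    fix n :: int and z :: complex and h
    assume n: "hs_bound n \<le> 1 / 8" "n \<in> indices v"
    show "per_eigenvalue v (per_sign n) (lam0 v n + z) \<Longrightarrow> (z - alpha n z)\<^sup>2 = beta_minus v n z * beta_plus v n z"
      if z: "cmod z \<le> radius v n"
      using n(2) z unfolding Dirac indices.simps radius.simps per_eigenvalue.simps lam0.simps
      by (intro eigenvalue_equation[OF _ refl _ n(1)]) auto
    assume h: "h \<in> {alpha n, beta_minus v n, beta_plus v n}"
    show "(\<epsilon> n)-lipschitz_on (cball 0 (radius v n)) h"
    proof (intro lipschitz_onI \<epsilon>)
      fix x y :: complex assume "x \<in> cball 0 (radius v n)" "y \<in> cball 0 (radius v n)"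
      then have "cmod x \<le> 1 / 2" "cmod y \<le> 1 / 2" by (simp_all add: Dirac)
      note L = lipschitz[OF this n(1), folded \<epsilon>_def]
      from h L show "dist (h x) (h y) \<le> \<epsilon> n * dist x y"
        unfolding Dirac dist_norm by (elim insertE emptyE) (simp_all del: beta_minus.simps beta_plus.simps)
    qed
  qed
qed

end
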